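(* For every integer $n\geq 1$, there exists a partial subdivision of the neighborhood complex $\mathcal{N}(SG_{n,2})$ (obtained by subdividing some of its faces) which simplicially collapses onto a subcomplex that is the boundary complex of a three-dimensional simplicial polytope and that is invariant under the action induced by the automorphism group of $SG_{n,2}$.
   Context: For a graph $G=(V,E)$, the neighborhood complex $\mathcal{N}(G)$ is the simplicial complex on vertex set $V$ whose faces are the subsets $F\subseteq V$ having a common neighbor. An $n$-subset of $[2n+2]$ is stable if it contains no two cyclically consecutive elements of $\mathbb{Z}/(2n+2)$ (i.e. no $\{i,i+1\}$, $1\le i\le 2n+1$, and not $\{1,2n+2\}$). The stable Kneser graph $SG_{n,2}$ has the stable $n$-subsets of $[2n+2]$ as vertices, adjacent iff disjoint. Its automorphism group is the dihedral group of order $2(2n+2)$, acting via the natural action of the dihedral group on $[2n+2]$ viewed as the vertices of a regular $(2n+2)$-gon labeled cyclically; this induces a simplicial action on $\mathcal{N}(SG_{n,2})$ and on the subdivision (with subdivision vertices, such as barycenters of faces, permuted accordingly). A simplicial collapse is a sequence of elementary collapses removing a free face together with the unique face properly containing it. *)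

theory Defs
  imports "HOL-Analysis.Analysis"
begin

text \<open>An abstract simplicial complex is given by its set of faces; the empty face is included.\<close>

definition neighborhood_complex :: "'a set \<Rightarrow> ('a \<Rightarrow> 'a \<Rightarrow> bool) \<Rightarrow> 'a set set" where
  "neighborhood_complex V adj = {F. F \<subseteq> V \<and> (\<exists>x\<in>V. \<forall>y\<in>F. adj x y)}"

definition graph_automorphism :: "'a set \<Rightarrow> ('a \<Rightarrow> 'a \<Rightarrow> bool) \<Rightarrow> ('a \<Rightarrow> 'a) \<Rightarrow> bool" where
  "graph_automorphism V adj \<phi> \<longleftrightarrow>
     bij_betw \<phi> V V \<and> (\<forall>x\<in>V. \<forall>y\<in>V. adj (\<phi> x) (\<phi> y) \<longleftrightarrow> adj x y)"

definition SG_vertices :: "nat \<Rightarrow> nat set set" where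
  "SG_vertices n = {A. A \<subseteq> {1..2*n+2} \<and> card A = n \<and>
     (\<forall>i\<in>{1..2*n+1}. \<not> {i, i+1} \<subseteq> A) \<and> \<not> {1, 2*n+2} \<subseteq> A}"

definition SG_adj :: "nat set \<Rightarrow> nat set \<Rightarrow> bool" where
  "SG_adj A B \<longleftrightarrow> A \<inter> B = {}"

text \<open>Stellar subdivision of \<open>K\<close> at its nonempty face \<open>\<sigma>\<close>, with new vertex \<open>b\<close>: the open star of
  \<open>\<sigma>\<close> is replaced by the cone with apex \<open>b\<close> over the faces of the closed star that do not
  contain \<open>\<sigma>\<close>.\<close>

definition stellar_subdivision :: "'a set set \<Rightarrow> 'a set \<Rightarrow> 'a \<Rightarrow> 'a set set" where
  "stellar_subdivision K \<sigma> b =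
     {\<tau>\<in>K. \<not> \<sigma> \<subseteq> \<tau>} \<union> {insert b \<tau> | \<tau>. \<not> \<sigma> \<subseteq> \<tau> \<and> \<tau> \<union> \<sigma> \<in> K}"

text \<open>A face of \<open>K\<close>, written in the vertex set of a subdivision. The vertices of a subdivision of
  \<open>K\<close> are nonempty faces of \<open>K\<close>: the singleton \<open>{v}\<close> stands for the original vertex \<open>v\<close>, and a
  face \<open>F\<close> with at least two elements stands for the subdivision vertex (e.g. the barycenter)
  placed in the interior of \<open>F\<close>.\<close>

definition embed_face :: "'a set \<Rightarrow> 'a set set" where
  "embed_face F = (\<lambda>v. {v}) ` F"

text \<open>Some of the faces of \<open>K\<close> are subdivided one after the other. A face can only be subdivided
  while it is still intact, hence at most once, so its label \<open>F\<close> is fresh. (If \<open>F\<close> is a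
  single vertex, the step changes nothing.) Subdividing all faces in order of decreasing
  dimension gives the barycentric subdivision.\<close>

inductive partial_subdivision :: "'a set set \<Rightarrow> 'a set set set \<Rightarrow> bool" for K where
  start: "partial_subdivision K (embed_face ` K)"
| subdivide: "partial_subdivision K (stellar_subdivision K' (embed_face F) F)"
    if "partial_subdivision K K'" "F \<in> K" "F \<noteq> {}" "embed_face F \<in> K'"

text \<open>A vertex map \<open>\<phi>\<close> of \<open>K\<close> sends the subdivision vertex of \<open>F\<close> to that of \<open>\<phi> ` F\<close>.\<close>

definition induced_action :: "('a \<Rightarrow> 'a) \<Rightarrow> 'a set set \<Rightarrow> 'a set set" where
  "induced_action \<phi> \<sigma> = (\<lambda>F. \<phi> ` F) ` \<sigma>"

definition aut_invariant :: "'a set \<Rightarrow> ('a \<Rightarrow> 'a \<Rightarrow> bool) \<Rightarrow> 'a set set set \<Rightarrow> bool" where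
  "aut_invariant V adj L \<longleftrightarrow> (\<forall>\<phi>. graph_automorphism V adj \<phi> \<longrightarrow> induced_action \<phi> ` L = L)"

text \<open>The empty face never counts as a free face; otherwise a point would collapse to the void
  complex.\<close>

definition elementary_collapse :: "'a set set \<Rightarrow> 'a set set \<Rightarrow> bool" where
  "elementary_collapse K L \<longleftrightarrow>
     (\<exists>\<sigma>\<in>K. \<exists>\<tau>\<in>K. \<sigma> \<noteq> {} \<and> \<sigma> \<subset> \<tau> \<and> (\<forall>\<rho>\<in>K. \<sigma> \<subset> \<rho> \<longrightarrow> \<rho> = \<tau>) \<and> L = K - {\<sigma>, \<tau>})"

definition collapses :: "'a set set \<Rightarrow> 'a set set \<Rightarrow> bool" where
  "collapses = elementary_collapse\<^sup>*\<^sup>*"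

definition simplicial_polytope :: "'a::euclidean_space set \<Rightarrow> bool" where
  "simplicial_polytope P \<longleftrightarrow> polytope P \<and> (\<forall>F. F facet_of P \<longrightarrow> (\<exists>k. k simplex F))"

text \<open>The boundary complex as an abstract complex: the vertex sets of the proper faces.\<close>

definition boundary_complex :: "'a::euclidean_space set \<Rightarrow> 'a set set" where
  "boundary_complex P = {{x. x extreme_point_of F} | F. F face_of P \<and> F \<noteq> P}"

definition complex_isomorphic :: "'a set set \<Rightarrow> 'b set set \<Rightarrow> bool" where
  "complex_isomorphic K L \<longleftrightarrow> (\<exists>f. bij_betw f (\<Union>K) (\<Union>L) \<and> (\<lambda>\<sigma>. f ` \<sigma>) ` K = L)"

definition is_boundary_of_simplicial_3_polytope :: "'a set set \<Rightarrow> bool" where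
  "is_boundary_of_simplicial_3_polytope L \<longleftrightarrow>
     (\<exists>P :: (real^3) set. simplicial_polytope P \<and> aff_dim P = 3 \<and>
        complex_isomorphic L (boundary_complex P))"

end

theory Submission imports Defs begin

text \<open>Write \<open>N = n + 1\<close>. A stable \<open>n\<close>-subset of the \<open>2 N\<close>-cycle alternates except at two places,
  so it consists of the even elements of an arc and the odd elements of the complementary arc. The
  centre \<open>q\<close> and the radius \<open>k\<close> of the first arc place the stable sets on \<open>N\<close> levels with \<open>N\<close>
  vertices each, consecutive levels being staggered as in an antiprism. In these coordinates the
  neighbourhood of a vertex consists of the lattice neighbours of the antipodal point
  \<open>(N + 1 - k, q + N)\<close>: a square with corners \<open>(k, q \<plusminus> 1)\<close>, \<open>(k \<plusminus> 1, q)\<close> in general, and a whole end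
  level plus one vertex of the next level if the centre lies on an end level. Subdividing the
  simplices spanned by the two end levels adds two poles. All faces containing the vertical diagonal
  of a square, or an edge near a pole that does not belong to the desired sphere, can be collapsed
  away; what remains is the stack of antiprisms closed by two pyramids.

  Placing the levels on parallel circles with radii \<open>cos (j \<phi>)\<close>, where \<open>\<pi> / N < \<phi> < \<pi> / (N - 1)\<close>, makes
  this complex polytopal: for every linear functional the level maxima form a strictly unimodal
  sequence, so the functional is maximal on at most two adjacent levels and there only on vertices
  of a common triangle.

  Two vertices have at least three common neighbours exactly if they lie on the same end level. An
  automorphism therefore permutes the two end levels, where the adjacency of the remaining
  neighbours detects the cyclic order. So it acts on the end levels as a dihedral symmetry, and it
  is determined by this, level by level.\<close>

subsection \<open>Collapses and subdivisions\<close>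

text \<open>The bounds on \<open>\<phi>\<close> come from two demands. Adjacent radii satisfy
  \<open>rad (k - 1) + rad (k + 1) = 2 * cos \<phi> * rad k\<close>, while the largest cosine
  available on a level lies between \<open>cos (pi / N)\<close> and 1 and is the same on both
  neighbours of a level. So \<open>cos \<phi> < cos (pi / N)\<close> puts the mean of the two
  neighbouring maxima below the middle one, at every level strictly between the ends and in every
  direction; \<open>\<phi> < pi / (N - 1)\<close> keeps all radii positive. The choice is
  \<open>\<phi> = 2 * pi / (2 * N - 1)\<close>. The poles answer the demand for invariance:
  rotations fix no vertex of an end level, so the simplex on that level offers no invariant apex,
  and its subdivision point supplies one. The collapses themselves need not be equivariant, only the
  set of deleted edges. There are three families of such edges. Within a family the open star of
  every edge is a cone, and adding its apex to a face never completes another edge of the family, so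
  no order has to be chosen.\<close>

definition down_closed :: "'a set set \<Rightarrow> bool" where
  "down_closed K \<longleftrightarrow> (\<forall>\<rho>\<in>K. Pow \<rho> \<subseteq> K)"

lemma down_closedD: "down_closed K \<Longrightarrow> \<rho> \<in> K \<Longrightarrow> \<sigma> \<subseteq> \<rho> \<Longrightarrow> \<sigma> \<in> K"
  by (auto simp: down_closed_def)

lemma collapses_trans: "collapses K L \<Longrightarrow> collapses L M \<Longrightarrow> collapses K M"
  unfolding collapses_def by (rule rtranclp_trans)

text \<open>The cone hypothesis says that the faces containing \<open>e\<close> come in pairs with
  and without \<open>v\<close>. If \<open>\<sigma>\<close> is maximal among those without
  \<open>v\<close>, then \<open>insert v \<sigma>\<close> is the only larger face, so the pair can
  be removed; what is left still consists of such pairs, and their number decreases.\<close>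

lemma collapses_open_star:
  assumes "finite {\<rho>\<in>K. e \<subseteq> \<rho>}" and "e \<noteq> {}" and "v \<notin> e"
    and "\<And>\<rho>. e \<subseteq> \<rho> \<Longrightarrow> insert v \<rho> \<in> K \<longleftrightarrow> \<rho> - {v} \<in> K"
  shows "collapses K {\<rho>\<in>K. \<not> e \<subseteq> \<rho>}"
  using assms
proof (induction "card {\<rho>\<in>K. e \<subseteq> \<rho>}" arbitrary: K rule: less_induct)
  case less
  note cone = less.prems(4)
  show ?case
  proof (cases "{\<rho>\<in>K. e \<subseteq> \<rho>} = {}")
    case True
    then have "{\<rho>\<in>K. \<not> e \<subseteq> \<rho>} = K" by blast
    then show ?thesis by (simp add: collapses_def)
  next
    case False
    then obtain \<rho>0 where "\<rho>0 \<in> K" "e \<subseteq> \<rho>0" by blast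
    then have "\<rho>0 - {v} \<in> {\<rho>\<in>K. e \<subseteq> \<rho> \<and> v \<notin> \<rho>}"
      using cone[of \<rho>0] less.prems(3) by (cases "v \<in> \<rho>0") (auto simp: insert_absorb)
    moreover have "finite {\<rho>\<in>K. e \<subseteq> \<rho> \<and> v \<notin> \<rho>}"
      by (rule finite_subset[OF _ less.prems(1)]) blast
    ultimately obtain \<sigma> where \<sigma>: "\<sigma> \<in> K" "e \<subseteq> \<sigma>" "v \<notin> \<sigma>"
      and max: "\<And>\<rho>. \<rho> \<in> K \<Longrightarrow> e \<subseteq> \<rho> \<Longrightarrow> v \<notin> \<rho> \<Longrightarrow> \<sigma> \<subseteq> \<rho> \<Longrightarrow> \<rho> = \<sigma>"
      using finite_has_maximal[of "{\<rho>\<in>K. e \<subseteq> \<rho> \<and> v \<notin> \<rho>}"] by (smt (verit) empty_iff mem_Collect_eq)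
    let ?\<tau> = "insert v \<sigma>"
    let ?K' = "K - {\<sigma>, ?\<tau>}"
    have \<tau>: "?\<tau> \<in> K" using cone[OF \<sigma>(2)] \<sigma> by simp
    have free: "\<rho> = ?\<tau>" if "\<rho> \<in> K" "\<sigma> \<subset> \<rho>" for \<rho>
    proof (cases "v \<in> \<rho>")
      case True
      have "e \<subseteq> \<rho>" using that \<sigma> by blast
      then have "\<rho> - {v} \<in> K" using cone[of \<rho>] that True by (simp add: insert_absorb)
      then have "\<rho> - {v} = \<sigma>"
        using max[of "\<rho> - {v}"] that \<sigma> less.prems(3) by blast
      then show ?thesis using True by blast
    next
      case False
      then show ?thesis using max[of \<rho>] that \<sigma> by blast
    qed
    have el: "elementary_collapse K ?K'"
      unfolding elementary_collapse_def
      using \<sigma> \<tau> free less.prems(2) by (intro bexI[of _ \<sigma>] bexI[of _ ?\<tau>]) auto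
    have sub: "{\<rho>\<in>?K'. e \<subseteq> \<rho>} \<subset> {\<rho>\<in>K. e \<subseteq> \<rho>}" using \<sigma> by blast
    have "collapses ?K' {\<rho>\<in>?K'. \<not> e \<subseteq> \<rho>}"
    proof (rule less.hyps[OF psubset_card_mono[OF less.prems(1) sub]])
      show "finite {\<rho>\<in>?K'. e \<subseteq> \<rho>}" using less.prems(1) sub by (meson finite_subset psubset_imp_subset)
      show "e \<noteq> {}" "v \<notin> e" by fact+
      fix \<rho> assume "e \<subseteq> \<rho>"
      then show "insert v \<rho> \<in> ?K' \<longleftrightarrow> \<rho> - {v} \<in> ?K'"
        using cone[of \<rho>] \<sigma>(3) by auto
    qed
    moreover have "{\<rho>\<in>?K'. \<not> e \<subseteq> \<rho>} = {\<rho>\<in>K. \<not> e \<subseteq> \<rho>}" using \<sigma> by blast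
    ultimately have "collapses ?K' {\<rho>\<in>K. \<not> e \<subseteq> \<rho>}" by simp
    then show ?thesis
      unfolding collapses_def
      by (rule converse_rtranclp_into_rtranclp[where r = elementary_collapse, OF el])
  qed
qed

definition avoiding :: "'a set set \<Rightarrow> 'a set set \<Rightarrow> 'a set set" where
  "avoiding K E = {\<rho>\<in>K. \<forall>e\<in>E. \<not> e \<subseteq> \<rho>}"

lemma down_closed_avoiding: "down_closed K \<Longrightarrow> down_closed (avoiding K E)"
  unfolding down_closed_def avoiding_def by blast

lemma finite_avoiding: "finite K \<Longrightarrow> finite (avoiding K E)"
  unfolding avoiding_def by simp

text \<open>The last clause makes the members of \<open>E\<close> independent: an apex never
  completes another member of \<open>E\<close>, so deleting the open star of one member leaves the
  stars of the others cones over their own apices. Hence the open stars can be deleted in any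
  order.\<close>

lemma collapses_avoiding:
  assumes "finite K" and "down_closed K"
    and apex: "\<And>e. e \<in> E \<Longrightarrow> e \<noteq> {} \<and> (\<exists>a. a \<notin> e \<and>
      (\<forall>\<rho>\<in>K. e \<subseteq> \<rho> \<longrightarrow> insert a \<rho> \<in> K \<and> (\<forall>e'\<in>E. e' \<subseteq> insert a \<rho> \<longrightarrow> e' \<subseteq> \<rho>)))"
  shows "collapses K (avoiding K E)"
proof -
  obtain v where v: "\<And>e. e \<in> E \<Longrightarrow> e \<noteq> {} \<and> v e \<notin> e"
    and cone: "\<And>e \<rho>. e \<in> E \<Longrightarrow> \<rho> \<in> K \<Longrightarrow> e \<subseteq> \<rho> \<Longrightarrow> insert (v e) \<rho> \<in> K"
    and indep: "\<And>e e' \<rho>. e \<in> E \<Longrightarrow> e' \<in> E \<Longrightarrow> \<rho> \<in> K \<Longrightarrow> e \<subseteq> \<rho> \<Longrightarrow> e' \<subseteq> insert (v e) \<rho> \<Longrightarrow> e' \<subseteq> \<rho>"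
    using apex by metis
  have "collapses K (avoiding K F)" if "finite F" "F \<subseteq> E" for F
    using that
  proof (induction F rule: finite_induct)
    case empty
    then show ?case by (simp add: avoiding_def collapses_def)
  next
    case (insert e F)
    let ?K = "avoiding K F"
    have e: "e \<in> E" "F \<subseteq> E" using insert.prems by auto
    have "collapses ?K {\<rho>\<in>?K. \<not> e \<subseteq> \<rho>}"
    proof (rule collapses_open_star)
      show "finite {\<rho>\<in>?K. e \<subseteq> \<rho>}" using finite_avoiding[OF assms(1)] by simp
      show "e \<noteq> {}" "v e \<notin> e" using v e by auto
      fix \<rho> assume "e \<subseteq> \<rho>"
      show "insert (v e) \<rho> \<in> ?K \<longleftrightarrow> \<rho> - {v e} \<in> ?K"
      proof
        assume "insert (v e) \<rho> \<in> ?K"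
        then show "\<rho> - {v e} \<in> ?K"
          using down_closedD[OF down_closed_avoiding[OF assms(2)]] by blast
      next
        assume *: "\<rho> - {v e} \<in> ?K"
        have sub: "e \<subseteq> \<rho> - {v e}" using \<open>e \<subseteq> \<rho>\<close> v e by blast
        have K: "\<rho> - {v e} \<in> K" using * by (simp add: avoiding_def)
        have "insert (v e) (\<rho> - {v e}) \<in> K" using cone[OF e(1) K sub] .
        moreover have "\<not> e' \<subseteq> insert (v e) (\<rho> - {v e})" if "e' \<in> F" for e'
          using indep[OF e(1) _ K sub, of e'] that e(2) * by (auto simp: avoiding_def)
        ultimately show "insert (v e) \<rho> \<in> ?K" by (simp add: avoiding_def)
      qed
    qed
    moreover have "{\<rho>\<in>?K. \<not> e \<subseteq> \<rho>} = avoiding K (insert e F)" by (auto simp: avoiding_def)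
    ultimately show ?case using insert.IH[OF e(2)] collapses_trans by metis
  qed
  \<comment> \<open>\<open>E\<close> may be infinite, but a member outside the down-closed
    \<open>K\<close> lies in no face.\<close>
  moreover have "finite (E \<inter> K)" using assms(1) by simp
  moreover have "avoiding K (E \<inter> K) = avoiding K E"
    using down_closedD[OF assms(2)] by (auto simp: avoiding_def)
  ultimately show ?thesis by (metis Int_lower1)
qed

text \<open>One inclusion is enough: the induced action is injective on families of subsets of
  \<open>V\<close>, because \<open>\<phi>\<close> is injective there, and an injective self-map of
  the finite \<open>L\<close> is onto.\<close>

lemma aut_invariantI:
  assumes fin: "finite L" and lab: "\<And>\<sigma>. \<sigma> \<in> L \<Longrightarrow> \<sigma> \<subseteq> Pow V"
    and sub: "\<And>\<phi> \<sigma>. graph_automorphism V adj \<phi> \<Longrightarrow> \<sigma> \<in> L \<Longrightarrow> induced_action \<phi> \<sigma> \<in> L"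
  shows "aut_invariant V adj L"
  unfolding aut_invariant_def
proof (intro allI impI)
  fix \<phi> assume a: "graph_automorphism V adj \<phi>"
  then have inj: "inj_on \<phi> V" by (simp add: graph_automorphism_def bij_betw_def)
  have "inj_on (induced_action \<phi>) (Pow (Pow V))"
    unfolding induced_action_def using inj_on_image_Pow[OF inj_on_image_Pow[OF inj]] .
  then have "inj_on (induced_action \<phi>) L" using lab by (meson PowI inj_on_subset subsetI)
  then show "induced_action \<phi> ` L = L" using endo_inj_surj[OF fin] sub[OF a] by blast
qed

section \<open>Stellar subdivision at two faces without a common coface\<close>

lemma embed_face_subset_iff [simp]: "embed_face A \<subseteq> embed_face B \<longleftrightarrow> A \<subseteq> B"
  by (auto simp: embed_face_def)

lemma embed_face_eq_iff [simp]: "embed_face A = embed_face B \<longleftrightarrow> A = B"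
  by (auto simp: embed_face_def)

lemma embed_face_Un: "embed_face (A \<union> B) = embed_face A \<union> embed_face B"
  by (auto simp: embed_face_def)

lemma subset_embed_face: "\<tau> \<subseteq> embed_face B \<Longrightarrow> \<exists>A\<subseteq>B. \<tau> = embed_face A"
  unfolding embed_face_def by (metis subset_imageE)

lemma not_in_embed_face: "F \<noteq> {} \<Longrightarrow> \<nexists>x. F = {x} \<Longrightarrow> F \<notin> embed_face A"
  by (auto simp: embed_face_def)

text \<open>Closed form of subdividing at \<open>F\<close> and then at \<open>G\<close> when no face
  contains both. It is symmetric in the two faces, which matters because automorphisms may exchange
  them.\<close>

definition two_face_subdivision :: "'a set set \<Rightarrow> 'a set \<Rightarrow> 'a set \<Rightarrow> 'a set set set" where
  "two_face_subdivision K F G = embed_face ` {\<tau>\<in>K. \<not> F \<subseteq> \<tau> \<and> \<not> G \<subseteq> \<tau>}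
     \<union> {insert F (embed_face \<tau>) | \<tau>. \<not> F \<subseteq> \<tau> \<and> \<tau> \<union> F \<in> K}
     \<union> {insert G (embed_face \<tau>) | \<tau>. \<not> G \<subseteq> \<tau> \<and> \<tau> \<union> G \<in> K}"

lemma two_face_subdivision_intros:
  "\<tau> \<in> K \<Longrightarrow> \<not> F \<subseteq> \<tau> \<Longrightarrow> \<not> G \<subseteq> \<tau> \<Longrightarrow> embed_face \<tau> \<in> two_face_subdivision K F G"
  "H = F \<or> H = G \<Longrightarrow> \<not> H \<subseteq> \<tau> \<Longrightarrow> \<tau> \<union> H \<in> K \<Longrightarrow> insert H (embed_face \<tau>) \<in> two_face_subdivision K F G"
  unfolding two_face_subdivision_def by blast+

lemma stellar_subdivision_embed_face:
  "stellar_subdivision (embed_face ` K) (embed_face F) F =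
     embed_face ` {\<tau>\<in>K. \<not> F \<subseteq> \<tau>} \<union> {insert F (embed_face \<tau>) | \<tau>. \<not> F \<subseteq> \<tau> \<and> \<tau> \<union> F \<in> K}"
  (is "?L = ?R")
proof -
  have "(\<exists>\<tau>. x = insert F \<tau> \<and> \<not> embed_face F \<subseteq> \<tau> \<and> \<tau> \<union> embed_face F \<in> embed_face ` K) \<longleftrightarrow>
        (\<exists>\<tau>. x = insert F (embed_face \<tau>) \<and> \<not> F \<subseteq> \<tau> \<and> \<tau> \<union> F \<in> K)" for x
  proof (intro iffI; elim exE conjE imageE)
    fix \<tau> \<rho> assume *: "x = insert F \<tau>" "\<not> embed_face F \<subseteq> \<tau>" "\<tau> \<union> embed_face F = embed_face \<rho>" "\<rho> \<in> K"
    then obtain A where A: "\<tau> = embed_face A" using subset_embed_face by (metis Un_upper1)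
    then have "embed_face (A \<union> F) = embed_face \<rho>" using * by (simp add: embed_face_Un)
    then have "A \<union> F = \<rho>" by simp
    then show "\<exists>\<tau>'. x = insert F (embed_face \<tau>') \<and> \<not> F \<subseteq> \<tau>' \<and> \<tau>' \<union> F \<in> K"
      using * A by (intro exI[of _ A]) simp
  next
    fix \<tau> assume "x = insert F (embed_face \<tau>)" "\<not> F \<subseteq> \<tau>" "\<tau> \<union> F \<in> K"
    then show "\<exists>\<tau>'. x = insert F \<tau>' \<and> \<not> embed_face F \<subseteq> \<tau>' \<and> \<tau>' \<union> embed_face F \<in> embed_face ` K"
      by (intro exI[of _ "embed_face \<tau>"]) (simp add: embed_face_Un[symmetric])
  qed
  moreover have "{\<tau>\<in>embed_face ` K. \<not> embed_face F \<subseteq> \<tau>} = embed_face ` {\<tau>\<in>K. \<not> F \<subseteq> \<tau>}"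
    using embed_face_subset_iff[of F] by blast
  ultimately show ?thesis unfolding stellar_subdivision_def by presburger
qed

text \<open>As \<open>F \<union> G\<close> is not a face, the open stars of \<open>F\<close> and
  \<open>G\<close> are disjoint: the first step leaves every face containing \<open>G\<close> intact
  and creates no new one. Since \<open>F\<close> is not a single vertex, its label differs from all
  embedded vertices.\<close>

lemma partial_subdivision_two_faces:
  assumes K: "down_closed K" and F: "F \<in> K" "F \<noteq> {}" "\<nexists>x. F = {x}" and G: "G \<in> K" "G \<noteq> {}" "\<nexists>x. G = {x}"
    and FG: "F \<union> G \<notin> K" and "\<not> F \<subseteq> G"
  shows "partial_subdivision K (two_face_subdivision K F G)"
proof -
  let ?K1 = "stellar_subdivision (embed_face ` K) (embed_face F) F"
  have K1: "partial_subdivision K ?K1"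
    using F by (intro partial_subdivision.intros) auto
  have GK1: "embed_face G \<in> ?K1"
    unfolding stellar_subdivision_embed_face using G \<open>\<not> F \<subseteq> G\<close> by blast
  have noG: "\<not> G \<subseteq> \<tau>" if "\<tau> \<union> F \<in> K" for \<tau>
    using down_closedD[OF K that, of "F \<union> G"] FG by blast
  have noF: "\<not> F \<subseteq> \<tau>" if "\<tau> \<union> G \<in> K" for \<tau>
    using down_closedD[OF K that, of "F \<union> G"] FG by blast
  have G': "embed_face G \<subseteq> insert F (embed_face \<tau>) \<longleftrightarrow> G \<subseteq> \<tau>" for \<tau>
    using not_in_embed_face[OF F(2,3), of G] by (metis embed_face_subset_iff subset_insert)
  have F': "F \<notin> embed_face \<tau>" for \<tau> using not_in_embed_face[OF F(2,3)] .
  have A: "{\<rho>\<in>?K1. \<not> embed_face G \<subseteq> \<rho>} = embed_face ` {\<tau>\<in>K. \<not> F \<subseteq> \<tau> \<and> \<not> G \<subseteq> \<tau>}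
     \<union> {insert F (embed_face \<tau>) | \<tau>. \<not> F \<subseteq> \<tau> \<and> \<tau> \<union> F \<in> K}"
  proof -
    let ?X = "{\<tau>\<in>K. \<not> F \<subseteq> \<tau>}"
    let ?Y = "{insert F (embed_face \<tau>) | \<tau>. \<not> F \<subseteq> \<tau> \<and> \<tau> \<union> F \<in> K}"
    have X: "{\<rho>\<in>embed_face ` ?X. \<not> embed_face G \<subseteq> \<rho>} = embed_face ` {\<tau>\<in>?X. \<not> G \<subseteq> \<tau>}"
      using embed_face_subset_iff[of G] by blast
    have "\<forall>\<rho>\<in>?Y. \<not> embed_face G \<subseteq> \<rho>"
    proof
      fix \<rho> assume "\<rho> \<in> ?Y"
      then obtain \<tau> where "\<rho> = insert F (embed_face \<tau>)" "\<tau> \<union> F \<in> K" by blast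
      then show "\<not> embed_face G \<subseteq> \<rho>" using noG G' by metis
    qed
    then have Y: "{\<rho>\<in>?Y. \<not> embed_face G \<subseteq> \<rho>} = ?Y" by blast
    have U: "{\<rho>\<in>A \<union> B. P \<rho>} = {\<rho>\<in>A. P \<rho>} \<union> {\<rho>\<in>B. P \<rho>}" for A B and P :: "'a set set \<Rightarrow> bool"
      by blast
    show ?thesis unfolding stellar_subdivision_embed_face U X Y by simp
  qed
  have "(\<exists>\<tau>. x = insert G \<tau> \<and> \<not> embed_face G \<subseteq> \<tau> \<and> \<tau> \<union> embed_face G \<in> ?K1) \<longleftrightarrow>
        (\<exists>\<tau>. x = insert G (embed_face \<tau>) \<and> \<not> G \<subseteq> \<tau> \<and> \<tau> \<union> G \<in> K)" for x
  proof (intro iffI; elim exE conjE)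
    fix \<tau> assume *: "x = insert G \<tau>" "\<not> embed_face G \<subseteq> \<tau>" "\<tau> \<union> embed_face G \<in> ?K1"
    have "\<tau> \<union> embed_face G \<in> embed_face ` K"
    proof (rule ccontr)
      assume "\<tau> \<union> embed_face G \<notin> embed_face ` K"
      then obtain \<rho> where "\<tau> \<union> embed_face G = insert F (embed_face \<rho>)" "\<rho> \<union> F \<in> K"
        using *(3) unfolding stellar_subdivision_embed_face by blast
      then show False using noG[of \<rho>] G'[of \<rho>] by blast
    qed
    then obtain \<rho> where \<rho>: "\<tau> \<union> embed_face G = embed_face \<rho>" "\<rho> \<in> K" by blast
    then obtain A where A: "\<tau> = embed_face A" using subset_embed_face by (metis Un_upper1)
    then have "embed_face (A \<union> G) = embed_face \<rho>" using \<rho> by (simp add: embed_face_Un)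
    then have "A \<union> G = \<rho>" by simp
    then show "\<exists>\<tau>'. x = insert G (embed_face \<tau>') \<and> \<not> G \<subseteq> \<tau>' \<and> \<tau>' \<union> G \<in> K"
      using * A \<rho> by (intro exI[of _ A]) simp
  next
    fix \<tau> assume *: "x = insert G (embed_face \<tau>)" "\<not> G \<subseteq> \<tau>" "\<tau> \<union> G \<in> K"
    have "\<not> F \<subseteq> \<tau> \<union> G" using noF[of "\<tau> \<union> G"] * by simp
    then have "embed_face (\<tau> \<union> G) \<in> ?K1" unfolding stellar_subdivision_embed_face using * by blast
    then show "\<exists>\<tau>'. x = insert G \<tau>' \<and> \<not> embed_face G \<subseteq> \<tau>' \<and> \<tau>' \<union> embed_face G \<in> ?K1"
      using * by (intro exI[of _ "embed_face \<tau>"]) (simp add: embed_face_Un[symmetric])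
  qed
  then have B: "{insert G \<tau> |\<tau>. \<not> embed_face G \<subseteq> \<tau> \<and> \<tau> \<union> embed_face G \<in> ?K1} =
      {insert G (embed_face \<tau>) |\<tau>. \<not> G \<subseteq> \<tau> \<and> \<tau> \<union> G \<in> K}"
    by (rule Collect_cong)
  have "stellar_subdivision ?K1 (embed_face G) G = two_face_subdivision K F G"
    unfolding stellar_subdivision_def[of ?K1] two_face_subdivision_def A B by (rule refl)
  then show ?thesis
    using partial_subdivision.subdivide[OF K1 G(1,2) GK1] by simp
qed

lemma induced_action_embed_face: "induced_action \<phi> (embed_face \<tau>) = embed_face (\<phi> ` \<tau>)"
  by (auto simp: induced_action_def embed_face_def)

lemma induced_action_insert: "induced_action \<phi> (insert F \<rho>) = insert (\<phi> ` F) (induced_action \<phi> \<rho>)"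
  by (simp add: induced_action_def)

lemma induced_action_two_face_subdivision:
  assumes KV: "\<And>\<tau>. \<tau> \<in> K \<Longrightarrow> \<tau> \<subseteq> V" and inj: "inj_on \<phi> V"
    and K: "\<And>\<tau>. \<tau> \<in> K \<Longrightarrow> \<phi> ` \<tau> \<in> K"
    and FG: "F \<subseteq> V" "G \<subseteq> V" "\<phi> ` F = F \<and> \<phi> ` G = G \<or> \<phi> ` F = G \<and> \<phi> ` G = F"
    and \<rho>: "\<rho> \<in> two_face_subdivision K F G"
  shows "induced_action \<phi> \<rho> \<in> two_face_subdivision K F G"
proof -
  have sub: "\<phi> ` A \<subseteq> \<phi> ` B \<longleftrightarrow> A \<subseteq> B" if "A \<subseteq> V" "B \<subseteq> V" for A B
    using inj that by (meson image_mono inj_on_image_subset_iff)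
  consider (a) \<tau> where "\<rho> = embed_face \<tau>" "\<tau> \<in> K" "\<not> F \<subseteq> \<tau>" "\<not> G \<subseteq> \<tau>"
    | (b) H \<tau> where "H = F \<or> H = G" "\<rho> = insert H (embed_face \<tau>)" "\<not> H \<subseteq> \<tau>" "\<tau> \<union> H \<in> K"
    using \<rho> unfolding two_face_subdivision_def by blast
  then show ?thesis
  proof cases
    case a
    have "\<not> \<phi> ` F \<subseteq> \<phi> ` \<tau>" "\<not> \<phi> ` G \<subseteq> \<phi> ` \<tau>" using sub KV[OF a(2)] FG a by auto
    then have "\<not> F \<subseteq> \<phi> ` \<tau>" "\<not> G \<subseteq> \<phi> ` \<tau>" using FG(3) by metis+
    then show ?thesis using a K[OF a(2)]
      by (auto simp: two_face_subdivision_def induced_action_embed_face)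
  next
    case b
    have "\<not> \<phi> ` H \<subseteq> \<phi> ` \<tau>" using sub[of H \<tau>] KV[OF b(4)] FG b by auto
    moreover have "\<phi> ` \<tau> \<union> \<phi> ` H \<in> K" using K[OF b(4)] by (simp add: image_Un)
    moreover have "\<phi> ` H = F \<or> \<phi> ` H = G" using b(1) FG(3) by auto
    ultimately show ?thesis
      unfolding b(2) induced_action_insert induced_action_embed_face two_face_subdivision_def by blast
  qed
qed

subsection \<open>Recognizing simplicial polytopes\<close>

text \<open>The faces are never enumerated: every proper face of a polytope is exposed, so by
  \<open>cover\<close> its extreme points lie in some independent \<open>T\<close>, while
  \<open>exposed\<close> makes each such \<open>T\<close>, and with it every subset of it, span a
  face. Full dimension also follows from \<open>cover\<close>: a hyperplane containing
  \<open>S\<close> would give \<open>S \<subseteq> T\<close>, against \<open>proper\<close>.\<close>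

lemma simplicial_polytope_convex_hull:
  fixes S :: "'a::euclidean_space set"
  assumes fin: "finite S" and ne: "\<T> \<noteq> {}"
    and indep: "\<And>T. T \<in> \<T> \<Longrightarrow> \<not> affine_dependent T"
    and proper: "\<And>T. T \<in> \<T> \<Longrightarrow> T \<subset> S"
    and exposed: "\<And>T. T \<in> \<T> \<Longrightarrow> \<exists>a b. (\<forall>x\<in>S. a \<bullet> x \<le> b) \<and> {x\<in>S. a \<bullet> x = b} = T"
    and cover: "\<And>a b. a \<noteq> 0 \<Longrightarrow> \<forall>x\<in>S. a \<bullet> x \<le> b \<Longrightarrow> \<exists>T\<in>\<T>. {x\<in>S. a \<bullet> x = b} \<subseteq> T"
  shows "simplicial_polytope (convex hull S)"
    and "aff_dim (convex hull S) = DIM('a)"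
    and "boundary_complex (convex hull S) = {\<sigma>. \<exists>T\<in>\<T>. \<sigma> \<subseteq> T}"
proof -
  let ?P = "convex hull S"
  have poly: "polytope ?P" using fin by (auto simp: polytope_def)
  show "aff_dim ?P = DIM('a)"
  proof (rule ccontr)
    assume "aff_dim ?P \<noteq> DIM('a)"
    then have "aff_dim S < DIM('a)" using aff_dim_le_DIM[of S] by (simp add: aff_dim_convex_hull)
    then obtain a b where "a \<noteq> 0" "S \<subseteq> {x. a \<bullet> x = b}" using aff_lowdim_subset_hyperplane by metis
    then show False using cover[of a b] proper by force
  qed
  have face: "convex hull T face_of ?P" if T: "T \<in> \<T>" for T
  proof -
    obtain a b where ab: "\<forall>x\<in>S. a \<bullet> x \<le> b" "{x\<in>S. a \<bullet> x = b} = T" using exposed[OF T] by blast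
    have "?P \<subseteq> {x. a \<bullet> x \<le> b}" using ab(1) by (intro hull_minimal) (auto simp: convex_halfspace_le)
    then have F: "(?P \<inter> {x. a \<bullet> x = b}) face_of ?P"
      by (intro face_of_Int_supporting_hyperplane_le) (auto simp: convex_convex_hull)
    then obtain s where s: "s \<subseteq> S" "?P \<inter> {x. a \<bullet> x = b} = convex hull s"
      using face_of_convex_hull_subset[OF finite_imp_compact[OF fin]] by blast
    have "s \<subseteq> T" using s ab(2) hull_subset[of s convex] by blast
    moreover have "T \<subseteq> convex hull s" using s(2) ab(2) hull_subset[of S convex] by blast
    ultimately have "convex hull s = convex hull T" by (metis hull_hull hull_mono subset_antisym)
    then show ?thesis using F s by simp
  qed
  have sub: "{x. x extreme_point_of F} \<subseteq> S" if "F face_of ?P" for F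
    using that extreme_point_of_convex_hull extreme_point_of_face by blast
  have ext: "\<exists>T\<in>\<T>. {x. x extreme_point_of F} \<subseteq> T" if F: "F face_of ?P" "F \<noteq> ?P" for F
  proof -
    have "F exposed_face_of ?P"
      using exposed_face_of_polyhedron[OF polytope_imp_polyhedron[OF poly]] F by simp
    then obtain a b where ab: "?P \<subseteq> {x. a \<bullet> x \<le> b}" "F = ?P \<inter> {x. a \<bullet> x = b}"
      unfolding exposed_face_of_def by blast
    show ?thesis
    proof (cases "a = 0")
      case True
      \<comment> \<open>A zero functional exposes only the empty face and the whole
        polytope.\<close>
      then have "F = {}" using ab F by auto
      then show ?thesis using ne by (auto simp: extreme_point_of_def)
    next
      case False
      have "\<forall>x\<in>S. a \<bullet> x \<le> b" using ab(1) hull_subset[of S convex] by blast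
      then obtain T where "T \<in> \<T>" "{x\<in>S. a \<bullet> x = b} \<subseteq> T" using cover[OF False] by blast
      moreover have "{x. x extreme_point_of F} \<subseteq> {x\<in>S. a \<bullet> x = b}"
        using sub[OF F(1)] ab(2) by (auto simp: extreme_point_of_def)
      ultimately show ?thesis by blast
    qed
  qed
  show "boundary_complex ?P = {\<sigma>. \<exists>T\<in>\<T>. \<sigma> \<subseteq> T}"
  proof (intro subset_antisym subsetI)
    fix \<sigma> assume "\<sigma> \<in> boundary_complex ?P"
    then show "\<sigma> \<in> {\<sigma>. \<exists>T\<in>\<T>. \<sigma> \<subseteq> T}" using ext unfolding boundary_complex_def by blast
  next
    fix \<sigma> assume "\<sigma> \<in> {\<sigma>. \<exists>T\<in>\<T>. \<sigma> \<subseteq> T}"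
    then obtain T where T: "T \<in> \<T>" "\<sigma> \<subseteq> T" by blast
    have indep': "\<not> affine_dependent \<sigma>" using affine_independent_subset indep T by blast
    have "convex hull \<sigma> face_of convex hull T"
      using face_of_convex_hull_affine_independent[OF indep[OF T(1)]] T(2) by blast
    then have 1: "convex hull \<sigma> face_of ?P" using face[OF T(1)] face_of_trans by blast
    have 2: "{x. x extreme_point_of convex hull \<sigma>} = \<sigma>"
      using extreme_point_of_convex_hull_affine_independent[OF indep'] by blast
    have "convex hull \<sigma> \<noteq> ?P"
    proof
      assume eq: "convex hull \<sigma> = ?P"
      obtain a b where ab: "{x\<in>S. a \<bullet> x = b} = T" using exposed[OF T(1)] by blast
      have "convex hull \<sigma> \<subseteq> {x. a \<bullet> x = b}" using ab T(2) by (intro hull_minimal) (auto simp: convex_hyperplane)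
      then have "S \<subseteq> T" using ab eq hull_subset[of S convex] by blast
      then show False using proper[OF T(1)] by blast
    qed
    then show "\<sigma> \<in> boundary_complex ?P" unfolding boundary_complex_def using 1 2 by blast
  qed
  show "simplicial_polytope ?P"
    unfolding simplicial_polytope_def
  proof (intro conjI allI impI poly)
    fix F assume "F facet_of ?P"
    then have F: "F face_of ?P" "F \<noteq> ?P" by (auto simp: facet_of_def)
    let ?\<sigma> = "{x. x extreme_point_of F}"
    obtain T where "T \<in> \<T>" "?\<sigma> \<subseteq> T" using ext[OF F] by blast
    then have "\<not> affine_dependent ?\<sigma>" using affine_independent_subset indep by blast
    moreover have "compact F" "convex F"
      using F(1) face_of_polytope_polytope[OF poly] polytope_imp_compact polytope_imp_convex by blast+
    then have "F = convex hull ?\<sigma>" by (rule Krein_Milman_Minkowski)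
    ultimately have "(int (card ?\<sigma>) - 1) simplex F" unfolding simplex_def by (intro exI[of _ ?\<sigma>]) simp
    then show "\<exists>k. k simplex F" by blast
  qed
qed

lemma affine_independent_triangle:
  fixes x y w c :: "'a::euclidean_space"
  assumes "x \<noteq> y" and "c \<bullet> x = c \<bullet> y" and "c \<bullet> w \<noteq> c \<bullet> x"
  shows "\<not> affine_dependent {x, y, w}"
proof -
  have "affine hull {x, y} \<subseteq> {z. c \<bullet> z = c \<bullet> x}"
    using assms by (intro hull_minimal) (auto simp: affine_hyperplane)
  then have "w \<notin> affine hull {x, y}" using assms by blast
  then have "\<not> affine_dependent (insert w {x, y})"
    using affine_independent_insert affine_independent_2 by blast
  then show ?thesis by (simp add: insert_commute)
qed

text \<open>\<open>I\<close> indexes the vertices with repetitions (angles that agree modulo a full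
  turn, the many names of a pole). As \<open>g\<close> and \<open>h\<close> identify the same
  indices, \<open>h\<close> factors through \<open>g\<close>, and the factor is the
  isomorphism.\<close>

lemma complex_isomorphic_image:
  assumes eq: "\<And>a b. a \<in> I \<Longrightarrow> b \<in> I \<Longrightarrow> g a = g b \<longleftrightarrow> h a = h b"
    and cover: "\<Union>\<T> = I"
  shows "complex_isomorphic {\<sigma>. \<exists>T\<in>\<T>. \<sigma> \<subseteq> g ` T} {\<sigma>. \<exists>T\<in>\<T>. \<sigma> \<subseteq> h ` T}"
    (is "complex_isomorphic ?K ?L")
proof -
  define f where "f = h \<circ> inv_into I g"
  have f: "f (g a) = h a" if "a \<in> I" for a
    using that eq[of "inv_into I g (g a)" a] by (simp add: f_def inv_into_into f_inv_into_f)
  have U: "\<Union>?K = g ` I" "\<Union>?L = h ` I" using cover by blast+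
  have im: "f ` g ` T = h ` T" if "T \<subseteq> I" for T
    using f that by (force simp: image_image)
  have T: "T \<subseteq> I" if "T \<in> \<T>" for T using that cover by blast
  have "inj_on f (g ` I)" using f eq by (auto simp: inj_on_def)
  then have "bij_betw f (\<Union>?K) (\<Union>?L)" unfolding U using im[of I] by (simp add: bij_betw_def)
  moreover have "(\<lambda>\<sigma>. f ` \<sigma>) ` ?K = ?L"
  proof (intro subset_antisym subsetI)
    fix \<sigma> assume "\<sigma> \<in> (\<lambda>\<sigma>. f ` \<sigma>) ` ?K"
    then obtain \<rho> t where "\<sigma> = f ` \<rho>" "t \<in> \<T>" "\<rho> \<subseteq> g ` t" by blast
    then show "\<sigma> \<in> ?L" using im[OF T] by (metis (mono_tags, lifting) image_mono mem_Collect_eq)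
  next
    fix \<sigma> assume "\<sigma> \<in> ?L"
    then obtain t where t: "t \<in> \<T>" "\<sigma> \<subseteq> h ` t" by blast
    then have "\<sigma> \<subseteq> f ` g ` t" using im[OF T] by simp
    then obtain \<rho> where "\<rho> \<subseteq> g ` t" "\<sigma> = f ` \<rho>" by (meson subset_imageE)
    then show "\<sigma> \<in> (\<lambda>\<sigma>. f ` \<sigma>) ` ?K" using t by blast
  qed
  ultimately show ?thesis unfolding complex_isomorphic_def by blast
qed

subsection \<open>The drum polytope\<close>

text \<open>Says that no level is a weak local minimum. In this form the property follows from a
  comparison with a weighted mean of the two neighbouring values, also at the end levels.\<close>

definition unimodal_on_levels :: "int \<Rightarrow> (int \<Rightarrow> real) \<Rightarrow> bool" where
  "unimodal_on_levels N F \<longleftrightarrow> (\<forall>k. 1 \<le> k \<and> k \<le> N \<longrightarrow> F (k - 1) < F k \<or> F (k + 1) < F k)"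

text \<open>Otherwise the minimum of \<open>F\<close> over the levels strictly between
  \<open>i\<close> and \<open>j\<close> would be a weak local minimum: its neighbours are such
  levels too, or are \<open>i\<close> or \<open>j\<close>, where \<open>F\<close> is at least
  \<open>F m\<close>.\<close>

lemma unimodal_no_dip:
  assumes F: "unimodal_on_levels N F" and ij: "0 \<le> i" "i < m" "m < j" "j \<le> N + 1"
  shows "F i < F m \<or> F j < F m"
proof (rule ccontr)
  assume dip: "\<not> ?thesis"
  have ne: "finite {i+1..j-1}" "{i+1..j-1} \<noteq> {}" using ij by auto
  define k where "k = arg_min_on F {i+1..j-1}"
  have k: "k \<in> {i+1..j-1}" unfolding k_def by (rule arg_min_if_finite(1)[OF ne])
  have min: "F k \<le> F l" if "l \<in> {i+1..j-1}" for l
    unfolding k_def using arg_min_least[OF ne that] .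
  have nb: "F k \<le> F l" if "l = k - 1 \<or> l = k + 1" for l
  proof (cases "l \<in> {i+1..j-1}")
    case False
    then have "l = i \<or> l = j" using that k by auto
    moreover have "F k \<le> F m" using min[of m] ij by simp
    ultimately show ?thesis using dip by auto
  qed (use min in auto)
  have "F (k - 1) < F k \<or> F (k + 1) < F k"
    using F[unfolded unimodal_on_levels_def, rule_format, of k] k ij by simp
  then show False using nb[of "k - 1"] nb[of "k + 1"] by simp
qed

lemma unimodal_argmax_adjacent:
  assumes F: "unimodal_on_levels N F" and max: "\<And>k. 0 \<le> k \<Longrightarrow> k \<le> N + 1 \<Longrightarrow> F k \<le> M"
    and ij: "0 \<le> i" "i < j" "j \<le> N + 1" "F i = M" "F j = M"
  shows "j = i + 1"
  using unimodal_no_dip[OF F, of i "i + 1" j] max[of "i + 1"] ij by force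

lemma unimodal_two_max:
  assumes F: "unimodal_on_levels N F" and j: "0 \<le> j" "j \<le> N" "F j = F (j + 1)"
    and k: "0 \<le> k" "k \<le> N + 1" "k \<noteq> j" "k \<noteq> j + 1"
  shows "F k < F j"
proof (cases "k < j")
  case True
  then show ?thesis using unimodal_no_dip[OF F, of k j "j + 1"] j k by simp
next
  case False
  then show ?thesis using unimodal_no_dip[OF F, of j "j + 1" k] j k by simp
qed

lemma cos_add_2pi_int: "cos (x + 2 * pi * of_int n) = cos x"
  by (simp add: cos_add)

text \<open>By the product formula the difference of the cosines is
  \<open>2 * sin (x + pi * u / N) * sin (pi * u / N)\<close> with \<open>0 < u < N\<close>. The
  bound on \<open>x\<close> keeps \<open>x + pi * u / N\<close> between 0 and \<open>pi\<close>, and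
  the product vanishes only at these two ends, where the direction is midway between two vertices of
  a regular \<open>N\<close>-gon.\<close>

lemma cos_regular_polygon:
  fixes N t :: int and x :: real
  assumes N: "0 < N" and x: "\<bar>x\<bar> \<le> pi / N" and t: "\<not> N dvd t"
  shows "cos (x + 2 * pi * t / N) \<le> cos x"
    and "cos (x + 2 * pi * t / N) = cos x \<Longrightarrow> x = pi / N \<and> N dvd t + 1 \<or> x = - pi / N \<and> N dvd t - 1"
proof -
  define u where "u = t mod N"
  have u: "0 < u" "u < N" using N t by (auto simp: u_def dvd_eq_mod_eq_0 order.not_eq_order_implies_strict)
  have tu: "t = u + N * (t div N)" by (simp add: u_def)
  have "x + 2 * pi * t / N = x + 2 * pi * u / N + 2 * pi * of_int (t div N)"
    using N by (subst tu) (simp add: field_simps)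
  then have c: "cos (x + 2 * pi * t / N) = cos (x + 2 * pi * u / N)"
    by (simp only: cos_add_2pi_int)
  have d: "cos x - cos (x + 2 * pi * u / N) = 2 * sin (x + pi * u / N) * sin (pi * u / N)"
    using cos_diff_cos[of x "x + 2 * pi * u / N"] by (simp add: add_divide_distrib)
  have s2: "sin (pi * u / N) > 0" using u N by (intro sin_gt_zero) (auto simp: field_simps)
  have lo: "0 \<le> x + pi * u / N"
  proof -
    have "pi / N \<le> pi * u / N" using u N by (simp add: divide_right_mono)
    then show ?thesis using x by linarith
  qed
  have hi: "x + pi * u / N \<le> pi"
  proof -
    have "real_of_int (u + 1) \<le> N" using u by linarith
    then have "pi * (u + 1) \<le> pi * N" by simp
    then have "pi * (u + 1) / N \<le> pi" using N by (simp add: field_simps)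
    then have "pi * u / N + pi / N \<le> pi" by (simp add: add_divide_distrib distrib_left)
    then show ?thesis using x by linarith
  qed
  have s1: "sin (x + pi * u / N) \<ge> 0" using lo hi by (intro sin_ge_zero)
  show "cos (x + 2 * pi * t / N) \<le> cos x" using c d s1 s2 by (smt (verit) mult_nonneg_nonneg)
  assume "cos (x + 2 * pi * t / N) = cos x"
  then have "sin (x + pi * u / N) = 0" using c d s2 by simp
  then have "x + pi * u / N = 0 \<or> x + pi * u / N = pi" 
    using lo hi sin_gt_zero[of "x + pi * u / N"] by linarith
  then show "x = pi / N \<and> N dvd t + 1 \<or> x = - pi / N \<and> N dvd t - 1"
  proof
    assume e: "x + pi * u / N = 0"
    then have "pi * u / N \<le> pi / N" using x by linarith
    then have "pi * u \<le> pi * 1" using N by (simp add: divide_le_cancel)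
    then have "u \<le> 1" by (simp only: mult_le_cancel_left_pos[OF pi_gt_zero])
    then have "u = 1" using u by linarith
    then have "x = - pi / N" using e by simp
    moreover have "N dvd t - 1" using \<open>u = 1\<close> tu by (metis add_diff_cancel_left' dvd_triv_left)
    ultimately show ?thesis by blast
  next
    assume e: "x + pi * u / N = pi"
    then have "pi - pi / N \<le> pi * u / N" using x by linarith
    moreover have "pi - pi / N = pi * (N - 1) / N" using N by (simp add: field_simps)
    ultimately have "pi * (N - 1) \<le> pi * u" using N by (simp only: divide_le_cancel of_int_0_less_iff)
    then have "N - 1 \<le> u" by (simp only: mult_le_cancel_left_pos[OF pi_gt_zero])
    then have u1: "u = N - 1" using u by linarith
    have "pi * u / N = pi - pi / N" using N unfolding u1 by (simp add: field_simps)
    then have "x = pi / N" using e by linarith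
    moreover have "t + 1 = N * (1 + t div N)" using u1 tu unfolding distrib_left by linarith
    then have "N dvd t + 1" by simp
    ultimately show ?thesis by blast
  qed
qed

section \<open>Coordinates of the drum and its points in space\<close>

locale levels =
  fixes N :: int
  assumes N3: "3 \<le> N"
begin

text \<open>\<open>(k, q)\<close> is the point on level \<open>k\<close> at angle \<open>\<pi> q / N\<close>, so \<open>q\<close> matters modulo \<open>2 N\<close>. Positions with
  \<open>k + q\<close> even are vertices, those with \<open>k + q\<close> odd are centres of squares. Levels \<open>0\<close> and \<open>N + 1\<close> are
  the poles, where \<open>q\<close> is immaterial.\<close>

definition positions :: "(int \<times> int) set" where
  "positions = {(k, q). 0 \<le> k \<and> k \<le> N + 1 \<and> even (k + q)}"

text \<open>Angles are kept as unreduced integers, so that shifts by one step are plain arithmetic;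
  this relation is the price. Both \<open>pt\<close> and \<open>lab\<close> identify exactly the
  positions it relates.\<close>

definition same :: "int \<times> int \<Rightarrow> int \<times> int \<Rightarrow> bool" where
  "same a b \<longleftrightarrow> fst a = fst b \<and> (fst a = 0 \<or> fst a = N + 1 \<or> 2 * N dvd snd a - snd b)"

text \<open>If the apex lies on level \<open>0\<close> or \<open>N + 1\<close>, the triangle is a
  side of one of the two pyramids, so the poles need no separate clause.\<close>

definition triangles :: "(int \<times> int) set set" where
  "triangles = {{(k, q - 1), (k, q + 1), (k + t, q)} | k q t.
     1 \<le> k \<and> k \<le> N \<and> odd (k + q) \<and> (t = 1 \<or> t = -1)}"

lemma Union_triangles: "\<Union> triangles = positions"
proof (intro subset_antisym subsetI)
  fix a assume "a \<in> \<Union> triangles"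
  then show "a \<in> positions" by (auto simp: triangles_def positions_def)
next
  fix a assume "a \<in> positions"
  then obtain k q where a: "a = (k, q)" "0 \<le> k" "k \<le> N + 1" "even (k + q)"
    by (auto simp: positions_def)
  have tri: "{(l, r - 1), (l, r + 1), (l + t, r)} \<in> triangles"
    if "1 \<le> l" "l \<le> N" "odd (l + r)" "t = 1 \<or> t = -1" for l r t
    using that unfolding triangles_def by blast
  consider "k = 0" | "k = N + 1" | "1 \<le> k" "k \<le> N" using a by linarith
  then show "a \<in> \<Union> triangles"
  proof cases
    case 1
    then show ?thesis using a N3 by (intro UnionI[OF tri[of 1 q "-1"]]) auto
  next
    case 2
    then show ?thesis using a N3 by (intro UnionI[OF tri[of N q 1]]) auto
  next
    case 3
    then show ?thesis using a by (intro UnionI[OF tri[of k "q + 1" 1]]) auto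
  qed
qed

text \<open>Consecutive levels are \<open>2 * pi / (2 * N - 1)\<close> apart, symmetrically about
  the equator: the level \<open>k\<close> has angle \<open>j * \<phi>\<close> for
  \<open>j = k - (N + 1) / 2\<close>. The value 0 puts the poles on the axis.\<close>

definition rad :: "int \<Rightarrow> real" where
  "rad k = (if 1 \<le> k \<and> k \<le> N then cos (real_of_int (2 * k - N - 1) * pi / real_of_int (2 * N - 1)) else 0)"

text \<open>The poles lie only slightly above the end levels; this keeps the level maxima unimodal there.\<close>

definition ht :: "int \<Rightarrow> real" where
  "ht k = (if k < 1 then 1 - rad 1 / 2 else if k > N then N + rad 1 / 2 else k)"

definition pt :: "int \<times> int \<Rightarrow> real^3" where
  "pt = (\<lambda>(k, q). vector [rad k * cos (pi * q / N), rad k * sin (pi * q / N), ht k])"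

lemma rad_pos: "1 \<le> k \<Longrightarrow> k \<le> N \<Longrightarrow> 0 < rad k"
proof -
  assume k: "1 \<le> k" "k \<le> N"
  define c where "c = real_of_int (2 * k - N - 1)"
  define d where "d = real_of_int (2 * N - 1)"
  have d: "0 < d" using N3 by (simp add: d_def)
  have "2 * \<bar>2 * k - N - 1\<bar> < 2 * N - 1" using k by arith
  then have "real_of_int (2 * \<bar>2 * k - N - 1\<bar>) < d" unfolding d_def by (simp only: of_int_less_iff)
  then have "2 * \<bar>c\<bar> < d" unfolding c_def by (simp only: of_int_mult of_int_abs of_int_numeral)
  then have "\<bar>c\<bar> / d < 1 / 2" using d by (simp add: field_simps)
  then have "\<bar>c\<bar> / d * pi < 1 / 2 * pi" by (intro mult_strict_right_mono) auto
  then have "\<bar>c * pi / d\<bar> < pi / 2" using d by (simp add: abs_mult)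
  then have "- (pi / 2) < c * pi / d \<and> c * pi / d < pi / 2" by (simp only: abs_less_iff minus_less_iff)
  then have "0 < cos (c * pi / d)" by (simp only: cos_gt_zero_pi)
  then show ?thesis using k by (simp add: rad_def c_def d_def)
qed

lemma rad_le_1: "rad k \<le> 1" by (simp add: rad_def)

lemma rad_pole: "k = 0 \<or> k = N + 1 \<Longrightarrow> rad k = 0" by (auto simp: rad_def)

lemma rad_reflect: "rad (N + 1 - k) = rad k"
proof -
  have "real_of_int (2 * (N + 1 - k) - N - 1) * pi / real_of_int (2 * N - 1)
     = - (real_of_int (2 * k - N - 1) * pi / real_of_int (2 * N - 1))"
    unfolding minus_divide_left minus_mult_left by simp
  then show ?thesis unfolding rad_def by (simp only: cos_minus) auto
qed

text \<open>Equally spaced values of a cosine are an eigenvector of the sum over neighbours. The end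
  levels are left out because the poles have radius 0 instead of the next cosine value.\<close>

lemma rad_recurrence:
  assumes "2 \<le> k" "k \<le> N - 1"
  shows "rad (k - 1) + rad (k + 1) = 2 * cos (2 * pi / (2 * N - 1)) * rad k"
proof -
  define x where "x = real_of_int (2 * k - N - 1) * pi / real_of_int (2 * N - 1)"
  define w where "w = 2 * pi / (2 * N - 1)"
  have "real_of_int (2 * (k - 1) - N - 1) * pi / real_of_int (2 * N - 1) = x - w"
    "real_of_int (2 * (k + 1) - N - 1) * pi / real_of_int (2 * N - 1) = x + w"
    by (simp_all add: x_def w_def diff_divide_distrib[symmetric] add_divide_distrib[symmetric] left_diff_distrib distrib_right)
  then have "rad (k - 1) = cos (x - w)" "rad (k + 1) = cos (x + w)" "rad k = cos x"
    using assms by (simp_all add: rad_def x_def)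
  then show ?thesis unfolding w_def[symmetric] by (simp add: cos_add cos_diff)
qed

lemma ht_strict_mono: "0 \<le> k \<Longrightarrow> k < l \<Longrightarrow> l \<le> N + 1 \<Longrightarrow> ht k < ht l"
proof -
  assume *: "0 \<le> k" "k < l" "l \<le> N + 1"
  have r: "0 < rad 1" using rad_pos[of 1] N3 by simp
  have k: "ht k \<le> k \<or> k = 0 \<and> ht k < 1" using * r by (auto simp: ht_def)
  have l: "ht l = l \<or> N < l \<and> N < ht l" using * r by (auto simp: ht_def)
  have "real_of_int k < real_of_int l" "1 \<le> real_of_int l" "real_of_int k \<le> real_of_int N" "1 \<le> real_of_int N"
    using * N3 by auto
  with k l show "ht k < ht l" by linarith
qed

lemma ht_eq_iff:
  assumes "0 \<le> k" "k \<le> N + 1" "0 \<le> l" "l \<le> N + 1"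
  shows "ht k = ht l \<longleftrightarrow> k = l"
proof (cases k l rule: linorder_cases)
  case less
  then show ?thesis using ht_strict_mono[OF assms(1) _ assms(4)] by simp
next
  case greater
  then show ?thesis using ht_strict_mono[OF assms(3) _ assms(2)] by simp
qed simp

lemma inner_pt: "vector [x, y, z] \<bullet> pt (k, q) =
    rad k * (x * cos (pi * q / N) + y * sin (pi * q / N)) + z * ht k"
proof -
  have "vector [x, y, z] \<bullet> (vector [x', y', z'] :: real^3) = x * x' + y * y' + z * z'" for x' y' z'
    by (simp add: inner_vec_def sum_3)
  then show ?thesis by (simp add: pt_def distrib_left mult.left_commute)
qed

lemma pt_eq_iff:
  assumes "a \<in> positions" "b \<in> positions"
  shows "pt a = pt b \<longleftrightarrow> same a b"
proof -
  obtain k q where a: "a = (k, q)" "0 \<le> k" "k \<le> N + 1" using assms(1) by (auto simp: positions_def)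
  obtain l r where b: "b = (l, r)" "0 \<le> l" "l \<le> N + 1" using assms(2) by (auto simp: positions_def)
  have "pt a = pt b \<longleftrightarrow> rad k * cos (pi * q / N) = rad l * cos (pi * r / N) \<and>
      rad k * sin (pi * q / N) = rad l * sin (pi * r / N) \<and> k = l"
    using ht_eq_iff a b by (simp add: pt_def vec_eq_iff forall_3)
  also have "\<dots> \<longleftrightarrow> k = l \<and> (k = 0 \<or> k = N + 1 \<or>
      sin (pi * q / N) = sin (pi * r / N) \<and> cos (pi * q / N) = cos (pi * r / N))"
    using rad_pos[of k] rad_pole[of k] a by auto
  also have "(sin (pi * q / N) = sin (pi * r / N) \<and> cos (pi * q / N) = cos (pi * r / N)) \<longleftrightarrow> 2 * N dvd q - r"
  proof -
    have "(pi * q / N = pi * r / N + 2 * pi * real_of_int n) \<longleftrightarrow> q - r = 2 * N * n" for n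
    proof -
      have "(pi * q / N = pi * r / N + 2 * pi * real_of_int n) \<longleftrightarrow> pi * q = pi * (r + 2 * N * n)"
        using N3 by (simp add: field_simps)
      also have "\<dots> \<longleftrightarrow> real_of_int q = real_of_int (r + 2 * N * n)" by simp
      also have "\<dots> \<longleftrightarrow> q - r = 2 * N * n" by linarith
      finally show ?thesis .
    qed
    then show ?thesis unfolding sin_cos_eq_iff dvd_def by metis
  qed
  finally show ?thesis by (simp add: same_def a b)
qed

text \<open>The largest value of \<open>cos (\<pi> q / N - \<alpha>)\<close> on level \<open>k\<close>, for a direction \<open>\<alpha> = \<pi> s / N + \<beta>\<close>
  with \<open>0 \<le> \<beta> \<le> \<pi> / N\<close>.\<close>

definition cc :: "int \<Rightarrow> real \<Rightarrow> int \<Rightarrow> real" where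
  "cc s \<beta> k = (if even (k + s) then cos \<beta> else cos (pi / N - \<beta>))"

lemma cos_pi_N: "1 / 2 \<le> cos (pi / N)"
proof -
  have "pi / N \<le> pi / 3" using N3 by (intro divide_left_mono) auto
  then have "cos (pi / 3) \<le> cos (pi / N)" using N3 by (intro cos_monotone_0_pi_le) (auto simp: field_simps)
  then show ?thesis by (simp add: cos_60)
qed

lemma cc_bounds:
  assumes "0 \<le> \<beta>" "\<beta> \<le> pi / N"
  shows "cos (pi / N) \<le> cc s \<beta> k" "cc s \<beta> k \<le> 1"
proof -
  have "pi / N \<le> pi" using N3 by (simp add: field_simps)
  then show "cos (pi / N) \<le> cc s \<beta> k"
    using assms by (auto simp: cc_def intro!: cos_monotone_0_pi_le)
qed (simp add: cc_def)

text \<open>The strict bound is where \<open>\<phi> > pi / N\<close> enters; nonnegativity allows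
  multiplying the bound \<open>cc_bounds(2)\<close> by this cosine.\<close>

lemma cos_step: "0 \<le> cos (2 * pi / (2 * N - 1))" "cos (2 * pi / (2 * N - 1)) < cos (pi / N)"
proof -
  have "2 * pi / (2 * N - 1) \<le> 2 * pi / 4" using N3 by (intro divide_left_mono) auto
  moreover have "0 \<le> 2 * pi / (2 * N - 1)" using N3 by simp
  ultimately show "0 \<le> cos (2 * pi / (2 * N - 1))" by (intro cos_ge_zero) auto
  have "2 * pi / (2 * N - 1) \<le> 2 * pi / 2" using N3 by (intro divide_left_mono) auto
  moreover have "pi / N < 2 * pi / (2 * N - 1)" using N3 by (simp add: field_simps)
  ultimately show "cos (2 * pi / (2 * N - 1)) < cos (pi / N)" using N3 by (intro cos_monotone_0_pi) auto
qed

lemma less_weighted_mean: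
  fixes x y z e :: real
  assumes "x + e * y < (1 + e) * z" and "0 \<le> e"
  shows "x < z \<or> y < z"
proof (rule ccontr)
  assume "\<not> ?thesis"
  then have "z \<le> x" "e * z \<le> e * y" using assms(2) by (auto intro: mult_left_mono)
  then show False using assms(1) by (simp add: distrib_right)
qed

text \<open>Each level is compared with a weighted mean of its neighbours whose weights make the
  height term \<open>\<zeta> * ht\<close> cancel, so the sign and size of \<open>\<zeta>\<close> do
  not matter. Equal weights do this on equally spaced levels; next to a pole the weights are 1 for
  the pole and \<open>rad 1 / 2\<close> for the other neighbour.\<close>

lemma unimodal_profile:
  assumes \<beta>: "0 \<le> \<beta>" "\<beta> \<le> pi / N"
  shows "unimodal_on_levels N (\<lambda>k. rad k * cc s \<beta> k + \<zeta> * ht k)"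
  unfolding unimodal_on_levels_def
proof (intro allI impI)
  let ?F = "\<lambda>k. rad k * cc s \<beta> k + \<zeta> * ht k"
  fix k assume k: "1 \<le> k \<and> k \<le> N"
  note bd = cc_bounds[OF \<beta>, of s]
  have pos: "0 < cc s \<beta> l" for l using bd(1)[of l] cos_pi_N by linarith
  \<comment> \<open>The pole has radius 0, so only the other neighbour counts. Its share is at most
    \<open>rad 1 / 2\<close>, and \<open>cos (pi / N) \<ge> 1 / 2\<close> makes this at most
    \<open>rad 1 * cc s \<beta> k\<close>.\<close>
  have end_ineq: "rad l * cc s \<beta> l * (rad 1 / 2) < (1 + rad 1 / 2) * (rad 1 * cc s \<beta> k)" for l
  proof -
    have r1: "0 < rad 1" using rad_pos[of 1] N3 by simp
    have "rad l * cc s \<beta> l \<le> 1" using rad_le_1[of l] bd(2)[of l] pos[of l] by (smt (verit) mult_left_le_one_le mult_nonneg_nonneg mult_le_one mult_neg_pos)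
    then have "rad l * cc s \<beta> l * (rad 1 / 2) \<le> rad 1 / 2" using r1 by (simp add: mult_left_le_one_le mult_right_le_one_le)
    also have "\<dots> \<le> rad 1 * cc s \<beta> k" using bd(1)[of k] cos_pi_N r1 by simp
    also have "\<dots> < (1 + rad 1 / 2) * (rad 1 * cc s \<beta> k)" using r1 pos[of k] by simp
    finally show ?thesis .
  qed
  consider "k = 1" | "k = N" | "2 \<le> k" "k \<le> N - 1" using k by linarith
  then show "?F (k - 1) < ?F k \<or> ?F (k + 1) < ?F k"
  proof cases
    case 1
    \<comment> \<open>The heights \<open>1 - rad 1 / 2\<close>, \<open>1\<close> and
      \<open>2\<close> satisfy
      \<open>ht 0 + (rad 1 / 2) * ht 2 = (1 + rad 1 / 2) * ht 1\<close>.\<close>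
    have "?F 0 + (rad 1 / 2) * ?F 2 < (1 + rad 1 / 2) * ?F 1"
      using end_ineq[of 2] 1 N3 by (simp add: rad_pole ht_def algebra_simps)
    then have "?F 0 < ?F 1 \<or> ?F 2 < ?F 1" 
      by (rule less_weighted_mean) (use rad_pos[of 1] N3 in simp)
    then show ?thesis using 1 by simp
  next
    case 2
    have rN: "rad N = rad 1" using rad_reflect[of 1] by simp
    have "?F (N + 1) + (rad 1 / 2) * ?F (N - 1) < (1 + rad 1 / 2) * ?F N"
      using end_ineq[of "N - 1"] 2 N3 rN by (simp add: rad_pole ht_def algebra_simps)
    then have "?F (N + 1) < ?F N \<or> ?F (N - 1) < ?F N" 
      by (rule less_weighted_mean) (use rad_pos[of 1] N3 in simp)
    then show ?thesis using 2 by auto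
  next
    case 3
    define c where "c = cc s \<beta> (k + 1)"
    \<comment> \<open>Levels \<open>k - 1\<close> and \<open>k + 1\<close> have the same parity,
      hence the same best cosine.\<close>
    have c: "cc s \<beta> (k - 1) = c" "cc s \<beta> (k + 1) = c" by (simp_all add: c_def cc_def)
    have "cos (2 * pi / (2 * N - 1)) * c \<le> cos (2 * pi / (2 * N - 1))"
      using cos_step(1) bd(2)[of "k + 1"] by (simp add: c_def mult_left_le)
    then have "cos (2 * pi / (2 * N - 1)) * c < cc s \<beta> k" using cos_step(2) bd(1)[of k] by linarith
    then have "rad k * (cos (2 * pi / (2 * N - 1)) * c) < rad k * cc s \<beta> k"
      using rad_pos[of k] k by simp
    moreover have "rad (k - 1) * c + rad (k + 1) * c = 2 * (rad k * (cos (2 * pi / (2 * N - 1)) * c))"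
      using rad_recurrence[OF 3] by (simp add: distrib_right[symmetric])
    moreover have "ht (k - 1) + ht (k + 1) = 2 * ht k" using 3 by (simp add: ht_def)
    then have "\<zeta> * ht (k - 1) + \<zeta> * ht (k + 1) = 2 * (\<zeta> * ht k)" by (simp add: distrib_left[symmetric])
    ultimately show ?thesis unfolding c by linarith
  qed
qed

text \<open>The vertices of a level form a regular \<open>N\<close>-gon at the angles of one parity.
  The direction lies between the angles \<open>s\<close> and \<open>s + 1\<close>, so the nearest
  vertex is the one of these with the right parity. Since \<open>\<beta> < pi / N\<close>, a tie can
  occur only for \<open>\<beta> = 0\<close> on the levels of the other parity, between
  \<open>s - 1\<close> and \<open>s + 1\<close>.\<close>

lemma level_max:
  assumes \<beta>: "0 \<le> \<beta>" "\<beta> < pi / N" and kq: "even (k + q)"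
  shows "cos (pi * q / N - (pi * s / N + \<beta>)) \<le> cc s \<beta> k"
    and "cos (pi * q / N - (pi * s / N + \<beta>)) = cc s \<beta> k \<Longrightarrow>
      (if even (k + s) then 2 * N dvd q - s else 2 * N dvd q - (s - 1) \<or> 2 * N dvd q - (s + 1))"
proof -
  have N0: "0 < N" using N3 by simp
  define x :: real and t where "x = (if even (k + s) then - \<beta> else pi / N - \<beta>)"
    and "t = (if even (k + s) then (q - s) div 2 else (q - s - 1) div 2)"
  have x: "\<bar>x\<bar> \<le> pi / N" using \<beta> by (auto simp: x_def)
  have q: "q = s + 2 * t + (if even (k + s) then 0 else 1)" using kq by (auto simp: t_def)
  have ang: "pi * q / N - (pi * s / N + \<beta>) = x + 2 * pi * t / N"
    using N0 by (subst q) (auto simp: x_def field_simps)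
  have cc: "cc s \<beta> k = cos x" by (simp add: cc_def x_def)
  show "cos (pi * q / N - (pi * s / N + \<beta>)) \<le> cc s \<beta> k"
  proof (cases "N dvd t")
    case True
    then obtain n where "t = N * n" by blast
    then have "x + 2 * pi * t / N = x + 2 * pi * n" using N0 by simp
    then show ?thesis unfolding ang cc by (simp only: cos_add_2pi_int)
  next
    case False
    then show ?thesis unfolding ang cc using cos_regular_polygon(1)[OF N0 x] by blast
  qed
  assume eq: "cos (pi * q / N - (pi * s / N + \<beta>)) = cc s \<beta> k"
  show "if even (k + s) then 2 * N dvd q - s else 2 * N dvd q - (s - 1) \<or> 2 * N dvd q - (s + 1)"
  proof (cases "N dvd t")
    case True
    then show ?thesis using q by auto
  next
    case False
    have "x = pi / N \<and> N dvd t + 1 \<or> x = - pi / N \<and> N dvd t - 1"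
      using cos_regular_polygon(2)[OF N0 x False] eq ang cc by simp
    moreover have "x \<noteq> - pi / N" using \<beta> N0 by (auto simp: x_def)
    moreover have "x \<noteq> pi / N" if "even (k + s)" using \<beta> that N0 by (auto simp: x_def)
    ultimately have "odd (k + s)" "N dvd t + 1" by auto
    then have "2 * N dvd 2 * (t + 1)" by (simp only: dvd_mult_cancel_left) simp
    moreover have "q - (s - 1) = 2 * (t + 1)" using q \<open>odd (k + s)\<close> by simp
    ultimately have "2 * N dvd q - (s - 1)" by (simp only:)
    then show ?thesis using \<open>odd (k + s)\<close> by metis
  qed
qed

text \<open>\<open>positions\<close> is infinite, but each class of \<open>same\<close> has a member
  with angle in \<open>{0..<2 * N}\<close>.\<close>

lemma finite_image_positions:
  assumes f: "\<And>a b. a \<in> positions \<Longrightarrow> b \<in> positions \<Longrightarrow> same a b \<Longrightarrow> f a = f b"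
  shows "finite (f ` positions)"
proof -
  have "f ` positions \<subseteq> f ` ({0..N+1} \<times> {0..<2*N})"
  proof (rule image_subsetI)
    fix a assume a: "a \<in> positions"
    then obtain k q where kq: "a = (k, q)" "0 \<le> k" "k \<le> N + 1" "even (k + q)"
      by (auto simp: positions_def)
    have "even (q mod (2 * N)) \<longleftrightarrow> even q" by (simp add: dvd_mod_iff)
    then have "(k, q mod (2 * N)) \<in> positions" using kq by (auto simp: positions_def)
    moreover have "2 * N dvd q - q mod (2 * N)" by (simp add: minus_mod_eq_mult_div)
    ultimately have "f a = f (k, q mod (2 * N))" using a kq by (intro f) (simp_all add: same_def)
    then show "f a \<in> f ` ({0..N+1} \<times> {0..<2*N})" using kq N3 by auto
  qed
  then show ?thesis by (rule finite_subset) simp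
qed

section \<open>Supporting hyperplanes of the drum\<close>

lemma triangle_in_triangles:
  "1 \<le> k \<Longrightarrow> k \<le> N \<Longrightarrow> odd (k + q) \<Longrightarrow> t = 1 \<or> t = -1 \<Longrightarrow>
    {(k, q - 1), (k, q + 1), (k + t, q)} \<in> triangles"
  unfolding triangles_def by blast

lemma triangle_subset_positions: "T \<in> triangles \<Longrightarrow> T \<subseteq> positions"
  using Union_triangles by blast

lemma pt_triangle_independent:
  assumes "T \<in> triangles"
  shows "\<not> affine_dependent (pt ` T)"
proof -
  obtain k q t where T: "T = {(k, q - 1), (k, q + 1), (k + t, q)}" "1 \<le> k" "k \<le> N" "t = 1 \<or> t = -1"
    using assms unfolding triangles_def by blast
  have "\<not> 2 * N dvd - 2" using N3 zdvd_imp_le[of "2 * N" 2] by auto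
  then have "pt (k, q - 1) \<noteq> pt (k, q + 1)"
    using triangle_subset_positions[OF assms] T N3 by (simp add: pt_eq_iff same_def)
  moreover have ht: "vector [0, 0, 1] \<bullet> pt (l, r) = ht l" for l r by (simp add: inner_pt)
  moreover have "ht (k + t) \<noteq> ht k" using T N3 by (auto simp: ht_eq_iff)
  ultimately have "\<not> affine_dependent {pt (k, q - 1), pt (k, q + 1), pt (k + t, q)}"
    by (intro affine_independent_triangle[where c = "vector [0, 0, 1]"]) auto
  then show ?thesis by (simp add: T)
qed

lemma pt_triangle_proper:
  assumes "T \<in> triangles"
  shows "pt ` T \<subset> pt ` positions"
proof -
  obtain k q t where T: "T = {(k, q - 1), (k, q + 1), (k + t, q)}" "1 \<le> k" "k \<le> N" "t = 1 \<or> t = -1"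
    using assms unfolding triangles_def by blast
  \<comment> \<open>A pole off both levels of the triangle; its coordinate sum is even.\<close>
  define p where "p = (if k + t = 0 then (N + 1, N + 1) else (0, 0))"
  have p: "p \<in> positions" "fst p \<noteq> k" "fst p \<noteq> k + t" using T N3 by (auto simp: p_def positions_def)
  have "pt p \<notin> pt ` T"
  proof
    assume "pt p \<in> pt ` T"
    then obtain a where "a \<in> T" "pt p = pt a" by blast
    then have "same p a" using pt_eq_iff p(1) triangle_subset_positions[OF assms] by blast
    then show False using \<open>a \<in> T\<close> p T(1) by (auto simp: same_def)
  qed
  then show ?thesis using p(1) triangle_subset_positions[OF assms] by blast
qed

lemma inner_pt_polar:
  "vector [\<rho> * cos \<alpha>, \<rho> * sin \<alpha>, \<rho> * \<zeta>] \<bullet> pt (k, q) =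
     \<rho> * (rad k * cos (pi * q / N - \<alpha>) + \<zeta> * ht k)"
  by (simp add: inner_pt cos_diff algebra_simps)

lemma level_value_le:
  assumes "0 \<le> \<beta>" "\<beta> < pi / N" and "(k, q) \<in> positions"
  shows "rad k * cos (pi * q / N - (pi * s / N + \<beta>)) + \<zeta> * ht k \<le> rad k * cc s \<beta> k + \<zeta> * ht k"
proof (cases "1 \<le> k \<and> k \<le> N")
  case True
  then show ?thesis using level_max(1)[OF assms(1,2), of k q s] rad_pos[of k] assms(3)
    by (simp add: positions_def)
qed (auto simp: rad_def)

text \<open>Horizontally the functional points at the angle \<open>s\<close> of the apex, midway
  between the two base vertices, so \<open>\<beta> = 0\<close> and the tie of
  \<open>level_max\<close> occurs on level \<open>k\<close>. The slope \<open>\<zeta>\<close> is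
  chosen to make the maxima of levels \<open>k\<close> and \<open>k + t\<close> equal; by
  \<open>unimodal_two_max\<close> all other levels stay strictly below.\<close>

lemma pt_triangle_exposed:
  assumes "T \<in> triangles"
  shows "\<exists>a b. (\<forall>x\<in>pt ` positions. a \<bullet> x \<le> b) \<and> {x\<in>pt ` positions. a \<bullet> x = b} = pt ` T"
proof -
  obtain k s t where T: "T = {(k, s - 1), (k, s + 1), (k + t, s)}"
    and k: "1 \<le> k" "k \<le> N" "odd (k + s)" and t: "t = 1 \<or> t = -1"
    using assms unfolding triangles_def by blast
  have Npos: "0 < pi / N" using N3 by simp
  define \<zeta> where "\<zeta> = (rad k * cc s 0 k - rad (k + t) * cc s 0 (k + t)) / (ht (k + t) - ht k)"
  define F where "F = (\<lambda>l. rad l * cc s 0 l + \<zeta> * ht l)"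
  define a where "a = (vector [1 * cos (pi * s / N), 1 * sin (pi * s / N), 1 * \<zeta>] :: real^3)"
  have "ht (k + t) \<noteq> ht k" using k t N3 by (auto simp: ht_eq_iff)
  then have "\<zeta> * (ht (k + t) - ht k) = rad k * cc s 0 k - rad (k + t) * cc s 0 (k + t)"
    by (simp add: \<zeta>_def)
  then have Feq: "F (k + t) = F k" by (simp add: F_def algebra_simps)
  have uni: "unimodal_on_levels N F" unfolding F_def using Npos by (intro unimodal_profile) auto
  have Flt: "F l < F k" if "0 \<le> l" "l \<le> N + 1" "l \<noteq> k" "l \<noteq> k + t" for l
    using t
  proof
    assume "t = 1"
    then show ?thesis using unimodal_two_max[OF uni, of k l] k that Feq by simp
  next
    assume "t = -1"
    then show ?thesis using unimodal_two_max[OF uni, of "k - 1" l] k that Feq by simp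
  qed
  have val: "a \<bullet> pt (l, q) = rad l * cos (pi * q / N - (pi * s / N + 0)) + \<zeta> * ht l" for l q
    unfolding a_def inner_pt_polar by simp
  have le: "a \<bullet> pt (l, q) \<le> F l" if "(l, q) \<in> positions" for l q
    unfolding val F_def using level_value_le[OF order_refl Npos that] .
  have Fle: "F l \<le> F k" if "0 \<le> l" "l \<le> N + 1" for l using Flt[of l] that Feq by (metis less_imp_le order_refl)
  have "\<forall>x\<in>pt ` positions. a \<bullet> x \<le> F k"
  proof
    fix x assume "x \<in> pt ` positions"
    then obtain l q where "x = pt (l, q)" "(l, q) \<in> positions" by (metis imageE surj_pair)
    then show "a \<bullet> x \<le> F k" using le[of l q] Fle[of l] by (auto simp: positions_def)
  qed
  moreover have "{x\<in>pt ` positions. a \<bullet> x = F k} = pt ` T"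
  proof (intro subset_antisym subsetI)
    fix x assume "x \<in> {x\<in>pt ` positions. a \<bullet> x = F k}"
    then obtain l q where x: "x = pt (l, q)" and lq: "(l, q) \<in> positions" and eq: "a \<bullet> pt (l, q) = F k"
      by (metis (mono_tags, lifting) imageE mem_Collect_eq surj_pair)
    have l: "0 \<le> l" "l \<le> N + 1" "even (l + q)" using lq by (auto simp: positions_def)
    then have lkt: "l = k \<or> l = k + t" using Flt[of l] le[OF lq] eq by linarith
    then have Fl: "F l = F k" using Feq by auto
    have "\<exists>b\<in>T. same (l, q) b"
    proof (cases "1 \<le> l \<and> l \<le> N")
      case False
      then have "l = k + t" using lkt k by auto
      moreover have "l = 0 \<or> l = N + 1" using False l by linarith
      ultimately have "same (l, q) (k + t, s)" by (auto simp: same_def)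
      then show ?thesis by (auto simp: T)
    next
      case True
      have "rad l * cos (pi * q / N - (pi * s / N + 0)) = rad l * cc s 0 l"
        using eq Fl unfolding val F_def by linarith
      then have "cos (pi * q / N - (pi * s / N + 0)) = cc s 0 l"
        using rad_pos[of l] True by simp
      then have "if even (l + s) then 2 * N dvd q - s else 2 * N dvd q - (s - 1) \<or> 2 * N dvd q - (s + 1)"
        using level_max(2)[OF order_refl Npos l(3), of s] by simp
      moreover have "even (l + s) \<longleftrightarrow> l \<noteq> k" using lkt k(3) t by auto
      ultimately have "same (l, q) (k + t, s) \<or> same (l, q) (k, s - 1) \<or> same (l, q) (k, s + 1)"
        using lkt by (cases "l = k") (simp add: same_def, blast, simp add: same_def)
      then show ?thesis unfolding T by blast
    qed
    then show "x \<in> pt ` T" using pt_eq_iff lq triangle_subset_positions[OF assms] x by blast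
  next
    fix x assume "x \<in> pt ` T"
    then obtain b where b: "b \<in> T" "x = pt b" by blast
    have "a \<bullet> pt (k + t, s) = F (k + t)" using k(3) t by (auto simp: val F_def cc_def)
    moreover have "pi * real_of_int (s - 1) / N - pi * s / N = - (pi / N)"
      "pi * real_of_int (s + 1) / N - pi * s / N = pi / N"
      by (simp_all add: diff_divide_distrib add_divide_distrib algebra_simps)
    then have "a \<bullet> pt (k, s - 1) = F k" "a \<bullet> pt (k, s + 1) = F k"
      using k(3) by (simp_all only: val F_def cc_def add_0_right cos_minus if_False diff_zero)
    ultimately have "a \<bullet> x = F k" using b Feq by (auto simp: T)
    then show "x \<in> {x\<in>pt ` positions. a \<bullet> x = F k}"
      using b triangle_subset_positions[OF assms] by blast
  qed
  ultimately show ?thesis by blast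
qed

text \<open>Of two adjacent levels, one, \<open>k'\<close>, has the parity of \<open>s\<close> and
  the single candidate \<open>s\<close>; the other, \<open>k\<close>, has the candidates
  \<open>s - 1\<close> and \<open>s + 1\<close>. Together they form a triangle with its base on
  \<open>k\<close>. If \<open>k\<close> is a pole, there is no base on it, and a triangle with apex
  on \<open>k\<close> and base vertices \<open>s\<close> and \<open>s + 2\<close> on
  \<open>k'\<close> serves.\<close>

lemma consecutive_levels_triangle:
  assumes "0 \<le> j" "j \<le> N"
  shows "\<exists>T\<in>triangles. \<forall>(l, q)\<in>positions. (l = j \<or> l = j + 1) \<longrightarrow>
     (1 \<le> l \<longrightarrow> l \<le> N \<longrightarrow>
       (if even (l + s) then 2 * N dvd q - s else 2 * N dvd q - (s - 1) \<or> 2 * N dvd q - (s + 1))) \<longrightarrow>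
     (\<exists>b\<in>T. same (l, q) b)" (is "\<exists>T\<in>triangles. ?P T")
proof -
  define k where "k = (if odd (j + s) then j else j + 1)"
  define k' where "k' = (if odd (j + s) then j + 1 else j)"
  have k: "odd (k + s)" "even (k' + s)" "k' = k + 1 \<or> k' = k - 1" "{j, j + 1} = {k, k'}"
    by (auto simp: k_def k'_def)
  have k0: "0 \<le> k" "k \<le> N + 1" "0 \<le> k'" "k' \<le> N + 1" using assms by (auto simp: k_def k'_def)
  consider "1 \<le> k" "k \<le> N" | "k = 0" | "k = N + 1" using k0 by linarith
  then show ?thesis
  proof cases
    case 1
    let ?T = "{(k, s - 1), (k, s + 1), (k + (k' - k), s)}"
    have "?T \<in> triangles" using 1 k by (intro triangle_in_triangles) auto
    moreover have "?P ?T"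
    proof (clarify)
      fix l q assume l: "l = j \<or> l = j + 1" and imp: "1 \<le> l \<longrightarrow> l \<le> N \<longrightarrow>
       (if even (l + s) then 2 * N dvd q - s else 2 * N dvd q - (s - 1) \<or> 2 * N dvd q - (s + 1))"
      from l have "l = k \<or> l = k'" using k(4) by blast
      then show "\<exists>b\<in>?T. same (l, q) b"
      proof
        assume lk: "l = k"
        then have "2 * N dvd q - (s - 1) \<or> 2 * N dvd q - (s + 1)" using imp 1 k(1) by simp
        then show ?thesis using lk by (auto simp: same_def)
      next
        assume lk: "l = k'"
        then have "1 \<le> l \<longrightarrow> l \<le> N \<longrightarrow> 2 * N dvd q - s" using imp k(2) by simp
        moreover have "l < 1 \<longrightarrow> l = 0" "N < l \<longrightarrow> l = N + 1" using lk k0 by linarith+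
        ultimately have "l = 0 \<or> l = N + 1 \<or> 2 * N dvd q - s" by linarith
        then have "same (l, q) (k + (k' - k), s)" using lk by (simp add: same_def)
        then show ?thesis by blast
      qed
    qed
    ultimately show ?thesis by blast
  next
    case 2
    let ?T = "{(1, s + 1 - 1), (1, s + 1 + 1), (1 + (- 1), s + 1)}"
    have "?T \<in> triangles" using 2 k N3 by (intro triangle_in_triangles) auto
    moreover have "?P ?T"
    proof (clarify)
      fix l q assume l: "l = j \<or> l = j + 1" and imp: "1 \<le> l \<longrightarrow> l \<le> N \<longrightarrow>
       (if even (l + s) then 2 * N dvd q - s else 2 * N dvd q - (s - 1) \<or> 2 * N dvd q - (s + 1))"
      have k': "k' = 1" using 2 k k0 by auto
      from l have "l = k \<or> l = k'" using k(4) by blast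
      then have "same (l, q) (1, s + 1 - 1) \<or> same (l, q) (1 + (- 1), s + 1)"
      proof
        assume "l = k"
        then show ?thesis using 2 by (simp add: same_def)
      next
        assume "l = k'"
        then show ?thesis using imp k(2) k' N3 by (simp add: same_def)
      qed
      then show "\<exists>b\<in>?T. same (l, q) b" by blast
    qed
    ultimately show ?thesis by blast
  next
    case 3
    let ?T = "{(N, s + 1 - 1), (N, s + 1 + 1), (N + 1, s + 1)}"
    have "?T \<in> triangles" using 3 k N3 by (intro triangle_in_triangles) auto
    moreover have "?P ?T"
    proof (clarify)
      fix l q assume l: "l = j \<or> l = j + 1" and imp: "1 \<le> l \<longrightarrow> l \<le> N \<longrightarrow>
       (if even (l + s) then 2 * N dvd q - s else 2 * N dvd q - (s - 1) \<or> 2 * N dvd q - (s + 1))"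
      have k': "k' = N" using 3 k k0 by auto
      from l have "l = k \<or> l = k'" using k(4) by blast
      then have "same (l, q) (N, s + 1 - 1) \<or> same (l, q) (N + 1, s + 1)"
      proof
        assume "l = k"
        then show ?thesis using 3 by (simp add: same_def)
      next
        assume "l = k'"
        then show ?thesis using imp k(2) k' N3 by (simp add: same_def)
      qed
      then show "\<exists>b\<in>?T. same (l, q) b" by blast
    qed
    ultimately show ?thesis by blast
  qed
qed

text \<open>In polar coordinates for the horizontal part, \<open>s\<close> counts the full steps
  \<open>pi / N\<close> in its argument and \<open>\<beta>\<close> is the remainder. Contact
  vertices maximize the functional on their level, and their level attains the overall maximum;
  unimodality confines these levels to two adjacent ones, where
  \<open>consecutive_levels_triangle\<close> applies.\<close>

lemma pt_argmax_subset_triangle: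
  assumes "a \<noteq> 0" and le: "\<forall>x\<in>pt ` positions. a \<bullet> x \<le> b"
  shows "\<exists>T\<in>triangles. {x\<in>pt ` positions. a \<bullet> x = b} \<subseteq> pt ` T"
proof -
  have suff: "\<exists>T\<in>triangles. {x\<in>pt ` positions. a \<bullet> x = b} \<subseteq> pt ` T"
    if ex: "\<exists>T\<in>triangles. \<forall>(l, q)\<in>positions. a \<bullet> pt (l, q) = b \<longrightarrow> (\<exists>c\<in>T. same (l, q) c)"
  proof -
    obtain T where T: "T \<in> triangles"
      "\<And>l q. (l, q) \<in> positions \<Longrightarrow> a \<bullet> pt (l, q) = b \<Longrightarrow> \<exists>c\<in>T. same (l, q) c"
      using ex by blast
    have "pt p \<in> pt ` T" if p: "p \<in> positions" "a \<bullet> pt p = b" for p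
    proof -
      obtain c where "c \<in> T" "same p c" using T(2)[of "fst p" "snd p"] p by auto
      then show ?thesis using pt_eq_iff[OF p(1)] triangle_subset_positions[OF T(1)] by (metis imageI subsetD)
    qed
    then show ?thesis using T(1) by blast
  qed
  define z where "z = Complex (a $ 1) (a $ 2)"
  define \<rho> where "\<rho> = cmod z"
  define \<alpha> where "\<alpha> = Arg z"
  have a1: "a $ 1 = \<rho> * cos \<alpha>" and a2: "a $ 2 = \<rho> * sin \<alpha>"
    using rcis_cmod_Arg[of z] unfolding \<rho>_def \<alpha>_def
    by (metis Re_rcis complex.sel(1) z_def, metis Im_rcis complex.sel(2) z_def)
  show ?thesis
  proof (cases "\<rho> = 0")
    case True
    \<comment> \<open>A vertical functional is maximal only at one pole, since \<open>ht\<close> is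
      strictly increasing.\<close>
    then have a3: "a $ 3 \<noteq> 0" using \<open>a \<noteq> 0\<close> a1 a2 by (auto simp: vec_eq_iff forall_3)
    have av: "a = vector [0, 0, a $ 3]" using a1 a2 True by (simp add: vec_eq_iff forall_3)
    have val: "a \<bullet> pt (k, q) = a $ 3 * ht k" for k q by (subst av) (simp add: inner_pt)
    have poles: "(N + 1, N + 1) \<in> positions" "(0, 0) \<in> positions" using N3 by (auto simp: positions_def)
    have hi: "a $ 3 * ht (N + 1) \<le> b" "a $ 3 * ht 0 \<le> b" using le poles val by (metis image_eqI)+
    define p where "p = (if a $ 3 > 0 then N + 1 else 0)"
    have lp: "l = p" if l: "(l, q) \<in> positions" "a \<bullet> pt (l, q) = b" for l q
    proof (rule ccontr)
      assume "l \<noteq> p"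
      then have "a $ 3 * ht l < a $ 3 * ht p"
        using l(1) a3 ht_strict_mono[of l "N + 1"] ht_strict_mono[of 0 l]
        by (auto simp: p_def positions_def mult_less_cancel_left)
      then show False using hi l(2) val by (auto simp: p_def split: if_splits)
    qed
    have "p = 0 \<or> p = N + 1" by (simp add: p_def)
    then have "\<exists>q. (p, q) \<in> positions" using poles by blast
    then obtain T r where "T \<in> triangles" "(p, r) \<in> T" using Union_triangles by blast
    moreover have "same (p, q) (p, r)" for q using \<open>p = 0 \<or> p = N + 1\<close> by (auto simp: same_def)
    ultimately show ?thesis by (intro suff bexI[of _ T]) (use lp in blast)+
  next
    case False
    then have \<rho>: "0 < \<rho>" by (simp add: \<rho>_def)
    define \<zeta> where "\<zeta> = a $ 3 / \<rho>"
    define M where "M = b / \<rho>"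
    have N0: "0 < pi / N" using N3 by simp
    define s where "s = \<lfloor>\<alpha> / (pi / N)\<rfloor>"
    define \<beta> where "\<beta> = \<alpha> - pi * s / N"
    have "real_of_int s \<le> \<alpha> / (pi / N)" "\<alpha> / (pi / N) < real_of_int s + 1"
      by (simp_all add: s_def)
    then have "real_of_int s * (pi / N) \<le> \<alpha>" "\<alpha> < (real_of_int s + 1) * (pi / N)"
      using N0 by (simp_all only: pos_le_divide_eq pos_divide_less_eq)
    then have \<beta>: "0 \<le> \<beta>" "\<beta> < pi / N" by (simp_all add: \<beta>_def algebra_simps add_divide_distrib)
    have \<alpha>: "\<alpha> = pi * s / N + \<beta>" by (simp add: \<beta>_def)
    have "a = vector [\<rho> * cos \<alpha>, \<rho> * sin \<alpha>, \<rho> * \<zeta>]"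
      using a1 a2 \<rho> by (simp add: vec_eq_iff forall_3 \<zeta>_def)
    then have val: "a \<bullet> pt (k, q) = \<rho> * (rad k * cos (pi * q / N - (pi * s / N + \<beta>)) + \<zeta> * ht k)" for k q
      using inner_pt_polar \<alpha> by metis
    define F where "F = (\<lambda>l. rad l * cc s \<beta> l + \<zeta> * ht l)"
    have uni: "unimodal_on_levels N F" unfolding F_def using \<beta> by (intro unimodal_profile) auto
    have FM: "F k \<le> M" if k: "0 \<le> k" "k \<le> N + 1" for k
    proof -
      \<comment> \<open>The maximum of the level is attained at this angle, so \<open>F k\<close>
        inherits the bound \<open>M\<close>.\<close>
      define q where "q = (if even (k + s) then s else s + 1)"
      have pos: "(k, q) \<in> positions" using k by (auto simp: q_def positions_def)
      have "pi * real_of_int (s + 1) / N - (pi * s / N + \<beta>) = pi / N - \<beta>"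
        by (simp add: add_divide_distrib algebra_simps)
      moreover have "pi * real_of_int s / N - (pi * s / N + \<beta>) = - \<beta>" by simp
      ultimately have "cos (pi * q / N - (pi * s / N + \<beta>)) = cc s \<beta> k"
        by (simp only: q_def cc_def cos_minus split: if_split) simp
      then have "a \<bullet> pt (k, q) = \<rho> * F k" unfolding val F_def by simp
      then have "\<rho> * F k \<le> b" using le pos by (metis image_eqI)
      then show ?thesis using \<rho> by (simp add: M_def field_simps)
    qed
    have max: "F l = M \<and> (1 \<le> l \<longrightarrow> l \<le> N \<longrightarrow>
       (if even (l + s) then 2 * N dvd q - s else 2 * N dvd q - (s - 1) \<or> 2 * N dvd q - (s + 1)))"
      if lq: "(l, q) \<in> positions" "a \<bullet> pt (l, q) = b" for l q
    proof -
      have l: "0 \<le> l" "l \<le> N + 1" "even (l + q)" using lq(1) by (auto simp: positions_def)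
      let ?v = "rad l * cos (pi * q / N - (pi * s / N + \<beta>)) + \<zeta> * ht l"
      have v: "?v = M" using lq(2) \<rho> unfolding val M_def by (simp add: field_simps)
      have "?v \<le> F l" unfolding F_def using level_value_le[OF \<beta> lq(1)] .
      then have Fl: "F l = M" using FM[OF l(1,2)] v by linarith
      have "rad l * cos (pi * q / N - (pi * s / N + \<beta>)) = rad l * cc s \<beta> l"
        using v Fl unfolding F_def by linarith
      then have "1 \<le> l \<Longrightarrow> l \<le> N \<Longrightarrow> cos (pi * q / N - (pi * s / N + \<beta>)) = cc s \<beta> l"
        using rad_pos[of l] by simp
      then show ?thesis using Fl level_max(2)[OF \<beta> l(3), of s] by blast
    qed
    have "\<exists>j. 0 \<le> j \<and> j \<le> N \<and> (\<forall>l. 0 \<le> l \<longrightarrow> l \<le> N + 1 \<longrightarrow> F l = M \<longrightarrow> l = j \<or> l = j + 1)"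
    proof (cases "\<exists>l. 0 \<le> l \<and> l \<le> N + 1 \<and> F l = M")
      case True
      then obtain l where l: "0 \<le> l" "l \<le> N + 1" "F l = M" by blast
      have adj: "m = l \<or> m = l + 1 \<or> m = l - 1" if "0 \<le> m" "m \<le> N + 1" "F m = M" for m
        using unimodal_argmax_adjacent[OF uni FM, of l m] unimodal_argmax_adjacent[OF uni FM, of m l] l that
        by (cases l m rule: linorder_cases) auto
      have not3: "\<not> (F (l - 1) = M \<and> F (l + 1) = M)" if "1 \<le> l" "l \<le> N"
        using unimodal_argmax_adjacent[OF uni FM, of "l - 1" "l + 1"] that by auto
      show ?thesis
      proof (cases "l \<le> N \<and> (l = 0 \<or> F (l - 1) \<noteq> M)")
        case True
        have "m = l \<or> m = l + 1" if "0 \<le> m" "m \<le> N + 1" "F m = M" for m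
          using adj[OF that] True that by auto
        then show ?thesis using True l by blast
      next
        case False
        have "F (l + 1) \<noteq> M" if "l \<le> N" using False not3 l that by auto
        then have "m = l - 1 \<or> m = l - 1 + 1" if "0 \<le> m" "m \<le> N + 1" "F m = M" for m
          using adj[OF that] that l by (cases "m = l + 1") auto
        moreover have "0 \<le> l - 1" "l - 1 \<le> N" using False l N3 by linarith+
        ultimately show ?thesis by blast
      qed
    next
      case False
      \<comment> \<open>The value \<open>b\<close> need not be attained; then any \<open>j\<close>
        will do.\<close>
      then show ?thesis using N3 by (intro exI[of _ 0]) auto
    qed
    then obtain j where j: "0 \<le> j" "j \<le> N"
      "\<And>l. 0 \<le> l \<Longrightarrow> l \<le> N + 1 \<Longrightarrow> F l = M \<Longrightarrow> l = j \<or> l = j + 1" by blast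
    obtain T where T: "T \<in> triangles" "\<forall>(l, q)\<in>positions. (l = j \<or> l = j + 1) \<longrightarrow>
     (1 \<le> l \<longrightarrow> l \<le> N \<longrightarrow>
       (if even (l + s) then 2 * N dvd q - s else 2 * N dvd q - (s - 1) \<or> 2 * N dvd q - (s + 1))) \<longrightarrow>
     (\<exists>b\<in>T. same (l, q) b)" using consecutive_levels_triangle[OF j(1,2)] by blast
    show ?thesis
    proof (intro suff bexI[OF _ T(1)] ballI, clarify)
      fix l q assume lq: "(l, q) \<in> positions" and b: "b = a \<bullet> pt (l, q)"
      have "l = j \<or> l = j + 1" using j(3) max[OF lq] b lq by (auto simp: positions_def)
      then show "\<exists>c\<in>T. same (l, q) c" using T(2) lq max[OF lq] b by blast
    qed
  qed
qed

lemma drum_polytope: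
  shows "simplicial_polytope (convex hull (pt ` positions))"
    and "aff_dim (convex hull (pt ` positions)) = 3"
    and "boundary_complex (convex hull (pt ` positions)) = {\<sigma>. \<exists>T\<in>triangles. \<sigma> \<subseteq> pt ` T}"
proof -
  let ?\<T> = "(`) pt ` triangles"
  have fin: "finite (pt ` positions)" by (rule finite_image_positions) (simp add: pt_eq_iff)
  have ne: "?\<T> \<noteq> {}" using Union_triangles N3 by (auto simp: positions_def)
  have i: "\<not> affine_dependent T" if "T \<in> ?\<T>" for T using that pt_triangle_independent by blast
  have p: "T \<subset> pt ` positions" if "T \<in> ?\<T>" for T using that pt_triangle_proper by blast
  have e: "\<exists>a b. (\<forall>x\<in>pt ` positions. a \<bullet> x \<le> b) \<and> {x\<in>pt ` positions. a \<bullet> x = b} = T" if "T \<in> ?\<T>" for T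
    using that pt_triangle_exposed by blast
  have c: "\<exists>T\<in>?\<T>. {x\<in>pt ` positions. a \<bullet> x = b} \<subseteq> T" if "a \<noteq> 0" "\<forall>x\<in>pt ` positions. a \<bullet> x \<le> b" for a b
    using pt_argmax_subset_triangle[OF that] by blast
  show "simplicial_polytope (convex hull (pt ` positions))"
    by (rule simplicial_polytope_convex_hull(1)[where \<T> = ?\<T>]; fact fin ne i p e c)
  have "aff_dim (convex hull (pt ` positions)) = DIM(real^3)"
    by (rule simplicial_polytope_convex_hull(2)[where \<T> = ?\<T>]; fact fin ne i p e c)
  then show "aff_dim (convex hull (pt ` positions)) = 3" by simp
  have "boundary_complex (convex hull (pt ` positions)) = {\<sigma>. \<exists>T\<in>?\<T>. \<sigma> \<subseteq> T}"
    by (rule simplicial_polytope_convex_hull(3)[where \<T> = ?\<T>]; fact fin ne i p e c)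
  then show "boundary_complex (convex hull (pt ` positions)) = {\<sigma>. \<exists>T\<in>triangles. \<sigma> \<subseteq> pt ` T}"
    by simp
qed

lemma is_boundary_of_simplicial_3_polytope_triangles:
  assumes "\<And>a b. a \<in> positions \<Longrightarrow> b \<in> positions \<Longrightarrow> g a = g b \<longleftrightarrow> same a b"
  shows "is_boundary_of_simplicial_3_polytope {\<sigma>. \<exists>T\<in>triangles. \<sigma> \<subseteq> g ` T}"
proof -
  have "complex_isomorphic {\<sigma>. \<exists>T\<in>triangles. \<sigma> \<subseteq> g ` T} (boundary_complex (convex hull (pt ` positions)))"
    unfolding drum_polytope(3)
    by (rule complex_isomorphic_image[OF _ Union_triangles]) (simp add: assms pt_eq_iff)
  then show ?thesis unfolding is_boundary_of_simplicial_3_polytope_def using drum_polytope by blast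
qed

end

subsection \<open>The neighborhood complex and its subdivision\<close>

context levels begin

definition inner :: "(int \<times> int) set" where
  "inner = {(k, q). 1 \<le> k \<and> k \<le> N \<and> even (k + q)}"

definition incident :: "int \<Rightarrow> int \<Rightarrow> int \<Rightarrow> int \<Rightarrow> bool" where
  "incident k q l r \<longleftrightarrow>
     l = k \<and> (k = 1 \<or> k = N \<or> 2 * N dvd r - (q - 1) \<or> 2 * N dvd r - (q + 1)) \<or>
     (l = k + 1 \<or> l = k - 1) \<and> 2 * N dvd r - q"

definition diamond :: "int \<Rightarrow> int \<Rightarrow> (int \<times> int) set" where
  "diamond k q = {(k, q - 1), (k, q + 1), (k - 1, q), (k + 1, q)}"

text \<open>\<open>k\<close> is an end level, \<open>k + t\<close> the next level and \<open>k - t\<close> the pole.\<close>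

definition is_end :: "int \<Rightarrow> int \<Rightarrow> bool" where
  "is_end k t \<longleftrightarrow> k = 1 \<and> t = 1 \<or> k = N \<and> t = -1"

text \<open>The period \<open>2 * N\<close> is at least 6, so it separates angles that are fewer
  than 6 steps apart.\<close>

lemma dvd_close: "2 * N dvd a \<Longrightarrow> 2 * N dvd b \<Longrightarrow> \<bar>a - b\<bar> < 6 \<Longrightarrow> a = b"
  using N3 dvd_imp_le_int[of "a - b" "2 * N"] by (cases "a = b") auto

lemma dvd_shift: "2 * N dvd a \<Longrightarrow> 2 * N dvd b \<longleftrightarrow> 2 * N dvd b - a"
  by (metis diff_add_cancel dvd_add_right_iff add.commute)

lemma diamond_subset_positions:
  "1 \<le> k \<Longrightarrow> k \<le> N \<Longrightarrow> odd (k + q) \<Longrightarrow> diamond k q \<subseteq> positions"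
  by (auto simp: diamond_def positions_def)

end

text \<open>From the graph only this description in coordinates is used, until the stable Kneser
  graph is shown to have it. In \<open>adj_iff\<close> the antipode turns a vertex into the centre
  of its neighbourhood.\<close>

locale drum_graph = levels N for N :: int +
  fixes V :: "'a set" and adj :: "'a \<Rightarrow> 'a \<Rightarrow> bool" and v :: "int \<times> int \<Rightarrow> 'a"
  assumes finite_V: "finite V" and V_eq: "V = v ` inner"
    and v_eq: "a \<in> inner \<Longrightarrow> b \<in> inner \<Longrightarrow> v a = v b \<longleftrightarrow> same a b"
    and adj_iff: "(k, q) \<in> inner \<Longrightarrow> (l, r) \<in> inner \<Longrightarrow>
      adj (v (k, q)) (v (l, r)) \<longleftrightarrow> incident (N + 1 - k) (q + N) l r"
begin

definition ring :: "int \<Rightarrow> 'a set" where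
  "ring k = v ` {(k, q) | q. even (k + q)}"

text \<open>The poles are the subdivision points of the simplices spanned by the first and the last ring.\<close>

definition lab :: "int \<times> int \<Rightarrow> 'a set" where
  "lab a = (if fst a = 0 then ring 1 else if fst a = N + 1 then ring N else {v a})"

text \<open>For odd \<open>k + q\<close> these are the neighbourhoods of the vertices, so they
  generate the neighborhood complex.\<close>

definition fac :: "int \<Rightarrow> int \<Rightarrow> 'a set" where
  "fac k q = v ` {(l, r) | l r. (l, r) \<in> inner \<and> incident k q l r}"

lemma v_eq_iff: "(k, q) \<in> inner \<Longrightarrow> (l, r) \<in> inner \<Longrightarrow> v (k, q) = v (l, r) \<longleftrightarrow> k = l \<and> 2 * N dvd q - r"
  using v_eq[of "(k, q)" "(l, r)"] by (auto simp: same_def inner_def)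

lemma v_in_ring: "(l, r) \<in> inner \<Longrightarrow> 1 \<le> k \<Longrightarrow> k \<le> N \<Longrightarrow> v (l, r) \<in> ring k \<longleftrightarrow> l = k"
proof -
  assume *: "(l, r) \<in> inner" "1 \<le> k" "k \<le> N"
  have "l = k" if "v (l, r) = v (k, q)" "even (k + q)" for q
    using v_eq_iff[of l r k q] * that by (simp add: inner_def)
  then show ?thesis using * by (auto simp: ring_def inner_def)
qed

lemma incident_cong: "2 * N dvd r - r' \<Longrightarrow> incident k q l r \<longleftrightarrow> incident k q l r'"
proof -
  assume d: "2 * N dvd r - r'"
  have "2 * N dvd r - x \<longleftrightarrow> 2 * N dvd r' - x" for x
    using dvd_shift[OF d, of "r - x"] by simp
  then show ?thesis unfolding incident_def by simp
qed

lemma v_in_fac: "(l, r) \<in> inner \<Longrightarrow> v (l, r) \<in> fac k q \<longleftrightarrow> incident k q l r"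
proof
  assume *: "(l, r) \<in> inner" "v (l, r) \<in> fac k q"
  then obtain l' r' where "(l', r') \<in> inner" "incident k q l' r'" "v (l, r) = v (l', r')"
    by (auto simp: fac_def)
  then show "incident k q l r" using v_eq_iff[of l r l' r'] * incident_cong by metis
qed (auto simp: fac_def)

lemma fac_subset: "fac k q \<subseteq> V"
  by (auto simp: fac_def V_eq)

text \<open>A face centred on another level meets the ring only in vertices of angle
  \<open>q\<close>, hence not in both \<open>(k, k)\<close> and \<open>(k, k + 2)\<close>. In
  particular no face contains both rings, so the two subdivisions do not interfere.\<close>

lemma ring_subset_fac_iff:
  assumes "k = 1 \<or> k = N"
  shows "ring k \<subseteq> fac l q \<longleftrightarrow> k = l"
proof
  assume sub: "ring k \<subseteq> fac l q"
  have inn: "(k, k) \<in> inner" "(k, k + 2) \<in> inner" using assms N3 by (auto simp: inner_def)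
  then have "v (k, k) \<in> ring k" "v (k, k + 2) \<in> ring k" by (auto simp: ring_def)
  then have "incident l q k k" "incident l q k (k + 2)" using sub v_in_fac inn by blast+
  then show "k = l" using dvd_close[of "k - q" "k + 2 - q"] unfolding incident_def by auto
next
  assume "k = l"
  then show "ring k \<subseteq> fac l q"
    using assms N3 by (auto simp: ring_def inner_def incident_def fac_def)
qed

lemma ring_not_singleton: "k = 1 \<or> k = N \<Longrightarrow> \<nexists>x. ring k = {x}"
proof
  assume k: "k = 1 \<or> k = N"
  assume "\<exists>x. ring k = {x}"
  moreover have "v (k, k) \<in> ring k" "v (k, k + 2) \<in> ring k" by (auto simp: ring_def)
  ultimately have "v (k, k) = v (k, k + 2)" by auto
  then have "2 * N dvd k - (k + 2)" using v_eq_iff[of k k k "k + 2"] k N3 by (auto simp: inner_def)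
  then show False using dvd_close[of "k - (k + 2)" 0] by simp
qed

lemma ring_nonempty: "ring k \<noteq> {}"
  unfolding ring_def by (auto intro: exI[of _ k])

lemma lab_pole: "lab (0, q) = ring 1" "lab (N + 1, q) = ring N"
  using N3 by (simp_all add: lab_def)

lemma lab_inner: "1 \<le> k \<Longrightarrow> k \<le> N \<Longrightarrow> lab (k, q) = {v (k, q)}"
  by (simp add: lab_def)

lemma lab_eq_iff:
  assumes "a \<in> positions" "b \<in> positions"
  shows "lab a = lab b \<longleftrightarrow> same a b"
proof -
  have r: "ring 1 \<noteq> ring N" using ring_subset_fac_iff[of 1 1 0] ring_subset_fac_iff[of N 1 0] N3 by auto
  have s: "ring 1 \<noteq> {x}" "ring N \<noteq> {x}" for x using ring_not_singleton by auto
  have i: "a \<in> inner" if "fst a \<noteq> 0" "fst a \<noteq> N + 1" "a \<in> positions" for a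
    using that by (auto simp: inner_def positions_def)
  show ?thesis
    using r s i v_eq[of a b] assms N3 unfolding lab_def same_def
    by (smt (verit) singleton_insert_inj_eq)
qed

lemma lab_in_diamond:
  assumes "1 \<le> k" "k \<le> N" "odd (k + q)" "(l, r) \<in> positions"
  shows "lab (l, r) \<in> lab ` diamond k q \<longleftrightarrow> l = k \<and> (2 * N dvd r - (q - 1) \<or> 2 * N dvd r - (q + 1)) \<or>
    (l = k - 1 \<or> l = k + 1) \<and> (l = 0 \<or> l = N + 1 \<or> 2 * N dvd r - q)"
proof -
  have "lab (l, r) \<in> lab ` diamond k q \<longleftrightarrow> (\<exists>c\<in>diamond k q. same (l, r) c)"
    using lab_eq_iff[OF assms(4)] diamond_subset_positions[OF assms(1-3)] by blast
  also have "\<dots> \<longleftrightarrow> same (l, r) (k, q - 1) \<or> same (l, r) (k, q + 1) \<or> same (l, r) (k - 1, q) \<or> same (l, r) (k + 1, q)"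
    by (simp add: diamond_def)
  also have "\<dots> \<longleftrightarrow> l = k \<and> (2 * N dvd r - (q - 1) \<or> 2 * N dvd r - (q + 1)) \<or>
    (l = k - 1 \<or> l = k + 1) \<and> (l = 0 \<or> l = N + 1 \<or> 2 * N dvd r - q)"
    using assms(1,2) by (auto simp: same_def)
  finally show ?thesis .
qed

text \<open>Vertex set of the subdivided simplex with centre \<open>(k, q)\<close> on an end level:
  the pole, the one vertex of the next level, and the rim. A subset is a face as long as it omits
  some rim vertex, see \<open>subdivided_iff\<close>.\<close>

definition cone :: "int \<Rightarrow> int \<Rightarrow> int \<Rightarrow> 'a set set" where
  "cone k t q = insert (lab (k - t, q)) (insert (lab (k + t, q)) (embed_face (ring k)))"

lemma rim_eq: "k = 1 \<or> k = N \<Longrightarrow> embed_face (ring k) = lab ` {(k, q) | q. even (k + q)}"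
  using N3 by (auto simp: embed_face_def ring_def lab_def image_iff)

lemma lab_in_rim:
  assumes "k = 1 \<or> k = N" "(l, r) \<in> positions"
  shows "lab (l, r) \<in> embed_face (ring k) \<longleftrightarrow> l = k"
proof -
  have "(k, q) \<in> positions" if "even (k + q)" for q using assms N3 that by (auto simp: positions_def)
  then have "lab (l, r) \<in> embed_face (ring k) \<longleftrightarrow> (\<exists>q. even (k + q) \<and> same (l, r) (k, q))"
    unfolding rim_eq[OF assms(1)] using lab_eq_iff[OF assms(2)] by blast
  also have "\<dots> \<longleftrightarrow> l = k"
  proof
    assume "l = k"
    then have "even (k + r) \<and> same (l, r) (k, r)" using assms(2) by (simp add: same_def positions_def)
    then show "\<exists>q. even (k + q) \<and> same (l, r) (k, q)" by blast
  qed (auto simp: same_def)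
  finally show ?thesis .
qed

lemma lab_in_cone:
  assumes "is_end k t" "odd (k + q)" "(l, r) \<in> positions"
  shows "lab (l, r) \<in> cone k t q \<longleftrightarrow> l = k \<or> l = k - t \<or> l = k + t \<and> 2 * N dvd r - q"
proof -
  have k: "k = 1 \<or> k = N" using assms by (auto simp: is_end_def)
  have p: "(k - t, q) \<in> positions" "(k + t, q) \<in> positions"
    using assms N3 by (auto simp: is_end_def positions_def)
  have "lab (l, r) \<in> cone k t q \<longleftrightarrow> same (l, r) (k - t, q) \<or> same (l, r) (k + t, q) \<or> l = k"
    unfolding cone_def using lab_eq_iff assms(3) p lab_in_rim[OF k assms(3)] by auto
  moreover have "same (l, r) (k - t, q) \<longleftrightarrow> l = k - t"
    "same (l, r) (k + t, q) \<longleftrightarrow> l = k + t \<and> 2 * N dvd r - q"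
    using assms(1) N3 by (auto simp: same_def is_end_def)
  ultimately show ?thesis by blast
qed

lemma cone_subset: "is_end k t \<Longrightarrow> odd (k + q) \<Longrightarrow> cone k t q \<subseteq> lab ` positions"
  unfolding cone_def using N3 rim_eq[of k] by (auto simp: is_end_def positions_def)

lemma fac_interior: "2 \<le> k \<Longrightarrow> k \<le> N - 1 \<Longrightarrow> odd (k + q) \<Longrightarrow> embed_face (fac k q) = lab ` diamond k q"
proof -
  assume k: "2 \<le> k" "k \<le> N - 1" "odd (k + q)"
  have d: "diamond k q \<subseteq> inner" using k by (auto simp: diamond_def inner_def)
  have "v (l, r) \<in> v ` diamond k q" if lr: "(l, r) \<in> inner" "incident k q l r" for l r
  proof -
    have "\<exists>c\<in>diamond k q. same (l, r) c"
      using lr(2) k unfolding incident_def diamond_def same_def by auto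
    then show ?thesis using v_eq[OF lr(1)] d by blast
  qed
  moreover have "incident k q l r" if "(l, r) \<in> diamond k q" for l r
    using that by (auto simp: incident_def diamond_def)
  moreover have "a \<in> {(l, r) | l r. (l, r) \<in> inner \<and> incident k q l r}" if "a \<in> diamond k q" for a
    using that d calculation(2)[of "fst a" "snd a"] by auto
  ultimately have "fac k q = v ` diamond k q" unfolding fac_def by fast
  moreover have "lab a = {v a}" if "a \<in> diamond k q" for a
    using that d lab_inner by (auto simp: inner_def)
  ultimately show ?thesis by (auto simp: embed_face_def image_image)
qed

lemma fac_end: "is_end k t \<Longrightarrow> odd (k + q) \<Longrightarrow> fac k q = insert (v (k + t, q)) (ring k)"
proof -
  assume kt: "is_end k t" "odd (k + q)"
  have w: "(k + t, q) \<in> inner" "incident k q (k + t) q"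
    using kt N3 by (auto simp: is_end_def inner_def incident_def)
  have "v (l, r) \<in> insert (v (k + t, q)) (ring k)" if lr: "(l, r) \<in> inner" "incident k q l r" for l r
  proof (cases "l = k")
    case True
    then show ?thesis using lr v_in_ring by (auto simp: inner_def)
  next
    case False
    then have "l = k + t \<and> 2 * N dvd r - q"
      using lr kt by (auto simp: incident_def is_end_def inner_def)
    then show ?thesis using v_eq_iff lr(1) w by blast
  qed
  moreover have "ring k \<subseteq> fac k q" using ring_subset_fac_iff kt by (auto simp: is_end_def)
  ultimately show ?thesis using w v_in_fac unfolding fac_def by fast
qed

lemma neighborhood_complex_eq:
  "neighborhood_complex V adj = {\<tau>. \<exists>k q. 1 \<le> k \<and> k \<le> N \<and> odd (k + q) \<and> \<tau> \<subseteq> fac k q}"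
proof -
  have nb: "{y\<in>V. adj (v (k, q)) y} = fac (N + 1 - k) (q + N)" if "(k, q) \<in> inner" for k q
    using adj_iff[OF that] unfolding V_eq fac_def by auto
  have F: "F \<subseteq> V \<and> (\<forall>y\<in>F. adj (v (k, q)) y) \<longleftrightarrow> F \<subseteq> fac (N + 1 - k) (q + N)" if "(k, q) \<in> inner" for F k q
    using nb[OF that] by blast
  \<comment> \<open>Applying the antipode twice shifts the angle by a full turn.\<close>
  have f: "fac k (q + 2 * N) = fac k q" for k q
  proof -
    have "2 * N dvd r - (q + 2 * N - c) \<longleftrightarrow> 2 * N dvd r - (q - c)" for r c
      using dvd_shift[of "- (2 * N)" "r - (q + 2 * N - c)"] by (simp add: algebra_simps)
    from this[of _ 1] this[of _ "-1"] this[of _ 0]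
    show ?thesis unfolding fac_def incident_def by simp
  qed
  show ?thesis
  proof (intro subset_antisym subsetI)
    fix \<tau> assume "\<tau> \<in> neighborhood_complex V adj"
    then obtain k q where kq: "(k, q) \<in> inner" "\<tau> \<subseteq> V \<and> (\<forall>y\<in>\<tau>. adj (v (k, q)) y)"
      unfolding neighborhood_complex_def V_eq by auto
    then have "\<tau> \<subseteq> fac (N + 1 - k) (q + N)" using F by blast
    moreover have "1 \<le> N + 1 - k" "N + 1 - k \<le> N" "odd (N + 1 - k + (q + N))"
      using kq(1) by (auto simp: inner_def)
    ultimately show "\<tau> \<in> {\<tau>. \<exists>k q. 1 \<le> k \<and> k \<le> N \<and> odd (k + q) \<and> \<tau> \<subseteq> fac k q}" by blast
  next
    fix \<tau> assume "\<tau> \<in> {\<tau>. \<exists>k q. 1 \<le> k \<and> k \<le> N \<and> odd (k + q) \<and> \<tau> \<subseteq> fac k q}"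
    then obtain k q where kq: "1 \<le> k" "k \<le> N" "odd (k + q)" "\<tau> \<subseteq> fac k q" by blast
    let ?a = "(N + 1 - k, q + N)"
    have a: "?a \<in> inner" using kq by (auto simp: inner_def)
    have "\<tau> \<subseteq> fac (N + 1 - (N + 1 - k)) (q + N + N)" using kq(4) f[of k q] by (simp add: algebra_simps)
    then have "\<tau> \<subseteq> V \<and> (\<forall>y\<in>\<tau>. adj (v ?a) y)" using F[OF a] by blast
    then show "\<tau> \<in> neighborhood_complex V adj"
      unfolding neighborhood_complex_def using a V_eq by blast
  qed
qed

section \<open>The faces of the subdivided complex\<close>

definition subdivided :: "'a set set set" where
  "subdivided = two_face_subdivision (neighborhood_complex V adj) (ring 1) (ring N)"

lemma partial_subdivision_subdivided: "partial_subdivision (neighborhood_complex V adj) subdivided"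
  unfolding subdivided_def
proof (rule partial_subdivision_two_faces)
  show "down_closed (neighborhood_complex V adj)"
    by (auto simp: down_closed_def neighborhood_complex_def)
  have c1: "odd (1 + 0 :: int)" and cN: "odd (N + (N + 1))" by auto
  show "ring 1 \<in> neighborhood_complex V adj"
    unfolding neighborhood_complex_eq using ring_subset_fac_iff[of 1 1 0] N3 c1 by force
  have "ring N \<subseteq> fac N (N + 1)" using ring_subset_fac_iff by simp
  then show "ring N \<in> neighborhood_complex V adj"
    unfolding neighborhood_complex_eq using N3 cN by (intro CollectI exI[of _ N] exI[of _ "N + 1"]) auto
  show "ring 1 \<union> ring N \<notin> neighborhood_complex V adj"
    unfolding neighborhood_complex_eq using ring_subset_fac_iff N3 by auto
  show "\<not> ring 1 \<subseteq> ring N"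
    using v_in_ring[of 1 1 N] v_in_ring[of 1 1 1] N3 by (auto simp: inner_def)
qed (use ring_nonempty ring_not_singleton in auto)

lemma subdivided_cases:
  assumes "\<rho> \<in> subdivided"
  obtains (a) \<tau> k q where "\<rho> = embed_face \<tau>" "1 \<le> k" "k \<le> N" "odd (k + q)" "\<tau> \<subseteq> fac k q"
      "\<not> ring 1 \<subseteq> \<tau>" "\<not> ring N \<subseteq> \<tau>"
    | (b) l \<tau> k q where "l = 1 \<or> l = N" "\<rho> = insert (ring l) (embed_face \<tau>)" "\<not> ring l \<subseteq> \<tau>"
      "1 \<le> k" "k \<le> N" "odd (k + q)" "\<tau> \<union> ring l \<subseteq> fac k q"
proof -
  let ?K = "neighborhood_complex V adj"
  have K: "\<exists>k q. 1 \<le> k \<and> k \<le> N \<and> odd (k + q) \<and> \<tau> \<subseteq> fac k q" if "\<tau> \<in> ?K" for \<tau>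
    using that unfolding neighborhood_complex_eq by (rule CollectD)
  consider (1) \<tau> where "\<rho> = embed_face \<tau>" "\<tau> \<in> ?K" "\<not> ring 1 \<subseteq> \<tau>" "\<not> ring N \<subseteq> \<tau>"
    | (2) l \<tau> where "l = 1 \<or> l = N" "\<rho> = insert (ring l) (embed_face \<tau>)" "\<not> ring l \<subseteq> \<tau>" "\<tau> \<union> ring l \<in> ?K"
    using assms unfolding subdivided_def two_face_subdivision_def by blast
  then show ?thesis
  proof cases
    case 1
    then show ?thesis using K[OF 1(2)] a by metis
  next
    case 2
    then show ?thesis using K[OF 2(4)] b by metis
  qed
qed

text \<open>Away from the end levels nothing is subdivided, and each square appears with both
  diagonals, that is, as a tetrahedron. On an end level the full ring is replaced by the cone from
  the pole over its proper subsets. The collapse works from this list.\<close>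

lemma subdivided_iff:
  "\<rho> \<in> subdivided \<longleftrightarrow>
     (\<exists>k q. 2 \<le> k \<and> k \<le> N - 1 \<and> odd (k + q) \<and> \<rho> \<subseteq> lab ` diamond k q) \<or>
     (\<exists>k t q. is_end k t \<and> odd (k + q) \<and> \<rho> \<subseteq> cone k t q \<and> \<not> embed_face (ring k) \<subseteq> \<rho>)"
  (is "_ \<longleftrightarrow> ?I \<or> ?E")
proof
  have emb: "embed_face (insert x A) = insert {x} (embed_face A)" for x :: 'a and A by (simp add: embed_face_def)
  have cone_eq: "cone k t q = insert (ring k) (embed_face (fac k q))" if "is_end k t" "odd (k + q)" for k t q
    using that lab_pole lab_inner[of "k + t"] N3 unfolding cone_def fac_end[OF that] emb
    by (auto simp: is_end_def)
  have end_or_int: "(2 \<le> k \<and> k \<le> N - 1) \<or> (\<exists>t. is_end k t)" if "1 \<le> k" "k \<le> N" for k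
    using that by (auto simp: is_end_def)
  have pole_notin: "ring k \<notin> embed_face A" if "k = 1 \<or> k = N" for k A
    using not_in_embed_face[OF ring_nonempty ring_not_singleton[OF that]] .
  have end_k: "k = 1 \<or> k = N" "1 \<le> k" "k \<le> N" if "is_end k t" for k t using that N3 by (auto simp: is_end_def)
  {
    assume "\<rho> \<in> subdivided"
    then show "?I \<or> ?E"
    proof (cases rule: subdivided_cases)
      case (a \<tau> k q)
      show ?thesis
      proof (cases "2 \<le> k \<and> k \<le> N - 1")
        case True
        then have "\<rho> \<subseteq> lab ` diamond k q" using a fac_interior[of k q] embed_face_subset_iff by metis
        then show ?thesis using True a(4) by blast
      next
        case False
        then obtain t where t: "is_end k t" using end_or_int a by blast
        have "\<rho> \<subseteq> cone k t q" using cone_eq[OF t a(4)] a(1,5) embed_face_subset_iff by blast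
        moreover have "\<not> embed_face (ring k) \<subseteq> \<rho>" using end_k[OF t] a by auto
        ultimately show ?thesis using t a(4) by blast
      qed
    next
      case (b l \<tau> k q)
      have kl: "k = l" using b(7) ring_subset_fac_iff[OF b(1), of k q] by simp
      then obtain t where t: "is_end k t" using b(1) by (auto simp: is_end_def)
      have "embed_face \<tau> \<subseteq> embed_face (fac k q)" using b(7) by simp
      then have "\<rho> \<subseteq> cone k t q" using cone_eq[OF t b(6)] b(2) kl by blast
      moreover have "\<not> embed_face (ring k) \<subseteq> \<rho>"
        using b(2,3) kl pole_notin[OF b(1)] subset_insert[of "ring l" "embed_face (ring l)"] by simp
      ultimately show ?thesis using t b(6) by blast
    qed
  }
  assume "?I \<or> ?E"
  then show "\<rho> \<in> subdivided"
  proof (elim disjE exE conjE)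
    fix k q assume k: "2 \<le> k" "k \<le> N - 1" "odd (k + q)" "\<rho> \<subseteq> lab ` diamond k q"
    then obtain \<tau> where \<tau>: "\<tau> \<subseteq> fac k q" "\<rho> = embed_face \<tau>" using subset_embed_face fac_interior by metis
    moreover have "\<not> ring 1 \<subseteq> fac k q" "\<not> ring N \<subseteq> fac k q" using ring_subset_fac_iff k by auto
    then have "\<not> ring 1 \<subseteq> \<tau>" "\<not> ring N \<subseteq> \<tau>" using \<tau> by auto
    moreover have "\<tau> \<in> neighborhood_complex V adj"
      unfolding neighborhood_complex_eq using k \<tau> by (intro CollectI exI[of _ k] exI[of _ q]) auto
    ultimately show ?thesis unfolding subdivided_def by (metis two_face_subdivision_intros(1))
  next
    fix k t q assume *: "is_end k t" "odd (k + q)" "\<rho> \<subseteq> cone k t q" "\<not> embed_face (ring k) \<subseteq> \<rho>"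
    then have "\<rho> - {ring k} \<subseteq> embed_face (fac k q)" using cone_eq[OF *(1,2)] by blast
    then obtain \<tau> where \<tau>: "\<tau> \<subseteq> fac k q" "\<rho> - {ring k} = embed_face \<tau>" using subset_embed_face by metis
    have n: "\<not> ring k \<subseteq> \<tau>" using \<tau>(2) *(4) by (metis Diff_subset embed_face_subset_iff order_trans)
    have "\<tau> \<union> ring k \<subseteq> fac k q"
      using ring_subset_fac_iff[OF end_k(1)[OF *(1)], of k q] \<tau>(1) by simp
    then have Un: "\<tau> \<union> ring k \<in> neighborhood_complex V adj"
      unfolding neighborhood_complex_eq using *(2) end_k(2,3)[OF *(1)] by blast
    show ?thesis
    proof (cases "ring k \<in> \<rho>")
      case True
      then have "\<rho> = insert (ring k) (embed_face \<tau>)" using \<tau>(2) by blast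
      then show ?thesis using two_face_subdivision_intros(2) n Un end_k(1)[OF *(1)]
        unfolding subdivided_def by metis
    next
      case False
      then have "\<rho> = embed_face \<tau>" using \<tau>(2) by blast
      moreover have "\<not> ring 1 \<subseteq> \<tau> \<and> \<not> ring N \<subseteq> \<tau>"
        using n \<tau>(1) ring_subset_fac_iff[of 1 k q] ring_subset_fac_iff[of N k q] by auto
      moreover have "\<tau> \<in> neighborhood_complex V adj" using Un by (auto simp: neighborhood_complex_def)
      ultimately show ?thesis unfolding subdivided_def by (metis two_face_subdivision_intros(1))
    qed
  qed
qed

lemma subdivided_subset: "\<rho> \<in> subdivided \<Longrightarrow> \<rho> \<subseteq> lab ` positions"
proof -
  assume "\<rho> \<in> subdivided"
  moreover have "lab ` diamond k q \<subseteq> lab ` positions" if "2 \<le> k" "k \<le> N - 1" "odd (k + q)" for k q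
    using diamond_subset_positions[of k q] that by auto
  ultimately show ?thesis unfolding subdivided_iff using cone_subset by blast
qed

lemma finite_subdivided: "finite subdivided"
proof (rule finite_subset)
  show "subdivided \<subseteq> Pow (lab ` positions)" using subdivided_subset by blast
  show "finite (Pow (lab ` positions))" using finite_image_positions[of lab] lab_eq_iff by simp
qed

lemma down_closed_subdivided: "down_closed subdivided"
  unfolding down_closed_def
proof (intro ballI subsetI)
  fix \<rho> \<sigma> assume "\<rho> \<in> subdivided" "\<sigma> \<in> Pow \<rho>"
  then show "\<sigma> \<in> subdivided" unfolding subdivided_iff Pow_iff by (meson order_trans)
qed

end

subsection \<open>The collapse\<close>

context drum_graph begin

text \<open>First of the three families of edges to be deleted. The cross edges have to go first:
  afterwards the star of a vertical edge, at an end level too, is contained in a single square, and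
  the star of a rim chord in the cone from the pole over the rim.\<close>

definition cross_edges :: "'a set set set" where
  "cross_edges = {{lab (k + t, q), lab (k, r)} | k t q r. is_end k t \<and> odd (k + q) \<and> even (k + r) \<and>
     \<not> 2 * N dvd r - (q - 1) \<and> \<not> 2 * N dvd r - (q + 1)}"

definition vertical_edges :: "'a set set set" where
  "vertical_edges = {{lab (k - 1, q), lab (k + 1, q)} | k q. 1 \<le> k \<and> k \<le> N \<and> odd (k + q)}"

definition rim_chords :: "'a set set set" where
  "rim_chords = {{lab (k, q), lab (k, r)} | k q r. (k = 1 \<or> k = N) \<and> even (k + q) \<and> even (k + r) \<and>
     \<not> 2 * N dvd r - q \<and> \<not> 2 * N dvd r - (q - 2) \<and> \<not> 2 * N dvd r - (q + 2)}"

definition sphere :: "'a set set set" where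
  "sphere = {\<sigma>. \<exists>T\<in>triangles. \<sigma> \<subseteq> lab ` T}"

lemma cross_edgeI: "is_end k t \<Longrightarrow> odd (k + q) \<Longrightarrow> even (k + r) \<Longrightarrow> \<not> 2 * N dvd r - (q - 1) \<Longrightarrow>
    \<not> 2 * N dvd r - (q + 1) \<Longrightarrow> {lab (k + t, q), lab (k, r)} \<in> cross_edges"
  unfolding cross_edges_def by blast

lemma vertical_edgeI: "1 \<le> k \<Longrightarrow> k \<le> N \<Longrightarrow> odd (k + q) \<Longrightarrow> {lab (k - 1, q), lab (k + 1, q)} \<in> vertical_edges"
  unfolding vertical_edges_def by blast

lemma rim_chordI: "k = 1 \<or> k = N \<Longrightarrow> even (k + q) \<Longrightarrow> even (k + r) \<Longrightarrow> \<not> 2 * N dvd r - q \<Longrightarrow>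
    \<not> 2 * N dvd r - (q - 2) \<Longrightarrow> \<not> 2 * N dvd r - (q + 2) \<Longrightarrow> {lab (k, q), lab (k, r)} \<in> rim_chords"
  unfolding rim_chords_def by blast

lemma avoidingD:
  assumes "\<rho> \<in> avoiding K E" "{a, b} \<in> E" "a \<in> \<rho>" "b \<in> \<rho>"
  shows False
proof -
  have "{a, b} \<subseteq> \<rho>" using assms by simp
  then show False using assms(1,2) unfolding avoiding_def by blast
qed

lemma end_position:
  assumes "is_end k t"
  shows "1 \<le> k" "k \<le> N" "1 \<le> k + t" "k + t \<le> N" "k = 1 \<or> k = N" "k - t = 0 \<or> k - t = N + 1" "t = 1 \<or> t = -1"
    "k + t \<noteq> 1" "k + t \<noteq> N"
  using assms N3 by (auto simp: is_end_def)

lemma end_unique: "is_end k t \<Longrightarrow> is_end l s \<Longrightarrow> l = k \<or> l = k - t \<or> l = k + t \<Longrightarrow> l = k \<and> s = t"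
  using N3 by (auto simp: is_end_def)

lemma pos_iff: "(k, q) \<in> positions \<longleftrightarrow> 0 \<le> k \<and> k \<le> N + 1 \<and> even (k + q)"
  by (simp add: positions_def)

lemma end_in_positions:
  assumes "is_end k t"
  shows "odd (k + q) \<Longrightarrow> (k - t, q) \<in> positions" "odd (k + q) \<Longrightarrow> (k + t, q) \<in> positions"
    "even (k + q) \<Longrightarrow> (k, q) \<in> positions"
  using assms N3 by (auto simp: is_end_def pos_iff)

text \<open>Vertices of a square on adjacent levels are one angular step apart, which a cross edge
  excludes.\<close>

lemma cross_edge_not_in_diamond:
  assumes k: "1 \<le> k" "k \<le> N" "odd (k + q)" and e: "e \<in> cross_edges"
  shows "\<not> e \<subseteq> lab ` diamond k q"
proof
  assume sub: "e \<subseteq> lab ` diamond k q"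
  obtain l t p r where e: "e = {lab (l + t, p), lab (l, r)}" "is_end l t" "odd (l + p)" "even (l + r)"
     "\<not> 2 * N dvd r - (p - 1)" "\<not> 2 * N dvd r - (p + 1)"
    using e by (auto simp: cross_edges_def)
  note l = end_position[OF e(2)]
  have pos: "(l + t, p) \<in> positions" "(l, r) \<in> positions" using l e(3,4) by (auto simp: pos_iff)
  have 1: "l + t = k \<and> (2 * N dvd p - (q - 1) \<or> 2 * N dvd p - (q + 1)) \<or>
      (l + t = k - 1 \<or> l + t = k + 1) \<and> 2 * N dvd p - q"
    using sub l lab_in_diamond[OF k pos(1)] unfolding e(1) by auto
  have 2: "l = k \<and> (2 * N dvd r - (q - 1) \<or> 2 * N dvd r - (q + 1)) \<or> (l = k - 1 \<or> l = k + 1) \<and> 2 * N dvd r - q"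
    using sub l lab_in_diamond[OF k pos(2)] unfolding e(1) by auto
  have d: "2 * N dvd a - b" if "2 * N dvd a" "2 * N dvd b" for a b using that by (rule dvd_diff)
  consider "l = k" "2 * N dvd p - q" | "l + t = k" "2 * N dvd r - q" using 1 2 l(7) by auto
  then show False
  proof cases
    case 1
    then have "2 * N dvd r - (q - 1) \<or> 2 * N dvd r - (q + 1)" using 2 by auto
    then show False using d[of "r - (q - 1)" "p - q"] d[of "r - (q + 1)" "p - q"] 1 e(5,6)
      by (auto simp: algebra_simps)
  next
    case c2: 2
    then have "2 * N dvd p - (q - 1) \<or> 2 * N dvd p - (q + 1)" using 1 l(7) by auto
    then show False using d[of "r - q" "p - (q - 1)"] d[of "r - q" "p - (q + 1)"] c2 e(5,6)
      by (auto simp: algebra_simps)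
  qed
qed

lemma vertical_edge_in_diamond:
  assumes k: "1 \<le> k" "k \<le> N" "odd (k + q)" and l: "1 \<le> l" "l \<le> N" "odd (l + p)"
    and sub: "{lab (l - 1, p), lab (l + 1, p)} \<subseteq> lab ` diamond k q"
  shows "l = k \<and> 2 * N dvd p - q"
proof -
  have pos: "(l - 1, p) \<in> positions" "(l + 1, p) \<in> positions" using l by (auto simp: pos_iff)
  have 1: "l - 1 = k \<or> (l - 1 = k - 1 \<or> l - 1 = k + 1) \<and> (l - 1 = 0 \<or> l - 1 = N + 1 \<or> 2 * N dvd p - q)"
    using sub lab_in_diamond[OF k pos(1)] by auto
  have 2: "l + 1 = k \<or> (l + 1 = k - 1 \<or> l + 1 = k + 1) \<and> (l + 1 = 0 \<or> l + 1 = N + 1 \<or> 2 * N dvd p - q)"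
    using sub lab_in_diamond[OF k pos(2)] by auto
  show ?thesis using 1 2 l N3 by auto
qed

lemma lab_cong: "2 * N dvd p - q \<Longrightarrow> (k, p) \<in> positions \<Longrightarrow> (k, q) \<in> positions \<Longrightarrow> lab (k, p) = lab (k, q)"
  using lab_eq_iff by (simp add: same_def)

lemma dvd_imp_even: "2 * N dvd x \<Longrightarrow> even x"
  by (metis dvd_trans dvd_triv_left)

lemma lab_diamond_cong:
  assumes "1 \<le> k" "k \<le> N" "odd (k + p)" "odd (k + q)" "2 * N dvd p - q"
  shows "lab ` diamond k p = lab ` diamond k q"
proof -
  have "lab (k, p + c) = lab (k, q + c)" if "odd c" for c
    using assms that by (intro lab_cong) (auto simp: pos_iff)
  from this[of "-1"] this[of 1]
  have "lab (k, p - 1) = lab (k, q - 1)" "lab (k, p + 1) = lab (k, q + 1)" by simp_all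
  moreover have "lab (k - 1, p) = lab (k - 1, q)" "lab (k + 1, p) = lab (k + 1, q)"
    by (rule lab_cong[OF assms(5)]; use assms in \<open>simp add: pos_iff\<close>)+
  ultimately show ?thesis by (simp add: diamond_def)
qed

lemma diamond_subset_in_subdivided:
  assumes k: "1 \<le> k" "k \<le> N" "odd (k + q)" and sub: "\<sigma> \<subseteq> lab ` diamond k q"
  shows "\<sigma> \<in> subdivided"
proof (cases "2 \<le> k \<and> k \<le> N - 1")
  case True
  then show ?thesis unfolding subdivided_iff using k sub by blast
next
  case False
  then have "is_end k 1 \<or> is_end k (-1)" using k by (auto simp: is_end_def)
  then obtain t where t: "is_end k t" by blast
  note e = end_position[OF t]
  have "lab (l, r) \<in> cone k t q" if "(l, r) \<in> diamond k q" for l r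
  proof -
    have "(l, r) \<in> positions" using that diamond_subset_positions[OF k] by blast
    then show ?thesis using lab_in_cone[OF t k(3)] that e(7) by (auto simp: diamond_def)
  qed
  then have "\<sigma> \<subseteq> cone k t q" using sub by auto
  moreover have "\<not> embed_face (ring k) \<subseteq> \<sigma>"
  proof
    assume "embed_face (ring k) \<subseteq> \<sigma>"
    \<comment> \<open>Because \<open>N \<ge> 3\<close>, \<open>q + 3\<close> names a rim vertex
      other than the two in the square.\<close>
    moreover have pos: "(k, q + 3) \<in> positions" using k by (auto simp: pos_iff)
    ultimately have "lab (k, q + 3) \<in> lab ` diamond k q" using lab_in_rim[OF e(5) pos] sub by blast
    then have "2 * N dvd q + 3 - (q - 1) \<or> 2 * N dvd q + 3 - (q + 1)"
      using lab_in_diamond[OF k pos] by auto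
    then show False using dvd_close[of "q + 3 - (q - 1)" 0] dvd_close[of "q + 3 - (q + 1)" 0] by auto
  qed
  ultimately show ?thesis unfolding subdivided_iff using t k(3) by blast
qed

text \<open>What the subdivision gains: a subset of the cone is barred only by containing the whole
  rim, and the pole is not on the rim, so adding the pole preserves faces.\<close>

lemma insert_pole:
  assumes t: "is_end k t" and q: "odd (k + q)" and \<rho>: "\<rho> \<subseteq> cone k t q" "\<not> embed_face (ring k) \<subseteq> \<rho>"
    and p: "odd (k + p)"
  shows "insert (lab (k - t, p)) \<rho> \<in> subdivided"
proof -
  note e = end_position[OF t]
  have pos: "(k - t, p) \<in> positions" using e(6,7) p N3 by (auto simp: pos_iff)
  have "lab (k - t, p) \<in> cone k t q" using lab_in_cone[OF t q pos] by simp
  moreover have "lab (k - t, p) \<notin> embed_face (ring k)" using lab_in_rim[OF e(5) pos] e(7) by auto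
  ultimately show ?thesis unfolding subdivided_iff using t q \<rho> by blast
qed

lemma lab_neq: "(k, q) \<in> positions \<Longrightarrow> (l, r) \<in> positions \<Longrightarrow> k \<noteq> l \<Longrightarrow> lab (k, q) \<noteq> lab (l, r)"
  using lab_eq_iff by (simp add: same_def)

lemma pole_notin_cross_edge:
  assumes t: "is_end k t" and p: "odd (k + p)" and e: "e \<in> cross_edges"
  shows "lab (k - t, p) \<notin> e"
proof -
  obtain l s q r where e: "e = {lab (l + s, q), lab (l, r)}" "is_end l s" "odd (l + q)" "even (l + r)"
    using e by (auto simp: cross_edges_def)
  note k = end_position[OF t] and l = end_position[OF e(2)]
  note pos = end_in_positions(1)[OF t p] end_in_positions(2)[OF e(2,3)] end_in_positions(3)[OF e(2,4)]
  have "k - t \<noteq> l + s" "k - t \<noteq> l" using k(6) l(1-4) by linarith+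
  then show ?thesis using lab_neq[OF pos(1,2)] lab_neq[OF pos(1,3)] e(1) by simp
qed

text \<open>The apex is the pole. A face with a cross edge cannot lie in a square, so it lies in a
  cone over the same end, where \<open>insert_pole\<close> applies; the pole lies on no cross edge,
  so adding it completes none.\<close>

lemma collapse_cross_edges: "collapses subdivided (avoiding subdivided cross_edges)"
proof (rule collapses_avoiding[OF finite_subdivided down_closed_subdivided])
  fix e assume ex: "e \<in> cross_edges"
  then obtain k t q r where e: "e = {lab (k + t, q), lab (k, r)}" "is_end k t" "odd (k + q)" "even (k + r)"
    unfolding cross_edges_def by blast
  note k = end_position[OF e(2)]
  have pos: "(k + t, q) \<in> positions" "(k, r) \<in> positions" using k e by (auto simp: pos_iff)
  have "insert (lab (k - t, q)) \<rho> \<in> subdivided" if \<rho>: "\<rho> \<in> subdivided" "e \<subseteq> \<rho>" for \<rho>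
    using \<rho>(1) unfolding subdivided_iff[of \<rho>]
  proof (elim disjE exE conjE)
    fix k2 q2 assume "2 \<le> k2" "k2 \<le> N - 1" "odd (k2 + q2)" "\<rho> \<subseteq> lab ` diamond k2 q2"
    then show ?thesis using cross_edge_not_in_diamond[OF _ _ _ ex, of k2 q2] \<rho>(2) by auto
  next
    fix k2 t2 q2 assume *: "is_end k2 t2" "odd (k2 + q2)" "\<rho> \<subseteq> cone k2 t2 q2" "\<not> embed_face (ring k2) \<subseteq> \<rho>"
    have "lab (k, r) \<in> cone k2 t2 q2" using \<rho>(2) *(3) e(1) by blast
    then have "k = k2 \<and> t = t2"
      using lab_in_cone[OF *(1,2) pos(2)] end_unique[OF *(1) e(2)] by blast
    then show ?thesis using insert_pole[OF *] e(3) by blast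
  qed
  moreover have "e' \<subseteq> \<rho>" if "e' \<in> cross_edges" "e' \<subseteq> insert (lab (k - t, q)) \<rho>" for e' \<rho>
    using pole_notin_cross_edge[OF e(2,3) that(1)] that(2) by blast
  moreover have "lab (k - t, q) \<notin> e" by (rule pole_notin_cross_edge[OF e(2,3) ex])
  ultimately show "e \<noteq> {} \<and> (\<exists>a. a \<notin> e \<and> (\<forall>\<rho>\<in>subdivided. e \<subseteq> \<rho> \<longrightarrow>
      insert a \<rho> \<in> subdivided \<and> (\<forall>e'\<in>cross_edges. e' \<subseteq> insert a \<rho> \<longrightarrow> e' \<subseteq> \<rho>)))"
    using e(1) by (intro conjI exI[of _ "lab (k - t, q)"]) auto
qed

text \<open>At an end level the vertical edge contains a vertex of the next level; in the absence of
  cross edges, a face with this vertex has no rim vertices besides its two neighbours, the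
  horizontal corners of the square.\<close>

lemma vertical_edge_star:
  assumes \<rho>: "\<rho> \<in> avoiding subdivided cross_edges"
    and k: "1 \<le> k" "k \<le> N" "odd (k + q)" and sub: "{lab (k - 1, q), lab (k + 1, q)} \<subseteq> \<rho>"
  shows "\<rho> \<subseteq> lab ` diamond k q"
proof -
  have "\<rho> \<in> subdivided" using \<rho> by (simp add: avoiding_def)
  then show ?thesis unfolding subdivided_iff
  proof (elim disjE exE conjE)
    fix k2 q2 assume *: "2 \<le> k2" "k2 \<le> N - 1" "odd (k2 + q2)" "\<rho> \<subseteq> lab ` diamond k2 q2"
    have k2: "1 \<le> k2" "k2 \<le> N" using * by auto
    have "k = k2 \<and> 2 * N dvd q - q2"
      using vertical_edge_in_diamond[OF k2 *(3) k] sub *(4) by blast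
    then show ?thesis using lab_diamond_cong[OF k, of q2] *(3,4) by simp
  next
    fix k2 t q2 assume *: "is_end k2 t" "odd (k2 + q2)" "\<rho> \<subseteq> cone k2 t q2"
    note e = end_position[OF *(1)]
    have pos: "(k - 1, q) \<in> positions" "(k + 1, q) \<in> positions" using k by (auto simp: pos_iff)
    have 1: "k - 1 = k2 \<or> k - 1 = k2 - t \<or> k - 1 = k2 + t \<and> 2 * N dvd q - q2"
      using lab_in_cone[OF *(1,2) pos(1)] sub *(3) by blast
    have 2: "k + 1 = k2 \<or> k + 1 = k2 - t \<or> k + 1 = k2 + t \<and> 2 * N dvd q - q2"
      using lab_in_cone[OF *(1,2) pos(2)] sub *(3) by blast
    have k2: "k = k2" "2 * N dvd q - q2" using 1 2 e(7) k by auto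
    have posw: "(k + t, q2) \<in> positions" using e k2 *(2) by (auto simp: pos_iff)
    have w: "lab (k + t, q2) \<in> \<rho>"
    proof -
      have "lab (k + t, q) = lab (k + t, q2)" using pos posw e(7) k2 by (intro lab_cong) auto
      then show ?thesis using sub e(7) by auto
    qed
    have "\<rho> \<subseteq> lab ` diamond k q2"
    proof
      fix x assume x: "x \<in> \<rho>"
      then have "x \<in> lab ` positions" using cone_subset[OF *(1,2)] *(3) by blast
      then obtain l r where lr: "x = lab (l, r)" "(l, r) \<in> positions" by auto
      have c: "l = k \<or> l = k - t \<or> l = k + t \<and> 2 * N dvd r - q2"
        using lab_in_cone[OF *(1,2) lr(2)] x lr(1) *(3) k2(1) by blast
      have "2 * N dvd r - (q2 - 1) \<or> 2 * N dvd r - (q2 + 1)" if "l = k"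
      proof (rule ccontr)
        assume "\<not> ?thesis"
        then have "{lab (k + t, q2), lab (k, r)} \<in> cross_edges"
          using *(1,2) k2(1) lr(2) that by (intro cross_edgeI) (simp_all add: pos_iff)
        then show False using avoidingD[OF \<rho> _ w] x lr(1) that by blast
      qed
      then show "x \<in> lab ` diamond k q2"
      proof -
        have "odd (k + q2)" using *(2) k2(1) by simp
        note d = lab_in_diamond[OF k(1,2) this lr(2)]
        assume r: "l = k \<Longrightarrow> 2 * N dvd r - (q2 - 1) \<or> 2 * N dvd r - (q2 + 1)"
        have "k - t = 0 \<or> k - t = N + 1" using e(6) k2(1) by simp
        then show ?thesis unfolding lr(1) d using c r e(7) by (elim disjE) simp_all
      qed
    qed
    then show ?thesis using lab_diamond_cong[OF k, of q2] *(2) k2 by simp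
  qed
qed

text \<open>The apex is the horizontal corner \<open>(k, q + 1)\<close>. This choice breaks the
  symmetry of the square, but only the complex that remains has to be invariant. A square contains
  just one vertical edge, so no other is completed.\<close>

lemma collapse_vertical_edges:
  "collapses (avoiding subdivided cross_edges) (avoiding (avoiding subdivided cross_edges) vertical_edges)"
proof (rule collapses_avoiding)
  let ?K = "avoiding subdivided cross_edges"
  show "finite ?K" "down_closed ?K"
    using finite_avoiding[OF finite_subdivided] down_closed_avoiding[OF down_closed_subdivided] by auto
  fix e assume "e \<in> vertical_edges"
  then obtain k q where e: "e = {lab (k - 1, q), lab (k + 1, q)}" and k: "1 \<le> k" "k \<le> N" "odd (k + q)"
    by (auto simp: vertical_edges_def)
  have pos: "(k, q + 1) \<in> positions" "(k - 1, q) \<in> positions" "(k + 1, q) \<in> positions"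
    using k by (auto simp: pos_iff)
  have "insert (lab (k, q + 1)) \<rho> \<in> ?K \<and> (\<forall>e'\<in>vertical_edges. e' \<subseteq> insert (lab (k, q + 1)) \<rho> \<longrightarrow> e' \<subseteq> \<rho>)"
    if \<rho>: "\<rho> \<in> ?K" "e \<subseteq> \<rho>" for \<rho>
  proof -
    have "\<rho> \<subseteq> lab ` diamond k q" using vertical_edge_star[OF \<rho>(1) k] \<rho>(2) e by simp
    then have sub: "insert (lab (k, q + 1)) \<rho> \<subseteq> lab ` diamond k q" by (auto simp: diamond_def)
    have "e' \<subseteq> \<rho>" if e': "e' \<in> vertical_edges" "e' \<subseteq> insert (lab (k, q + 1)) \<rho>" for e'
    proof -
      obtain l p where l: "e' = {lab (l - 1, p), lab (l + 1, p)}" "1 \<le> l" "l \<le> N" "odd (l + p)"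
        using e'(1) by (auto simp: vertical_edges_def)
      have "l = k \<and> 2 * N dvd p - q"
        using order_trans[OF e'(2) sub] unfolding l(1) by (rule vertical_edge_in_diamond[OF k l(2-4)])
      then have "l = k" and pq: "2 * N dvd p - q" by simp_all
      moreover have "lab (k - 1, p) = lab (k - 1, q)" "lab (k + 1, p) = lab (k + 1, q)"
        by (rule lab_cong[OF pq]; use l k \<open>l = k\<close> in \<open>simp add: pos_iff\<close>)+
      ultimately have "e' = e" unfolding e l(1) by simp
      then show ?thesis using \<rho>(2) by simp
    qed
    moreover have "\<not> e' \<subseteq> insert (lab (k, q + 1)) \<rho>" if "e' \<in> cross_edges" for e'
      using cross_edge_not_in_diamond[OF k that] sub by blast
    ultimately show ?thesis
      using diamond_subset_in_subdivided[OF k sub] by (auto simp: avoiding_def)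
  qed
  moreover have "lab (k, q + 1) \<notin> e" using lab_neq pos e by auto
  ultimately show "e \<noteq> {} \<and> (\<exists>a. a \<notin> e \<and> (\<forall>\<rho>\<in>?K. e \<subseteq> \<rho> \<longrightarrow>
      insert a \<rho> \<in> ?K \<and> (\<forall>e'\<in>vertical_edges. e' \<subseteq> insert a \<rho> \<longrightarrow> e' \<subseteq> \<rho>)))"
    using e by (intro conjI exI[of _ "lab (k, q + 1)"]) auto
qed

text \<open>The ends of a chord are more than two steps apart, so a vertex of the next level would
  form a cross edge with one of them. A square centred off the end levels has at most one vertex on
  the rim.\<close>

lemma rim_chord_star:
  assumes \<rho>: "\<rho> \<in> avoiding subdivided cross_edges"
    and k: "k = 1 \<or> k = N" "even (k + q)" "even (k + r)"
    and d: "\<not> 2 * N dvd r - q" "\<not> 2 * N dvd r - (q - 2)" "\<not> 2 * N dvd r - (q + 2)"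
    and sub: "{lab (k, q), lab (k, r)} \<subseteq> \<rho>"
  obtains t p where "is_end k t" "odd (k + p)" "\<rho> \<subseteq> insert (lab (k - t, p)) (embed_face (ring k))"
    "\<not> embed_face (ring k) \<subseteq> \<rho>"
proof -
  have pos: "(k, q) \<in> positions" "(k, r) \<in> positions" using k N3 by (auto simp: pos_iff)
  have dd: "2 * N dvd a - b" if "2 * N dvd a" "2 * N dvd b" for a b using that by (rule dvd_diff)
  have "\<rho> \<in> subdivided" using \<rho> by (simp add: avoiding_def)
  then show ?thesis unfolding subdivided_iff
  proof (elim disjE exE conjE)
    fix l p assume *: "2 \<le> l" "l \<le> N - 1" "odd (l + p)" "\<rho> \<subseteq> lab ` diamond l p"
    have l: "1 \<le> l" "l \<le> N" using * by auto
    have "k \<noteq> l" "k \<noteq> 0" "k \<noteq> N + 1" using *(1,2) k(1) N3 by auto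
    moreover have "lab (k, q) \<in> lab ` diamond l p" "lab (k, r) \<in> lab ` diamond l p" using sub *(4) by blast+
    ultimately have "2 * N dvd q - p" "2 * N dvd r - p"
      using lab_in_diamond[OF l *(3) pos(1)] lab_in_diamond[OF l *(3) pos(2)] by simp_all
    then show ?thesis using dd[of "r - p" "q - p"] d(1) by simp
  next
    fix l t p assume *: "is_end l t" "odd (l + p)" "\<rho> \<subseteq> cone l t p" "\<not> embed_face (ring l) \<subseteq> \<rho>"
    have "\<exists>s. is_end k s" using k(1) by (auto simp: is_end_def)
    then obtain s where "is_end k s" by blast
    moreover have "k = l \<or> k = l - t \<or> k = l + t"
      using lab_in_cone[OF *(1,2) pos(1)] sub *(3) by blast
    ultimately have kl: "k = l" "is_end k t" using end_unique[OF *(1)] by auto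
    have "lab (k + t, p) \<notin> \<rho>"
    proof
      assume w: "lab (k + t, p) \<in> \<rho>"
      have near: "2 * N dvd x - (p - 1) \<or> 2 * N dvd x - (p + 1)" if "lab (k, x) \<in> \<rho>" "even (k + x)" for x
        using cross_edgeI[OF kl(2) _ that(2), of p] avoidingD[OF \<rho> _ w that(1)] *(2) kl(1) by blast
      have "lab (k, q) \<in> \<rho>" "lab (k, r) \<in> \<rho>" using sub by auto
      from near[OF this(1) k(2)] near[OF this(2) k(3)] show False
        using dd[of "r - (p - 1)" "q - (p - 1)"] dd[of "r - (p - 1)" "q - (p + 1)"]
          dd[of "r - (p + 1)" "q - (p - 1)"] dd[of "r - (p + 1)" "q - (p + 1)"] d
        by (auto simp: algebra_simps)
    qed
    then have "\<rho> \<subseteq> insert (lab (k - t, p)) (embed_face (ring k))"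
      using *(3) kl(1) unfolding cone_def by blast
    then show ?thesis using that kl *(2,4) by blast
  qed
qed

text \<open>The apex is again the pole, which lies on no rim chord. It completes no vertical edge
  either: those join levels two apart, whereas the face stays on the rim and the pole.\<close>

lemma collapse_rim_chords:
  "collapses (avoiding (avoiding subdivided cross_edges) vertical_edges)
     (avoiding (avoiding (avoiding subdivided cross_edges) vertical_edges) rim_chords)"
proof (rule collapses_avoiding)
  let ?K = "avoiding subdivided cross_edges"
  let ?M = "avoiding ?K vertical_edges"
  show "finite ?M" "down_closed ?M"
    using finite_avoiding[OF finite_avoiding[OF finite_subdivided]]
      down_closed_avoiding[OF down_closed_avoiding[OF down_closed_subdivided]] by auto
  fix e assume "e \<in> rim_chords"
  then obtain k q r where e: "e = {lab (k, q), lab (k, r)}" and k: "k = 1 \<or> k = N" "even (k + q)" "even (k + r)"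
    and d: "\<not> 2 * N dvd r - q" "\<not> 2 * N dvd r - (q - 2)" "\<not> 2 * N dvd r - (q + 2)"
    unfolding rim_chords_def by blast
  have "is_end k 1 \<or> is_end k (-1)" using k(1) by (auto simp: is_end_def)
  then obtain t where t: "is_end k t" by blast
  have q1: "odd (k + (q + 1))" using k by simp
  let ?a = "lab (k - t, q + 1)"
  note pos = end_in_positions[OF t]
  note ep = end_position[OF t]
  have pole_notin_rim: "?a \<noteq> lab (l, x)" if "l = 1 \<or> l = N" "even (l + x)" for l x
  proof -
    have "(l, x) \<in> positions" using that N3 by (auto simp: pos_iff)
    moreover have "k - t \<noteq> l" using that ep N3 by auto
    ultimately show ?thesis using lab_neq[OF pos(1)[OF q1]] by blast
  qed
  have "insert ?a \<rho> \<in> ?M \<and> (\<forall>e'\<in>rim_chords. e' \<subseteq> insert ?a \<rho> \<longrightarrow> e' \<subseteq> \<rho>)" if \<rho>: "\<rho> \<in> ?M" "e \<subseteq> \<rho>" for \<rho>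
  proof (intro conjI ballI impI)
    have "\<rho> \<in> ?K" using \<rho>(1) by (simp add: avoiding_def)
    then obtain s p where s: "is_end k s" "odd (k + p)" "\<rho> \<subseteq> insert (lab (k - s, p)) (embed_face (ring k))"
      "\<not> embed_face (ring k) \<subseteq> \<rho>"
      using rim_chord_star[OF _ k d \<rho>(2)[unfolded e]] by blast
    have st: "s = t" using end_unique[OF s(1) t] by simp
    have "lab (k - t, p) = ?a"
      using lab_eq_iff[OF pos(1)[OF s(2)] pos(1)[OF q1]] ep(6) by (simp add: same_def) blast
    then have sub: "\<rho> \<subseteq> insert ?a (embed_face (ring k))" using s(3) st by simp
    have "\<rho> \<subseteq> cone k t p" using s(3) st unfolding cone_def by blast
    then have S: "insert ?a \<rho> \<in> subdivided" using insert_pole[OF t s(2) _ s(4) q1] by blast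
    have C: "\<not> e' \<subseteq> insert ?a \<rho>" if e': "e' \<in> cross_edges" for e'
      using pole_notin_cross_edge[OF t q1 e'] \<open>\<rho> \<in> ?K\<close> e' by (auto simp: avoiding_def)
    have Ve: "\<not> e' \<subseteq> insert ?a \<rho>" if e': "e' \<in> vertical_edges" for e'
    proof
      assume sub': "e' \<subseteq> insert ?a \<rho>"
      obtain l x where l: "e' = {lab (l - 1, x), lab (l + 1, x)}" "1 \<le> l" "l \<le> N" "odd (l + x)"
        using e' unfolding vertical_edges_def by blast
      have lp: "(l - 1, x) \<in> positions" "(l + 1, x) \<in> positions" using l by (auto simp: pos_iff)
      have lev: "m = k \<or> m = k - t" if "(m, x) \<in> positions" "lab (m, x) \<in> e'" for m
      proof -
        have "lab (m, x) = ?a \<or> lab (m, x) \<in> embed_face (ring k)" using sub sub' that(2) by blast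
        then show ?thesis
          using lab_in_rim[OF k(1) that(1)] lab_eq_iff[OF that(1) pos(1)[OF q1]] by (auto simp: same_def)
      qed
      show False using lev[OF lp(1)] lev[OF lp(2)] l(1) ep(7) by auto
    qed
    show "insert ?a \<rho> \<in> ?M" using S C Ve by (simp add: avoiding_def)
    fix e' assume e': "e' \<in> rim_chords" "e' \<subseteq> insert ?a \<rho>"
    then have "?a \<notin> e'" using pole_notin_rim unfolding rim_chords_def by blast
    then show "e' \<subseteq> \<rho>" using e'(2) by blast
  qed
  moreover have "?a \<notin> e" using pole_notin_rim k e by blast
  ultimately show "e \<noteq> {} \<and> (\<exists>a. a \<notin> e \<and> (\<forall>\<rho>\<in>?M. e \<subseteq> \<rho> \<longrightarrow>
      insert a \<rho> \<in> ?M \<and> (\<forall>e'\<in>rim_chords. e' \<subseteq> insert a \<rho> \<longrightarrow> e' \<subseteq> \<rho>)))"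
    using e by (intro conjI exI[of _ ?a]) auto
qed

section \<open>The complex that remains\<close>

lemma sphereI: "1 \<le> k \<Longrightarrow> k \<le> N \<Longrightarrow> odd (k + q) \<Longrightarrow> t = 1 \<or> t = -1 \<Longrightarrow>
    \<sigma> \<subseteq> {lab (k, q - 1), lab (k, q + 1), lab (k + t, q)} \<Longrightarrow> \<sigma> \<in> sphere"
  unfolding sphere_def by (intro CollectI bexI[OF _ triangle_in_triangles[of k q t]]) auto

text \<open>A square without its vertical diagonal leaves two triangles. In a cone, a face with the
  next-level vertex has no pole and only two possible rim vertices; any other face has rim vertices
  pairwise at most two steps apart, hence within one edge of the rim.\<close>

lemma avoiding_subset_sphere:
  assumes S: "\<rho> \<in> subdivided"
    and cross: "\<And>a b. {a, b} \<in> cross_edges \<Longrightarrow> a \<in> \<rho> \<Longrightarrow> b \<in> \<rho> \<Longrightarrow> False"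
    and vert: "\<And>a b. {a, b} \<in> vertical_edges \<Longrightarrow> a \<in> \<rho> \<Longrightarrow> b \<in> \<rho> \<Longrightarrow> False"
    and chord: "\<And>a b. {a, b} \<in> rim_chords \<Longrightarrow> a \<in> \<rho> \<Longrightarrow> b \<in> \<rho> \<Longrightarrow> False"
  shows "\<rho> \<in> sphere"
  using S unfolding subdivided_iff
proof (elim disjE exE conjE)
  fix k q assume *: "2 \<le> k" "k \<le> N - 1" "odd (k + q)" "\<rho> \<subseteq> lab ` diamond k q"
  have k: "1 \<le> k" "k \<le> N" using * by auto
  have "\<not> (lab (k - 1, q) \<in> \<rho> \<and> lab (k + 1, q) \<in> \<rho>)" using vert[OF vertical_edgeI[OF k *(3)]] by blast
  then consider "\<rho> \<subseteq> {lab (k, q - 1), lab (k, q + 1), lab (k + 1, q)}"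
    | "\<rho> \<subseteq> {lab (k, q - 1), lab (k, q + 1), lab (k + (- 1), q)}"
    using *(4) unfolding diamond_def by auto
  then show ?thesis using sphereI[OF k *(3)] by cases blast+
next
  fix k t q assume *: "is_end k t" "odd (k + q)" "\<rho> \<subseteq> cone k t q" "\<not> embed_face (ring k) \<subseteq> \<rho>"
  note k = end_position[OF *(1)] and pos = end_in_positions[OF *(1)]
  have dd: "2 * N dvd a - b" if "2 * N dvd a" "2 * N dvd b" for a b using that by (rule dvd_diff)
  have rim: "\<exists>r. x = lab (k, r) \<and> even (k + r)" if "x \<in> embed_face (ring k)" for x
    using that unfolding rim_eq[OF k(5)] by blast
  have cong: "lab (k, r) = lab (k, r')" if "2 * N dvd r - r'" "even (k + r)" "even (k + r')" for r r'
    using lab_cong that pos(3) by blast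
  show ?thesis
  proof (cases "lab (k + t, q) \<in> \<rho>")
    case w: True
    have "lab (k - t, q) \<notin> \<rho>" using vert[OF vertical_edgeI[OF k(1,2) *(2)]] w k(7) by auto
    moreover have "x = lab (k, q - 1) \<or> x = lab (k, q + 1)" if x: "x \<in> \<rho>" "x \<in> embed_face (ring k)" for x
    proof -
      obtain r where r: "x = lab (k, r)" "even (k + r)" using rim x by blast
      then have "2 * N dvd r - (q - 1) \<or> 2 * N dvd r - (q + 1)"
        using cross[OF cross_edgeI[OF *(1,2)] w] x by blast
      then show ?thesis using cong[of r "q - 1"] cong[of r "q + 1"] r *(2) by auto
    qed
    ultimately have "\<rho> \<subseteq> {lab (k, q - 1), lab (k, q + 1), lab (k + t, q)}"
      using *(3) unfolding cone_def by auto
    then show ?thesis using sphereI[OF k(1,2) *(2) k(7)] by blast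
  next
    case False
    have pole: "lab (k - t, q) = lab (k + (- t), p)" if "odd (k + p)" for p
      using lab_eq_iff[OF pos(1)[OF *(2)] pos(1)[OF that]] k(6) by (simp add: same_def) blast
    have nt: "- t = 1 \<or> - t = -1" using k(7) by auto
    have sub: "x = lab (k - t, q) \<or> (\<exists>r. x = lab (k, r) \<and> even (k + r))" if "x \<in> \<rho>" for x
      using that False rim *(3) unfolding cone_def by blast
    have tri: "\<rho> \<in> sphere" if p: "odd (k + p)" and cov: "\<And>r. even (k + r) \<Longrightarrow> lab (k, r) \<in> \<rho> \<Longrightarrow>
      2 * N dvd r - (p - 1) \<or> 2 * N dvd r - (p + 1)" for p
    proof -
      have "x \<in> {lab (k, p - 1), lab (k, p + 1), lab (k + (- t), p)}" if x: "x \<in> \<rho>" for x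
      proof (cases "x = lab (k - t, q)")
        case True
        then show ?thesis using pole[OF p] by simp
      next
        case False
        then obtain r where r: "x = lab (k, r)" "even (k + r)" using sub[OF x] by blast
        then have "2 * N dvd r - (p - 1) \<or> 2 * N dvd r - (p + 1)" using cov x by blast
        then show ?thesis using cong[of r "p - 1"] cong[of r "p + 1"] r p by auto
      qed
      then show ?thesis using sphereI[OF k(1,2) p nt] by blast
    qed
    have near: "2 * N dvd r - q \<or> 2 * N dvd r - (q - 2) \<or> 2 * N dvd r - (q + 2)"
      if "even (k + q)" "even (k + r)" "lab (k, q) \<in> \<rho>" "lab (k, r) \<in> \<rho>" for q r
      using chord[OF rim_chordI[OF k(5) that(1,2)] that(3,4)] by blast
    show ?thesis
    proof (cases "\<exists>r. even (k + r) \<and> lab (k, r) \<in> \<rho>")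
      case False
      then show ?thesis using tri[OF *(2)] by blast
    next
      case True
      then obtain r where r: "even (k + r)" "lab (k, r) \<in> \<rho>" by blast
      have r2: "even (k + (r + 2))" using r(1) by simp
      show ?thesis
      proof (cases "lab (k, r + 2) \<in> \<rho>")
        case no: False
        have "\<not> 2 * N dvd x - (r + 2)" if "even (k + x)" "lab (k, x) \<in> \<rho>" for x
          using cong[OF _ that(1) r2] no that(2) by auto
        then have "2 * N dvd x - (r - 1 - 1) \<or> 2 * N dvd x - (r - 1 + 1)" if "even (k + x)" "lab (k, x) \<in> \<rho>" for x
          using near[OF r(1) that(1) r(2) that(2)] that by auto
        then show ?thesis using tri[of "r - 1"] r(1) by auto
      next
        case yes: True
        \<comment> \<open>Rim vertices \<open>r - 2\<close>, \<open>r\<close> and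
          \<open>r + 2\<close> can be pairwise close only for \<open>N = 3\<close>; then they make
          up the whole rim, which no face contains.\<close>
        have "\<not> 2 * N dvd x - (r - 2)" if x: "even (k + x)" "lab (k, x) \<in> \<rho>" for x
        proof
          assume x1: "2 * N dvd x - (r - 2)"
          have "2 * N dvd x - (r + 2) \<or> 2 * N dvd x - (r + 2 - 2) \<or> 2 * N dvd x - (r + 2 + 2)"
            using near[OF r2 x(1) yes x(2)] .
          then have six: "2 * N dvd x - (r + 2 + 2)"
            using x1 dvd_close[of "x - (r - 2)" "x - (r + 2)"] dvd_close[of "x - (r - 2)" "x - (r + 2 - 2)"] by auto
          then have "2 * N dvd 6" using dd[OF six x1] by simp
          then have "N = 3" using N3 zdvd_imp_le[of "2 * N" 6] by auto
          have "lab (k, y) \<in> \<rho>" if y: "even (k + y)" for y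
          proof -
            have "even (y - r)" using y r(1) by auto
            then have "6 dvd y - r \<or> 6 dvd y - (r + 2) \<or> 6 dvd y - (r - 2)" by presburger
            then have "2 * N dvd y - r \<or> 2 * N dvd y - (r + 2) \<or> 2 * N dvd y - x"
              using dd[of "y - (r - 2)" "x - (r - 2)"] x1 \<open>N = 3\<close> by auto
            then show ?thesis using cong[OF _ y r(1)] cong[OF _ y r2] cong[OF _ y x(1)] r(2) yes x(2) by auto
          qed
          then have "embed_face (ring k) \<subseteq> \<rho>" unfolding rim_eq[OF k(5)] by blast
          then show False using *(4) by blast
        qed
        then have "2 * N dvd x - (r + 1 - 1) \<or> 2 * N dvd x - (r + 1 + 1)" if "even (k + x)" "lab (k, x) \<in> \<rho>" for x
          using near[OF r(1) that(1) r(2) that(2)] that by (auto simp: algebra_simps)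
        then show ?thesis using tri[of "r + 1"] r(1) by auto
      qed
    qed
  qed
qed

lemma sphere_avoiding:
  assumes "\<rho> \<in> sphere"
  shows "\<rho> \<in> subdivided" and "e \<in> cross_edges \<union> vertical_edges \<union> rim_chords \<Longrightarrow> \<not> e \<subseteq> \<rho>"
proof -
  obtain k q t where T: "\<rho> \<subseteq> lab ` {(k, q - 1), (k, q + 1), (k + t, q)}"
    and k: "1 \<le> k" "k \<le> N" "odd (k + q)" "t = 1 \<or> t = -1"
    using assms unfolding sphere_def triangles_def by blast
  have sub: "\<rho> \<subseteq> lab ` diamond k q" using T k(4) by (auto simp: diamond_def)
  show "\<rho> \<in> subdivided" using diamond_subset_in_subdivided[OF k(1-3) sub] .
  have lev: "l = k \<and> (2 * N dvd r - (q - 1) \<or> 2 * N dvd r - (q + 1)) \<or>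
      l = k + t \<and> (l = 0 \<or> l = N + 1 \<or> 2 * N dvd r - q)"
    if lr: "(l, r) \<in> positions" "lab (l, r) \<in> \<rho>" for l r
  proof -
    have "(k, q - 1) \<in> positions" "(k, q + 1) \<in> positions" "(k + t, q) \<in> positions"
      using k by (auto simp: pos_iff)
    then have "same (l, r) (k, q - 1) \<or> same (l, r) (k, q + 1) \<or> same (l, r) (k + t, q)"
      using T lr lab_eq_iff by auto
    then show ?thesis using k by (auto simp: same_def)
  qed
  assume "e \<in> cross_edges \<union> vertical_edges \<union> rim_chords"
  then consider "e \<in> cross_edges" | "e \<in> vertical_edges" | "e \<in> rim_chords" by blast
  then show "\<not> e \<subseteq> \<rho>"
  proof cases
    case 1
    then show ?thesis using cross_edge_not_in_diamond[OF k(1-3)] sub by blast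
  next
    case 2
    then obtain l x where l: "e = {lab (l - 1, x), lab (l + 1, x)}" "1 \<le> l" "l \<le> N" "odd (l + x)"
      unfolding vertical_edges_def by blast
    then have lp: "(l - 1, x) \<in> positions" "(l + 1, x) \<in> positions" by (auto simp: pos_iff)
    show ?thesis using lev[OF lp(1)] lev[OF lp(2)] l(1) k(4) by auto
  next
    case 3
    then obtain l x y where l: "e = {lab (l, x), lab (l, y)}" "l = 1 \<or> l = N" "even (l + x)" "even (l + y)"
      and d: "\<not> 2 * N dvd y - x" "\<not> 2 * N dvd y - (x - 2)" "\<not> 2 * N dvd y - (x + 2)"
      unfolding rim_chords_def by blast
    then have lp: "(l, x) \<in> positions" "(l, y) \<in> positions" using N3 by (auto simp: pos_iff)
    have dd: "2 * N dvd a - b" if "2 * N dvd a" "2 * N dvd b" for a b using that by (rule dvd_diff)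
    show ?thesis
    proof
      assume "e \<subseteq> \<rho>"
      then have x: "l = k \<and> (2 * N dvd x - (q - 1) \<or> 2 * N dvd x - (q + 1)) \<or> l = k + t \<and> 2 * N dvd x - q"
        and y: "l = k \<and> (2 * N dvd y - (q - 1) \<or> 2 * N dvd y - (q + 1)) \<or> l = k + t \<and> 2 * N dvd y - q"
        using lev[OF lp(1)] lev[OF lp(2)] l(1,2) N3 by auto
      show False
      proof (cases "l = k")
        case True
        then show False using x y k(4) dd[of "y - (q - 1)" "x - (q - 1)"] dd[of "y - (q - 1)" "x - (q + 1)"]
          dd[of "y - (q + 1)" "x - (q - 1)"] dd[of "y - (q + 1)" "x - (q + 1)"] d
        by (auto simp: algebra_simps)
      next
        case False
        then show False using x y dd[of "y - q" "x - q"] d(1) by simp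
      qed
    qed
  qed
qed

lemma collapses_subdivided_sphere: "collapses subdivided sphere"
proof -
  let ?L = "avoiding (avoiding (avoiding subdivided cross_edges) vertical_edges) rim_chords"
  have "collapses subdivided ?L"
    using collapse_cross_edges collapse_vertical_edges collapse_rim_chords collapses_trans by blast
  moreover have "?L = sphere"
  proof (intro subset_antisym subsetI)
    fix \<rho> assume \<rho>: "\<rho> \<in> ?L"
    have d: "False" if "{a, b} \<in> E" "a \<in> \<rho>" "b \<in> \<rho>" "E = cross_edges \<or> E = vertical_edges \<or> E = rim_chords" for a b E
      using \<rho> that unfolding avoiding_def by (metis (no_types, lifting) empty_subsetI insert_subset mem_Collect_eq)
    show "\<rho> \<in> sphere" using \<rho> by (intro avoiding_subset_sphere) (auto simp: avoiding_def dest: d)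
  next
    fix \<rho> assume "\<rho> \<in> sphere"
    then show "\<rho> \<in> ?L" using sphere_avoiding by (simp add: avoiding_def)
  qed
  ultimately show ?thesis by simp
qed

lemma sphere_polytopal: "is_boundary_of_simplicial_3_polytope sphere"
  unfolding sphere_def using is_boundary_of_simplicial_3_polytope_triangles lab_eq_iff by blast

end

subsection \<open>Automorphisms\<close>

context drum_graph begin

definition nbhd :: "'a \<Rightarrow> 'a set" where
  "nbhd x = {y\<in>V. adj x y}"

definition twins :: "'a \<Rightarrow> 'a \<Rightarrow> bool" where
  "twins x y \<longleftrightarrow> x \<noteq> y \<and> 3 \<le> card (nbhd x \<inter> nbhd y)"

lemma inner_iff: "(k, q) \<in> inner \<longleftrightarrow> 1 \<le> k \<and> k \<le> N \<and> even (k + q)"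
  by (simp add: inner_def)

lemma v_in_V: "a \<in> inner \<Longrightarrow> v a \<in> V"
  by (simp add: V_eq)

lemma V_cases: "x \<in> V \<Longrightarrow> (\<And>k q. x = v (k, q) \<Longrightarrow> (k, q) \<in> inner \<Longrightarrow> thesis) \<Longrightarrow> thesis"
  unfolding V_eq by auto

lemma nbhd_v: "(k, q) \<in> inner \<Longrightarrow> nbhd (v (k, q)) = fac (N + 1 - k) (q + N)"
proof -
  assume "(k, q) \<in> inner"
  then have "{y\<in>V. adj (v (k, q)) y} = fac (N + 1 - k) (q + N)"
    using adj_iff unfolding V_eq fac_def by auto
  then show ?thesis by (simp only: nbhd_def)
qed

lemma v_cong: "(k, q) \<in> inner \<Longrightarrow> (k, r) \<in> inner \<Longrightarrow> 2 * N dvd q - r \<Longrightarrow> v (k, q) = v (k, r)"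
  using v_eq_iff by simp

text \<open>The centre on level \<open>l\<close> fixes the angle of a common vertex on level
  \<open>k\<close> and vice versa; a common vertex on a third level is halfway between the
  two.\<close>

lemma fac_inter_distinct_levels:
  assumes k: "1 \<le> k" "k \<le> N" "odd (k + q)" and l: "1 \<le> l" "l \<le> N" "odd (l + p)" and "k \<noteq> l"
  shows "\<exists>a b. fac k q \<inter> fac l p \<subseteq> {a, b}"
proof -
  have el: "x = v (k, p) \<and> (k = l + 1 \<or> k = l - 1) \<or> x = v (l, q) \<and> (k = l + 1 \<or> k = l - 1) \<or>
      x = v ((k + l) div 2, q) \<and> (k = l + 2 \<or> k = l - 2)" if x: "x \<in> fac k q \<inter> fac l p" for x
  proof -
    have "x \<in> V" using x fac_subset by blast
    then obtain m r where m: "x = v (m, r)" "(m, r) \<in> inner" by (rule V_cases)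
    then have i: "incident k q m r" "incident l p m r" using x v_in_fac by auto
    consider "m = k" | "m = l" | "m \<noteq> k" "m \<noteq> l" by blast
    then show ?thesis
    proof cases
      case 1
      then have "k = l + 1 \<or> k = l - 1" "2 * N dvd r - p" using i(2) \<open>k \<noteq> l\<close> by (auto simp: incident_def)
      moreover from this have "(k, p) \<in> inner" using k l by (auto simp: inner_iff)
      ultimately show ?thesis using v_cong m 1 by blast
    next
      case 2
      then have "k = l + 1 \<or> k = l - 1" "2 * N dvd r - q" using i(1) \<open>k \<noteq> l\<close> by (auto simp: incident_def)
      moreover from this have "(l, q) \<in> inner" using k l by (auto simp: inner_iff)
      ultimately show ?thesis using v_cong m 2 by blast
    next
      case 3
      then have "m = k + 1 \<or> m = k - 1" "m = l + 1 \<or> m = l - 1" and d: "2 * N dvd r - q"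
        using i by (auto simp: incident_def)
      then have kl: "k = l + 2 \<or> k = l - 2" "m = (k + l) div 2" using \<open>k \<noteq> l\<close> by auto
      then have "(m, q) \<in> inner" using k l m(2) \<open>m = k + 1 \<or> m = k - 1\<close> by (auto simp: inner_iff)
      then have "x = v (m, q)" using v_cong[OF _ _ d] m by simp
      then show ?thesis using kl by simp
    qed
  qed
  show ?thesis
  proof (cases "k = l + 1 \<or> k = l - 1")
    case True
    then have "x \<in> {v (k, p), v (l, q)}" if "x \<in> fac k q \<inter> fac l p" for x using el[OF that] by auto
    then show ?thesis by blast
  next
    case False
    then have "x \<in> {v ((k + l) div 2, q)}" if "x \<in> fac k q \<inter> fac l p" for x using el[OF that] by auto
    then show ?thesis by blast
  qed
qed

lemma fac_inter_same_level:
  assumes k: "2 \<le> k" "k \<le> N - 1" "odd (k + q)" "odd (k + p)" and d: "\<not> 2 * N dvd q - p"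
  shows "\<exists>a b. fac k q \<inter> fac k p \<subseteq> {a, b}"
proof -
  have "x = v (k, q - 1) \<or> x = v (k, q + 1)" if x: "x \<in> fac k q \<inter> fac k p" for x
  proof -
    have "x \<in> V" using x fac_subset by blast
    then obtain m r where m: "x = v (m, r)" "(m, r) \<in> inner" by (rule V_cases)
    then have i: "incident k q m r" "incident k p m r" using x v_in_fac by auto
    have "m = k"
    proof (rule ccontr)
      assume "m \<noteq> k"
      then have "2 * N dvd r - q" "2 * N dvd r - p" using i by (auto simp: incident_def)
      then have "2 * N dvd (r - p) - (r - q)" by (rule dvd_diff[rotated])
      then show False using d by simp
    qed
    then have "2 * N dvd r - (q - 1) \<or> 2 * N dvd r - (q + 1)" using i(1) k by (auto simp: incident_def)
    moreover have "(k, q - 1) \<in> inner" "(k, q + 1) \<in> inner" using k by (auto simp: inner_iff)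
    ultimately show ?thesis using v_cong m \<open>m = k\<close> by blast
  qed
  then have "fac k q \<inter> fac k p \<subseteq> {v (k, q - 1), v (k, q + 1)}" by blast
  then show ?thesis by blast
qed

lemma card_ring: "k = 1 \<or> k = N \<Longrightarrow> ring k \<subseteq> A \<Longrightarrow> finite A \<Longrightarrow> 3 \<le> card A"
proof -
  assume k: "k = 1 \<or> k = N" and A: "ring k \<subseteq> A" "finite A"
  have "(k, k) \<in> inner" "(k, k + 2) \<in> inner" "(k, k + 4) \<in> inner" using k N3 by (auto simp: inner_iff)
  moreover have "\<not> 2 * N dvd k - (k + 2)" "\<not> 2 * N dvd k - (k + 4)" "\<not> 2 * N dvd (k + 2) - (k + 4)"
    using dvd_close[of "k - (k + 2)" 0] dvd_close[of "k - (k + 4)" 0] dvd_close[of "(k + 2) - (k + 4)" 0] by auto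
  ultimately have "card {v (k, k), v (k, k + 2), v (k, k + 4)} = 3"
    using v_eq_iff by (subst card_3_iff) blast
  moreover have "v (k, k) \<in> ring k" "v (k, k + 2) \<in> ring k" "v (k, k + 4) \<in> ring k"
    by (auto simp: ring_def)
  then have "{v (k, k), v (k, k + 2), v (k, k + 4)} \<subseteq> A" using A by blast
  ultimately show ?thesis using card_mono[OF A(2)] by metis
qed

lemma twins_iff:
  assumes a: "(k, q) \<in> inner" and b: "(l, r) \<in> inner"
  shows "twins (v (k, q)) (v (l, r)) \<longleftrightarrow> k = l \<and> (k = 1 \<or> k = N) \<and> \<not> 2 * N dvd q - r"
proof -
  let ?I = "fac (N + 1 - k) (q + N) \<inter> fac (N + 1 - l) (r + N)"
  have t: "twins (v (k, q)) (v (l, r)) \<longleftrightarrow> \<not> (k = l \<and> 2 * N dvd q - r) \<and> 3 \<le> card ?I"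
    unfolding twins_def using nbhd_v[OF a] nbhd_v[OF b] v_eq_iff[OF a b] by simp
  have c: "1 \<le> N + 1 - k" "N + 1 - k \<le> N" "odd (N + 1 - k + (q + N))"
      "1 \<le> N + 1 - l" "N + 1 - l \<le> N" "odd (N + 1 - l + (r + N))"
    using a b by (auto simp: inner_iff)
  have fin: "finite ?I" using fac_subset finite_V by (meson finite_Int finite_subset)
  have small: "\<not> 3 \<le> card ?I" if ex: "\<exists>x y. ?I \<subseteq> {x, y}"
  proof -
    obtain x y where xy: "?I \<subseteq> {x, y}" using ex by blast
    have "card ?I \<le> card {x, y}" by (rule card_mono) (use xy in auto)
    also have "\<dots> \<le> 2" by (simp add: card_insert_if)
    finally show ?thesis by simp
  qed
  consider "k \<noteq> l" | "k = l" "k \<noteq> 1" "k \<noteq> N" | "k = l" "k = 1 \<or> k = N" by blast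
  then show ?thesis
  proof cases
    case 1
    then show ?thesis using small[OF fac_inter_distinct_levels[OF c]] t by simp
  next
    case 2
    have "2 \<le> N + 1 - k" "N + 1 - k \<le> N - 1" using 2 a by (auto simp: inner_iff)
    then have "\<exists>x y. ?I \<subseteq> {x, y}" if "\<not> 2 * N dvd q - r"
      using fac_inter_same_level[of "N + 1 - k" "q + N" "r + N"] c 2(1) that by simp
    then have "\<not> 2 * N dvd q - r \<Longrightarrow> \<not> 3 \<le> card ?I" using small by blast
    then show ?thesis using t 2 by blast
  next
    case 3
    have e: "N + 1 - k = 1 \<or> N + 1 - k = N" using 3 by auto
    have "ring (N + 1 - k) \<subseteq> ?I" using ring_subset_fac_iff[OF e] 3(1) by simp
    then show ?thesis using t 3 card_ring[OF e _ fin] by blast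
  qed
qed

text \<open>The cyclic enumeration of the two end levels, and the only further neighbour of each of their
  vertices.\<close>

definition bdry :: "int \<Rightarrow> int \<times> int" where
  "bdry p = (if odd p then (1, p) else (N, p + N))"

definition subbdry :: "int \<Rightarrow> int \<times> int" where
  "subbdry p = (if odd p then (N - 1, p + N) else (2, p))"

lemma bdry_inner: "bdry p \<in> inner"
  using N3 by (auto simp: bdry_def inner_iff)

lemma subbdry_inner: "subbdry p \<in> inner"
  using N3 by (auto simp: subbdry_def inner_iff)

lemma v_bdry_eq_iff: "v (bdry p) = v (bdry q) \<longleftrightarrow> 2 * N dvd p - q"
proof -
  have "2 * N dvd p - q \<Longrightarrow> even (p - q)" by (rule dvd_imp_even)
  then show ?thesis
    using bdry_inner[of p] bdry_inner[of q] N3 unfolding bdry_def by (auto simp: v_eq_iff)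
qed

text \<open>The two ends are joined completely, so adjacency between end vertices shows nothing of
  their cyclic order. This is why \<open>subbdry\<close> is needed.\<close>

lemma adj_bdry: "adj (v (bdry p)) (v (bdry q)) \<longleftrightarrow> odd (p - q)"
  using bdry_inner[of p] bdry_inner[of q] N3 unfolding bdry_def
  by (auto simp: adj_iff incident_def)

lemma bdry_level: "(k, q) \<in> inner \<Longrightarrow> k = 1 \<or> k = N \<Longrightarrow> \<exists>p. (k, q) = bdry p"
proof (cases "k = 1")
  case True
  assume "(k, q) \<in> inner"
  then have "(k, q) = bdry q" using True by (auto simp: bdry_def inner_iff)
  then show ?thesis by blast
next
  case False
  assume "(k, q) \<in> inner" "k = 1 \<or> k = N"
  then have "(k, q) = bdry (q - N)" using False by (auto simp: bdry_def inner_iff)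
  then show ?thesis by blast
qed

lemma twins_bdry_iff: "x \<in> V \<Longrightarrow> (\<exists>y\<in>V. twins x y) \<longleftrightarrow> (\<exists>p. x = v (bdry p))"
proof
  assume "x \<in> V" "\<exists>y\<in>V. twins x y"
  then obtain y where y: "y \<in> V" "twins x y" by blast
  obtain k q where "x = v (k, q)" "(k, q) \<in> inner" using \<open>x \<in> V\<close> by (rule V_cases)
  moreover obtain l r where "y = v (l, r)" "(l, r) \<in> inner" using y(1) by (rule V_cases)
  moreover note y(2)
  ultimately have "k = 1 \<or> k = N" using twins_iff by blast
  then obtain p where "(k, q) = bdry p" using bdry_level \<open>(k, q) \<in> inner\<close> by blast
  then show "\<exists>p. x = v (bdry p)" using \<open>x = v (k, q)\<close> by auto
next
  assume "\<exists>p. x = v (bdry p)"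
  then obtain p where x: "x = v (bdry p)" by blast
  have "\<not> 2 * N dvd p - (p + 2)" using dvd_close[of "p - (p + 2)" 0] by auto
  then have "twins x (v (bdry (p + 2)))"
    using bdry_inner[of p] bdry_inner[of "p + 2"] unfolding x bdry_def by (auto simp: twins_iff)
  then show "\<exists>y\<in>V. twins x y" using v_in_V bdry_inner by blast
qed

lemma subbdry_not_bdry: "v (subbdry p) \<noteq> v (bdry q)"
  using bdry_inner[of q] subbdry_inner[of p] N3 unfolding bdry_def subbdry_def by (auto simp: v_eq_iff)

lemma adj_bdry_subbdry: "adj (v (bdry p)) (v (subbdry p))"
  using bdry_inner[of p] subbdry_inner[of p] N3 unfolding bdry_def subbdry_def
  by (auto simp: adj_iff incident_def)

lemma adj_bdry_unique:
  assumes "y \<in> V" "adj (v (bdry p)) y" "\<nexists>q. y = v (bdry q)"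
  shows "y = v (subbdry p)"
proof -
  obtain l r where y: "y = v (l, r)" "(l, r) \<in> inner" using assms(1) by (rule V_cases)
  then have l: "l \<noteq> 1" "l \<noteq> N" using bdry_level[OF y(2)] assms(3) y(1) by metis+
  show ?thesis
  proof (cases "odd p")
    case True
    then have "incident N (p + N) l r" using assms(2) y True adj_iff[OF _ y(2), of 1 p] bdry_inner[of p] by (simp add: bdry_def)
    then have "l = N - 1" "2 * N dvd r - (p + N)" using l y(2) by (auto simp: incident_def inner_iff)
    moreover from this have "(N - 1, p + N) \<in> inner" using subbdry_inner[of p] True by (simp add: subbdry_def)
    ultimately show ?thesis using v_cong[of "N - 1" r "p + N"] y True by (simp add: subbdry_def)
  next
    case False
    then have "incident 1 (p + N + N) l r" using assms(2) y False adj_iff[OF _ y(2), of N "p + N"] bdry_inner[of p] by (simp add: bdry_def)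
    then have l2: "l = 2" "2 * N dvd r - (p + N + N)" using l y(2) by (auto simp: incident_def inner_iff)
    then have "2 * N dvd r - p" using dvd_shift[of "- (2 * N)" "r - (p + N + N)"] by (simp add: algebra_simps)
    moreover have "(2, p) \<in> inner" using subbdry_inner[of p] False by (simp add: subbdry_def)
    ultimately show ?thesis using v_cong[of 2 r p] y l2(1) False by (simp add: subbdry_def)
  qed
qed

text \<open>For indices at opposite ends this recovers from the graph alone which of them are
  consecutive. Neither level \<open>2\<close> nor level \<open>N - 1\<close> is an end level, so no
  extra adjacencies interfere.\<close>

lemma adj_subbdry:
  assumes "odd (p - q)"
  shows "adj (v (subbdry p)) (v (subbdry q)) \<longleftrightarrow> 2 * N dvd q - (p - 1) \<or> 2 * N dvd q - (p + 1)"
proof -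
  have sh: "2 * N dvd x + 2 * N \<longleftrightarrow> 2 * N dvd x" "2 * N dvd x - 2 * N \<longleftrightarrow> 2 * N dvd x" for x
    using dvd_shift[of "2 * N" x] by simp_all
  show ?thesis
  proof (cases "odd p")
    case True
    then have "adj (v (subbdry p)) (v (subbdry q)) \<longleftrightarrow> incident 2 (p + N + N) 2 q"
      using assms subbdry_inner[of p] subbdry_inner[of q] unfolding subbdry_def by (simp add: adj_iff)
    also have "\<dots> \<longleftrightarrow> 2 * N dvd q - (p - 1) - 2 * N \<or> 2 * N dvd q - (p + 1) - 2 * N"
      using N3 by (simp add: incident_def algebra_simps)
    finally show ?thesis unfolding sh .
  next
    case False
    then have "adj (v (subbdry p)) (v (subbdry q)) \<longleftrightarrow> incident (N - 1) (p + N) (N - 1) (q + N)"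
      using assms subbdry_inner[of p] subbdry_inner[of q] unfolding subbdry_def by (simp add: adj_iff)
    also have "\<dots> \<longleftrightarrow> 2 * N dvd q - (p - 1) \<or> 2 * N dvd q - (p + 1)"
      using N3 by (simp add: incident_def algebra_simps)
    finally show ?thesis .
  qed
qed

end

section \<open>Every automorphism is dihedral\<close>

context levels begin

text \<open>The dihedral action on positions: \<open>\<epsilon> = \<plusminus>1\<close>, and an odd \<open>c\<close> exchanges the two ends.\<close>

definition dihedral :: "int \<Rightarrow> int \<Rightarrow> int \<times> int \<Rightarrow> int \<times> int" where
  "dihedral \<epsilon> c a = (if even c then (fst a, \<epsilon> * snd a + c) else (N + 1 - fst a, \<epsilon> * snd a + c + N))"

lemma dihedral_inner: "\<epsilon> = 1 \<or> \<epsilon> = -1 \<Longrightarrow> a \<in> inner \<Longrightarrow> dihedral \<epsilon> c a \<in> inner"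
  by (auto simp: dihedral_def inner_def)

lemma dihedral_surj:
  assumes "\<epsilon> = 1 \<or> \<epsilon> = -1" "(k, q) \<in> inner"
  shows "\<exists>b\<in>inner. dihedral \<epsilon> c b = (k, q)"
proof (cases "even c")
  case True
  then show ?thesis using assms
    by (intro bexI[of _ "(k, \<epsilon> * (q - c))"]) (auto simp: dihedral_def inner_def)
next
  case False
  then show ?thesis using assms
    by (intro bexI[of _ "(N + 1 - k, \<epsilon> * (q - c - N))"]) (auto simp: dihedral_def inner_def)
qed

lemma dvd_dihedral: "\<epsilon> = 1 \<or> \<epsilon> = -1 \<Longrightarrow> 2 * N dvd (\<epsilon> * q + c) - (\<epsilon> * r + c) \<longleftrightarrow> 2 * N dvd q - r"
  by (auto simp: dvd_diff_commute)

lemma dihedral_triangles: "\<epsilon> = 1 \<or> \<epsilon> = -1 \<Longrightarrow> T \<in> triangles \<Longrightarrow> dihedral \<epsilon> c ` T \<in> triangles"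
proof -
  assume e: "\<epsilon> = 1 \<or> \<epsilon> = -1" and "T \<in> triangles"
  then obtain k q t where T: "T = {(k, q - 1), (k, q + 1), (k + t, q)}"
    and k: "1 \<le> k" "k \<le> N" "odd (k + q)" "t = 1 \<or> t = -1"
    unfolding triangles_def by blast
  show ?thesis
  proof (cases "even c")
    case True
    have "dihedral \<epsilon> c ` T = {(k, \<epsilon> * q + c - 1), (k, \<epsilon> * q + c + 1), (k + t, \<epsilon> * q + c)}"
      using e True by (auto simp: T dihedral_def)
    then show ?thesis using triangle_in_triangles[of k "\<epsilon> * q + c" t] k e True by auto
  next
    case False
    have "dihedral \<epsilon> c ` T = {(N + 1 - k, \<epsilon> * q + c + N - 1), (N + 1 - k, \<epsilon> * q + c + N + 1), (N + 1 - k + (- t), \<epsilon> * q + c + N)}"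
      using e False by (auto simp: T dihedral_def)
    then show ?thesis using triangle_in_triangles[of "N + 1 - k" "\<epsilon> * q + c + N" "- t"] k e False by auto
  qed
qed

end

context drum_graph begin

lemma adj_dihedral:
  assumes e: "\<epsilon> = 1 \<or> \<epsilon> = -1" and a: "(k, q) \<in> inner" and b: "(l, r) \<in> inner"
  shows "adj (v (dihedral \<epsilon> c (k, q))) (v (dihedral \<epsilon> c (l, r))) \<longleftrightarrow> adj (v (k, q)) (v (l, r))"
proof -
  have A: "adj (v (dihedral \<epsilon> c (k, q))) (v (dihedral \<epsilon> c (l, r))) \<longleftrightarrow>
      incident (N + 1 - fst (dihedral \<epsilon> c (k, q))) (snd (dihedral \<epsilon> c (k, q)) + N)
        (fst (dihedral \<epsilon> c (l, r))) (snd (dihedral \<epsilon> c (l, r)))"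
    using adj_iff dihedral_inner[OF e a, of c] dihedral_inner[OF e b, of c] by (metis prod.collapse)
  have sh: "2 * N dvd x + 2 * N \<longleftrightarrow> 2 * N dvd x" for x by simp
  have D: "2 * N dvd \<epsilon> * r + d - (\<epsilon> * q + d + N - x) \<longleftrightarrow> 2 * N dvd r - (q + N - \<epsilon> * x)" for x d
  proof -
    \<comment> \<open>A reflection also changes the sign of \<open>N\<close>; the full turn
      \<open>2 * N\<close> repairs this.\<close>
    have "\<epsilon> * r + d - (\<epsilon> * q + d + N - x) = r - (q + N - \<epsilon> * x) \<or>
        \<epsilon> * r + d - (\<epsilon> * q + d + N - x) + 2 * N = - (r - (q + N - \<epsilon> * x))"
      using e by auto
    then show ?thesis using sh by (metis dvd_minus_iff)
  qed
  from D[of _ 1] D[of _ "-1"] D[of _ 0] e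
  have D1: "2 * N dvd \<epsilon> * r + d - (\<epsilon> * q + d + N - 1) \<or> 2 * N dvd \<epsilon> * r + d - (\<epsilon> * q + d + N + 1) \<longleftrightarrow>
      2 * N dvd r - (q + N - 1) \<or> 2 * N dvd r - (q + N + 1)"
    and D0: "2 * N dvd \<epsilon> * r + d - (\<epsilon> * q + d + N) \<longleftrightarrow> 2 * N dvd r - (q + N)" for d
    by auto
  show ?thesis
  proof (cases "even c")
    case True
    then show ?thesis unfolding A adj_iff[OF a b] incident_def
      using D1[of c] D0[of c] by (simp add: dihedral_def)
  next
    case False
    have "l = N + 1 - k \<longleftrightarrow> N + 1 - l = N + 1 - (N + 1 - k)"
      "l = N + 1 - k + 1 \<longleftrightarrow> N + 1 - l = N + 1 - (N + 1 - k) - 1"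
      "l = N + 1 - k - 1 \<longleftrightarrow> N + 1 - l = N + 1 - (N + 1 - k) + 1"
      "N + 1 - k = 1 \<longleftrightarrow> N + 1 - (N + 1 - k) = N" "N + 1 - k = N \<longleftrightarrow> N + 1 - (N + 1 - k) = 1" by auto
    then show ?thesis unfolding A adj_iff[OF a b] incident_def
      using False D1[of "c + N"] D0[of "c + N"] by (simp add: dihedral_def add.assoc) blast
  qed
qed

context
  fixes \<phi> :: "'a \<Rightarrow> 'a"
  assumes aut: "graph_automorphism V adj \<phi>"
begin

lemma aut_in: "x \<in> V \<Longrightarrow> \<phi> x \<in> V"
  using aut by (auto simp: graph_automorphism_def bij_betw_def)

lemma aut_surj: "y \<in> V \<Longrightarrow> \<exists>x\<in>V. \<phi> x = y"
  using aut unfolding graph_automorphism_def bij_betw_def by (metis imageE)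

lemma aut_inj: "inj_on \<phi> V"
  using aut by (simp add: graph_automorphism_def bij_betw_def)

lemma aut_eq_iff: "x \<in> V \<Longrightarrow> y \<in> V \<Longrightarrow> \<phi> x = \<phi> y \<longleftrightarrow> x = y"
  using aut_inj by (simp add: inj_on_eq_iff)

lemma aut_adj: "x \<in> V \<Longrightarrow> y \<in> V \<Longrightarrow> adj (\<phi> x) (\<phi> y) \<longleftrightarrow> adj x y"
  using aut by (simp add: graph_automorphism_def)

lemma aut_nbhd: "x \<in> V \<Longrightarrow> nbhd (\<phi> x) = \<phi> ` nbhd x"
proof (intro subset_antisym subsetI)
  fix y assume "x \<in> V" "y \<in> nbhd (\<phi> x)"
  then obtain z where "z \<in> V" "y = \<phi> z" "adj x z" using aut_surj aut_adj unfolding nbhd_def by blast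
  then show "y \<in> \<phi> ` nbhd x" unfolding nbhd_def by blast
next
  fix y assume "x \<in> V" "y \<in> \<phi> ` nbhd x"
  then show "y \<in> nbhd (\<phi> x)" using aut_in aut_adj unfolding nbhd_def by auto
qed

lemma aut_twins: "x \<in> V \<Longrightarrow> y \<in> V \<Longrightarrow> twins (\<phi> x) (\<phi> y) \<longleftrightarrow> twins x y"
proof -
  assume x: "x \<in> V" and y: "y \<in> V"
  have s: "nbhd x \<subseteq> V" "nbhd y \<subseteq> V" by (auto simp: nbhd_def)
  have "nbhd (\<phi> x) \<inter> nbhd (\<phi> y) = \<phi> ` (nbhd x \<inter> nbhd y)"
    unfolding aut_nbhd[OF x] aut_nbhd[OF y] using inj_on_image_Int[OF aut_inj s] by simp
  moreover have "card (\<phi> ` (nbhd x \<inter> nbhd y)) = card (nbhd x \<inter> nbhd y)"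
    by (rule card_image) (rule inj_on_subset[OF aut_inj], use s in blast)
  ultimately show ?thesis unfolding twins_def using aut_eq_iff[OF x y] by simp
qed

lemma aut_bdry: "x \<in> V \<Longrightarrow> (\<exists>p. \<phi> x = v (bdry p)) \<longleftrightarrow> (\<exists>p. x = v (bdry p))"
  using twins_bdry_iff aut_twins aut_in aut_surj by metis

lemma aut_subbdry:
  assumes "\<phi> (v (bdry p)) = v (bdry q)"
  shows "\<phi> (v (subbdry p)) = v (subbdry q)"
proof (rule adj_bdry_unique)
  have V: "v (bdry p) \<in> V" "v (subbdry p) \<in> V" using v_in_V bdry_inner subbdry_inner by auto
  show "\<phi> (v (subbdry p)) \<in> V" using aut_in V by simp
  show "adj (v (bdry q)) (\<phi> (v (subbdry p)))" using adj_bdry_subbdry aut_adj V assms by metis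
  show "\<nexists>r. \<phi> (v (subbdry p)) = v (bdry r)" using aut_bdry[OF V(2)] subbdry_not_bdry by metis
qed

text \<open>On the cyclic indices \<open>\<phi>\<close> acts by a map \<open>\<pi>\<close>,
  injective modulo \<open>2 * N\<close>, that preserves consecutiveness by
  \<open>adj_subbdry\<close>, hence by a rotation or a reflection of the cycle.\<close>

lemma aut_bdry_dihedral:
  obtains \<epsilon> c where "\<epsilon> = 1 \<or> \<epsilon> = -1" "\<And>p. \<phi> (v (bdry p)) = v (bdry (\<epsilon> * p + c))"
proof -
  have V: "v (bdry p) \<in> V" "v (subbdry p) \<in> V" for p using v_in_V bdry_inner subbdry_inner by auto
  have "\<forall>p. \<exists>p'. \<phi> (v (bdry p)) = v (bdry p')" using aut_bdry V by blast
  then obtain \<pi> where \<pi>: "\<And>p. \<phi> (v (bdry p)) = v (bdry (\<pi> p))" by metis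
  have inj: "2 * N dvd \<pi> p - \<pi> q \<longleftrightarrow> 2 * N dvd p - q" for p q
    using v_bdry_eq_iff[of p q] v_bdry_eq_iff[of "\<pi> p" "\<pi> q"] \<pi> aut_eq_iff[OF V(1) V(1)] by metis
  have odd: "odd (\<pi> p - \<pi> q) \<longleftrightarrow> odd (p - q)" for p q
    using adj_bdry[of p q] adj_bdry[of "\<pi> p" "\<pi> q"] \<pi> aut_adj[OF V(1) V(1)] by metis
  have next_to: "2 * N dvd \<pi> (p + 1) - (\<pi> p - 1) \<or> 2 * N dvd \<pi> (p + 1) - (\<pi> p + 1)" for p
  proof -
    have "2 * N dvd (p + 1) - (p - 1) \<or> 2 * N dvd (p + 1) - (p + 1)" by simp
    then have "adj (v (subbdry p)) (v (subbdry (p + 1)))" by (subst adj_subbdry) auto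
    then have "adj (v (subbdry (\<pi> p))) (v (subbdry (\<pi> (p + 1))))"
      using aut_adj[OF V(2) V(2)] aut_subbdry[OF \<pi>] by metis
    moreover have "odd (\<pi> p - \<pi> (p + 1))" using odd by simp
    ultimately show ?thesis by (simp add: adj_subbdry)
  qed
  have dd: "2 * N dvd a + b" if "2 * N dvd a" "2 * N dvd b" for a b using that by (rule dvd_add)
  define c where "c = \<pi> 0"
  obtain \<epsilon> :: int where e: "\<epsilon> = 1 \<or> \<epsilon> = -1" and e1: "2 * N dvd \<pi> 1 - (\<pi> 0 + \<epsilon>)"
    using next_to[of 0] by (metis add_0 diff_conv_add_uminus)
  \<comment> \<open>Two consecutive values are carried along to exclude turning back, which would
    make the images of \<open>n\<close> and \<open>n + 2\<close> coincide.\<close>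
  have main: "2 * N dvd \<pi> (int n) - (\<epsilon> * int n + c) \<and> 2 * N dvd \<pi> (int n + 1) - (\<epsilon> * (int n + 1) + c)" for n
  proof (induction n)
    case 0
    then show ?case using e1 by (simp add: c_def add.commute)
  next
    case (Suc n)
    have "2 * N dvd \<pi> (int n + 1 + 1) - (\<pi> (int n + 1) + \<epsilon>)"
    proof (rule ccontr)
      assume "\<not> ?thesis"
      then have "2 * N dvd \<pi> (int n + 1 + 1) - (\<pi> (int n + 1) - \<epsilon>)" using next_to[of "int n + 1"] e by auto
      then have "2 * N dvd (\<pi> (int n + 1 + 1) - (\<pi> (int n + 1) - \<epsilon>)) + (\<pi> (int n + 1) - (\<epsilon> * (int n + 1) + c))"
        using Suc dd by blast
      then have "2 * N dvd (\<pi> (int n + 1 + 1) - (\<pi> (int n + 1) - \<epsilon>)) + (\<pi> (int n + 1) - (\<epsilon> * (int n + 1) + c))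
          - (\<pi> (int n) - (\<epsilon> * int n + c))"
        by (rule dvd_diff) (use Suc in blast)
      then have "2 * N dvd \<pi> (int n + 1 + 1) - \<pi> (int n)" by (simp add: algebra_simps)
      then have "2 * N dvd int n + 1 + 1 - int n" using inj by blast
      then show False using dvd_close[of "int n + 1 + 1 - int n" 0] by simp
    qed
    then have "2 * N dvd (\<pi> (int n + 1 + 1) - (\<pi> (int n + 1) + \<epsilon>)) + (\<pi> (int n + 1) - (\<epsilon> * (int n + 1) + c))"
      using Suc dd by blast
    then show ?case using Suc by (simp add: algebra_simps)
  qed
  have "\<phi> (v (bdry p)) = v (bdry (\<epsilon> * p + c))" for p
  proof -
    define p0 where "p0 = p mod (2 * N)"
    have p0: "p0 = int (nat p0)" "2 * N dvd p - p0" using N3 by (auto simp: p0_def minus_mod_eq_mult_div)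
    have "v (bdry p) = v (bdry p0)" using p0(2) by (simp add: v_bdry_eq_iff)
    then have "\<phi> (v (bdry p)) = v (bdry (\<pi> p0))" using \<pi> by simp
    also have "\<dots> = v (bdry (\<epsilon> * p0 + c))" using main[of "nat p0"] p0(1) by (simp add: v_bdry_eq_iff)
    also have "\<dots> = v (bdry (\<epsilon> * p + c))"
      using p0(2) dvd_dihedral[OF e] by (simp add: v_bdry_eq_iff dvd_diff_commute)
    finally show ?thesis .
  qed
  then show ?thesis using that e by blast
qed

lemma dihedral_cong: "\<epsilon> = 1 \<or> \<epsilon> = -1 \<Longrightarrow> (k, q) \<in> inner \<Longrightarrow> (k, r) \<in> inner \<Longrightarrow> 2 * N dvd q - r \<Longrightarrow>
    v (dihedral \<epsilon> c (k, q)) = v (dihedral \<epsilon> c (k, r))"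
proof -
  assume e: "\<epsilon> = 1 \<or> \<epsilon> = -1" and i: "(k, q) \<in> inner" "(k, r) \<in> inner" and d: "2 * N dvd q - r"
  have D: "2 * N dvd (\<epsilon> * q + x) - (\<epsilon> * r + x)" for x using dvd_dihedral[OF e] d by blast
  have "2 * N dvd (\<epsilon> * q + c + N) - (\<epsilon> * r + c + N)" using D[of "c + N"] by (simp only: add.assoc)
  then show ?thesis
    using v_cong[OF _ _ D] v_cong[of _ "\<epsilon> * q + c + N" "\<epsilon> * r + c + N"]
      dihedral_inner[OF e i(1), of c] dihedral_inner[OF e i(2), of c]
    by (cases "even c") (simp_all add: dihedral_def)
qed

text \<open>The dihedral map preserves adjacency, so \<open>\<phi> (v (l, r))\<close> is the
  dihedral image of some neighbour of \<open>(k, q)\<close>. The images of all other neighbours are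
  already taken, and \<open>\<phi>\<close> is injective.\<close>

lemma aut_dihedral_step:
  assumes e: "\<epsilon> = 1 \<or> \<epsilon> = -1" and a: "(k, q) \<in> inner" "\<phi> (v (k, q)) = v (dihedral \<epsilon> c (k, q))"
    and z: "(l, r) \<in> inner" "adj (v (k, q)) (v (l, r))"
    and others: "\<And>m s. (m, s) \<in> inner \<Longrightarrow> adj (v (k, q)) (v (m, s)) \<Longrightarrow> v (m, s) \<noteq> v (l, r) \<Longrightarrow>
      \<phi> (v (m, s)) = v (dihedral \<epsilon> c (m, s))"
  shows "\<phi> (v (l, r)) = v (dihedral \<epsilon> c (l, r))"
proof -
  have V: "v (k, q) \<in> V" "v (l, r) \<in> V" using a z v_in_V by auto
  obtain k' q' where i': "\<phi> (v (l, r)) = v (k', q')" "(k', q') \<in> inner"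
    using aut_in[OF V(2)] by (rule V_cases)
  obtain m s where b: "(m, s) \<in> inner" "dihedral \<epsilon> c (m, s) = (k', q')"
    using dihedral_surj[OF e i'(2), of c] by auto
  have "adj (v (dihedral \<epsilon> c (k, q))) (v (dihedral \<epsilon> c (m, s)))"
    using aut_adj[OF V] z(2) a(2) i'(1) b(2) by simp
  then have ad: "adj (v (k, q)) (v (m, s))" using adj_dihedral[OF e a(1) b(1)] by simp
  show ?thesis
  proof (cases "v (m, s) = v (l, r)")
    case True
    then have "m = l" "2 * N dvd s - r" using v_eq_iff b(1) z(1) by auto
    then show ?thesis using dihedral_cong[OF e, of m s r c] b z(1) i'(1) by simp
  next
    case False
    then have "\<phi> (v (m, s)) = \<phi> (v (l, r))" using others[OF b(1) ad] b(2) i'(1) by simp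
    then show ?thesis using False aut_eq_iff v_in_V b(1) z(1) by blast
  qed
qed

text \<open>Induction inwards from both ends at once: the neighbourhood of a suitable vertex near
  one end reaches exactly one vertex of the first unknown level near the other end, and
  \<open>aut_dihedral_step\<close> settles it.\<close>

lemma aut_dihedral:
  obtains \<epsilon> c where "\<epsilon> = 1 \<or> \<epsilon> = -1" "\<And>a. a \<in> inner \<Longrightarrow> \<phi> (v a) = v (dihedral \<epsilon> c a)"
proof -
  obtain \<epsilon> c where e: "\<epsilon> = 1 \<or> \<epsilon> = -1" and B: "\<And>p. \<phi> (v (bdry p)) = v (bdry (\<epsilon> * p + c))"
    by (rule aut_bdry_dihedral) blast
  let ?ok = "\<lambda>k q. \<phi> (v (k, q)) = v (dihedral \<epsilon> c (k, q))"
  have first: "?ok 1 q" if "(1, q) \<in> inner" for q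
  proof -
    have "odd q" using that by (simp add: inner_iff)
    then have "\<phi> (v (1, q)) = v (bdry (\<epsilon> * q + c))" using B[of q] by (simp add: bdry_def)
    moreover have "bdry (\<epsilon> * q + c) = dihedral \<epsilon> c (1, q)"
      using \<open>odd q\<close> e by (auto simp: bdry_def dihedral_def)
    ultimately show ?thesis by simp
  qed
  have last: "?ok N q" if "(N, q) \<in> inner" for q
  proof -
    have q: "even (q - N)" using that by (simp add: inner_iff)
    then have eq: "\<phi> (v (N, q)) = v (bdry (\<epsilon> * (q - N) + c))" using B[of "q - N"] by (simp add: bdry_def)
    have p: "dihedral \<epsilon> c (N, q) = (if even c then (N, \<epsilon> * q + c) else (1, \<epsilon> * q + c + N))"
      by (simp add: dihedral_def)
    have b: "bdry (\<epsilon> * (q - N) + c) = (if even c then (N, \<epsilon> * (q - N) + c + N) else (1, \<epsilon> * (q - N) + c))"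
      using q e by (auto simp: bdry_def)
    have d: "2 * N dvd \<epsilon> * (q - N) + c + N - (\<epsilon> * q + c)" "2 * N dvd \<epsilon> * (q - N) + c - (\<epsilon> * q + c + N)"
      using e by auto
    show ?thesis
      using v_cong[OF _ _ d(1)] v_cong[OF _ _ d(2)] bdry_inner[of "\<epsilon> * (q - N) + c"]
        dihedral_inner[OF e that, of c] unfolding eq p b by (cases "even c") simp_all
  qed
  have main: "\<forall>k q. (k, q) \<in> inner \<longrightarrow> k \<le> 1 + int j \<or> N - int j \<le> k \<longrightarrow> ?ok k q" for j
  proof (induction j)
    case 0
    show ?case
    proof (intro allI impI)
      fix k q assume "(k, q) \<in> inner" "k \<le> 1 + int 0 \<or> N - int 0 \<le> k"
      moreover from this have "k = 1 \<or> k = N" by (auto simp: inner_iff)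
      ultimately show "?ok k q" using first last by auto
    qed
  next
    case (Suc j)
    show ?case
    proof (intro allI impI)
      fix k q assume kq: "(k, q) \<in> inner" and kj: "k \<le> 1 + int (Suc j) \<or> N - int (Suc j) \<le> k"
      have "1 \<le> k" "k \<le> N" using kq by (auto simp: inner_iff)
      then consider "k \<le> 1 + int j \<or> N - int j \<le> k" | "k = 2 + int j" "k \<noteq> N" | "k = N - 1 - int j" "k \<noteq> 1"
        using kj unfolding of_nat_Suc by linarith
      then show "?ok k q"
      proof cases
        case 1
        then show ?thesis using Suc kq by blast
      next
        case 2
        \<comment> \<open>The neighbourhood of this vertex is centred at \<open>(k - 1, q)\<close>;
          its only member above level \<open>k - 1\<close> is \<open>(k, q)\<close>.\<close>
        let ?a = "(N + 1 - (k - 1), q + N)"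
        have a: "?a \<in> inner" using kq 2 by (auto simp: inner_iff)
        show ?thesis
        proof (rule aut_dihedral_step[OF e a])
          show "?ok (N + 1 - (k - 1)) (q + N)" using Suc a 2 by auto
          show "adj (v ?a) (v (k, q))" using adj_iff[OF a kq] by (simp add: incident_def)
          fix m s assume m: "(m, s) \<in> inner" "adj (v ?a) (v (m, s))" "v (m, s) \<noteq> v (k, q)"
          then have "incident (k - 1) (q + N + N) m s" using adj_iff[OF a m(1)] by simp
          moreover have "\<not> (m = k \<and> 2 * N dvd s - (q + N + N))"
            using m v_eq_iff[OF m(1) kq] dvd_shift[of "- (2 * N)" "s - (q + N + N)"] by (auto simp: algebra_simps)
          ultimately have "m \<le> 1 + int j" using 2(1) by (auto simp: incident_def)
          then show "?ok m s" using Suc m(1) by blast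
        qed (rule kq)
      next
        case 3
        let ?a = "(N + 1 - (k + 1), q + N)"
        have a: "?a \<in> inner" using kq 3 by (auto simp: inner_iff)
        show ?thesis
        proof (rule aut_dihedral_step[OF e a])
          show "?ok (N + 1 - (k + 1)) (q + N)" using Suc a 3 by auto
          show "adj (v ?a) (v (k, q))" using adj_iff[OF a kq] by (simp add: incident_def)
          fix m s assume m: "(m, s) \<in> inner" "adj (v ?a) (v (m, s))" "v (m, s) \<noteq> v (k, q)"
          have "N + 1 - (N + 1 - (k + 1)) = k + 1" by simp
          then have "incident (k + 1) (q + N + N) m s" using adj_iff[OF a m(1)] m(2) by (simp only:)
          moreover have "\<not> (m = k \<and> 2 * N dvd s - (q + N + N))"
            using m v_eq_iff[OF m(1) kq] dvd_shift[of "- (2 * N)" "s - (q + N + N)"] by (auto simp: algebra_simps)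
          ultimately have "N - int j \<le> m" using 3(1) by (auto simp: incident_def)
          then show "?ok m s" using Suc m(1) by blast
        qed (rule kq)
      qed
    qed
  qed
  have "?ok k q" if "(k, q) \<in> inner" for k q
    using main[of "nat N"] that N3 by (auto simp: inner_iff)
  then show ?thesis using that[OF e] by auto
qed

lemma aut_lab:
  assumes e: "\<epsilon> = 1 \<or> \<epsilon> = -1" and d: "\<And>a. a \<in> inner \<Longrightarrow> \<phi> (v a) = v (dihedral \<epsilon> c a)"
  shows "k = 1 \<or> k = N \<Longrightarrow> \<phi> ` ring k = ring (if even c then k else N + 1 - k)"
    and "a \<in> positions \<Longrightarrow> \<phi> ` lab a = lab (dihedral \<epsilon> c a)"
proof -
  show r: "\<phi> ` ring k = ring (if even c then k else N + 1 - k)" if k: "k = 1 \<or> k = N" for k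
  proof (intro subset_antisym subsetI)
    fix x assume "x \<in> \<phi> ` ring k"
    then obtain q where q: "x = \<phi> (v (k, q))" "even (k + q)" by (auto simp: ring_def)
    then have i: "(k, q) \<in> inner" using k N3 by (auto simp: inner_iff)
    then have "x = v (dihedral \<epsilon> c (k, q))" using d q(1) by simp
    then show "x \<in> ring (if even c then k else N + 1 - k)"
      using dihedral_inner[OF e i, of c] by (auto simp: dihedral_def ring_def inner_iff)
  next
    fix x assume "x \<in> ring (if even c then k else N + 1 - k)"
    then obtain q where q: "x = v (if even c then k else N + 1 - k, q)" "even ((if even c then k else N + 1 - k) + q)"
      by (auto simp: ring_def)
    then have "(if even c then k else N + 1 - k, q) \<in> inner" using k N3 by (auto simp: inner_iff)
    then obtain b where b: "b \<in> inner" "dihedral \<epsilon> c b = (if even c then k else N + 1 - k, q)"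
      using dihedral_surj[OF e] by blast
    then have "fst b = k" by (auto simp: dihedral_def split: if_splits)
    then have "v b \<in> ring k" using b(1) by (cases b) (auto simp: ring_def inner_iff)
    moreover have "x = \<phi> (v b)" using d b q(1) by simp
    ultimately show "x \<in> \<phi> ` ring k" by blast
  qed
  assume a: "a \<in> positions"
  show "\<phi> ` lab a = lab (dihedral \<epsilon> c a)"
  proof (cases "a \<in> inner")
    case True
    then show ?thesis using d[OF True] dihedral_inner[OF e True, of c] by (auto simp: lab_def inner_def)
  next
    case False
    then have "fst a = 0 \<or> fst a = N + 1" using a by (auto simp: inner_def positions_def)
    then show ?thesis using r[of 1] r[of N] N3 by (auto simp: lab_def dihedral_def)
  qed
qed

end

lemma aut_invariant_sphere: "aut_invariant V adj sphere"
proof (rule aut_invariantI)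
  have sub: "sphere \<subseteq> subdivided" using sphere_avoiding(1) by blast
  show "finite sphere" using finite_subset[OF sub finite_subdivided] .
  show "\<sigma> \<subseteq> Pow V" if "\<sigma> \<in> sphere" for \<sigma>
  proof -
    have r: "ring k \<subseteq> V" if "k = 1 \<or> k = N" for k
      using that N3 by (auto simp: ring_def V_eq inner_iff)
    have "lab a \<subseteq> V" if "a \<in> positions" for a
      using r[of 1] r[of N] that by (auto simp: lab_def V_eq inner_def positions_def)
    then show ?thesis using that sub subdivided_subset by blast
  qed
  fix \<phi> \<sigma> assume \<phi>: "graph_automorphism V adj \<phi>" and "\<sigma> \<in> sphere"
  then obtain T where T: "T \<in> triangles" "\<sigma> \<subseteq> lab ` T" by (auto simp: sphere_def)
  obtain \<epsilon> c where e: "\<epsilon> = 1 \<or> \<epsilon> = -1" and d: "\<And>a. a \<in> inner \<Longrightarrow> \<phi> (v a) = v (dihedral \<epsilon> c a)"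
    by (rule aut_dihedral[OF \<phi>]) blast
  have "induced_action \<phi> \<sigma> \<subseteq> (\<lambda>a. \<phi> ` lab a) ` T" using T(2) by (auto simp: induced_action_def)
  also have "\<dots> = lab ` dihedral \<epsilon> c ` T"
    unfolding image_image
    by (rule image_cong[OF refl]) (use aut_lab(2)[OF \<phi> e d] triangle_subset_positions[OF T(1)] in blast)
  finally show "induced_action \<phi> \<sigma> \<in> sphere"
    unfolding sphere_def using dihedral_triangles[OF e T(1)] by blast
qed

lemma aut_invariant_subdivided: "aut_invariant V adj subdivided"
proof (rule aut_invariantI)
  have r: "ring k \<subseteq> V" if "k = 1 \<or> k = N" for k
    using that N3 by (auto simp: ring_def V_eq inner_iff)
  show "finite subdivided" by (rule finite_subdivided)
  show "\<sigma> \<subseteq> Pow V" if "\<sigma> \<in> subdivided" for \<sigma>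
  proof -
    have "lab a \<subseteq> V" if "a \<in> positions" for a
      using r[of 1] r[of N] that by (auto simp: lab_def V_eq inner_def positions_def)
    then show ?thesis using that subdivided_subset by blast
  qed
  fix \<phi> \<sigma> assume \<phi>: "graph_automorphism V adj \<phi>" and \<sigma>: "\<sigma> \<in> subdivided"
  obtain \<epsilon> c where e: "\<epsilon> = 1 \<or> \<epsilon> = -1" and d: "\<And>a. a \<in> inner \<Longrightarrow> \<phi> (v a) = v (dihedral \<epsilon> c a)"
    by (rule aut_dihedral[OF \<phi>]) blast
  show "induced_action \<phi> \<sigma> \<in> subdivided" unfolding subdivided_def
  proof (rule induced_action_two_face_subdivision[where V = V])
    let ?K = "neighborhood_complex V adj"
    show "\<tau> \<subseteq> V" if "\<tau> \<in> ?K" for \<tau> using that by (simp add: neighborhood_complex_def)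
    show "inj_on \<phi> V" by (rule aut_inj[OF \<phi>])
    show "\<phi> ` \<tau> \<in> ?K" if "\<tau> \<in> ?K" for \<tau>
    proof -
      obtain x where x: "\<tau> \<subseteq> V" "x \<in> V" "\<forall>y\<in>\<tau>. adj x y" using \<open>\<tau> \<in> ?K\<close> by (auto simp: neighborhood_complex_def)
      then have "\<forall>y\<in>\<phi> ` \<tau>. adj (\<phi> x) y" using aut_adj[OF \<phi>] by blast
      then show ?thesis using x aut_in[OF \<phi>] by (auto simp: neighborhood_complex_def)
    qed
    show "ring 1 \<subseteq> V" "ring N \<subseteq> V" using r by auto
    show "\<phi> ` ring 1 = ring 1 \<and> \<phi> ` ring N = ring N \<or> \<phi> ` ring 1 = ring N \<and> \<phi> ` ring N = ring 1"
      using aut_lab(1)[OF \<phi> e d, of 1] aut_lab(1)[OF \<phi> e d, of N] by (cases "even c") simp_all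
    show "\<sigma> \<in> two_face_subdivision ?K (ring 1) (ring N)" using \<sigma> by (simp add: subdivided_def)
  qed
qed

end

subsection \<open>Stable sets\<close>

context levels begin

text \<open>Distance to \<open>0\<close> in the cycle of length \<open>2 N\<close>.\<close>

definition cyc :: "int \<Rightarrow> int" where
  "cyc x = \<bar>(x + N - 1) mod (2 * N) - (N - 1)\<bar>"

lemma cyc_shift [simp]: "cyc (x + 2 * N * j) = cyc x"
proof -
  have "x + 2 * N * j + N - 1 = (x + N - 1) + 2 * N * j" by simp
  then show ?thesis unfolding cyc_def by (simp only: mod_mult_self2)
qed

lemma cyc_abs: "\<bar>t\<bar> \<le> N \<Longrightarrow> cyc t = \<bar>t\<bar>"
proof (cases "t = - N")
  case True
  \<comment> \<open>\<open>- N\<close> is represented by \<open>N\<close>, as the chosen residues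
    satisfy \<open>- N < t \<le> N\<close>.\<close>
  have "(- 1) mod (2 * N) = 2 * N - 1" using N3 by (simp add: zmod_minus1)
  then show ?thesis using True N3 by (simp add: cyc_def)
next
  case False
  assume "\<bar>t\<bar> \<le> N"
  then have "(t + N - 1) mod (2 * N) = t + N - 1" using False N3 by (intro mod_pos_pos_trivial) auto
  then show ?thesis by (simp add: cyc_def)
qed

lemma cyc_cases:
  obtains t j where "x = t + 2 * N * j" "- N < t" "t \<le> N" "cyc x = \<bar>t\<bar>"
proof -
  define t where "t = (x + N - 1) mod (2 * N) - (N - 1)"
  have "x = t + 2 * N * ((x + N - 1) div (2 * N))"
    using mult_div_mod_eq[of "2 * N" "x + N - 1"] unfolding t_def by linarith
  moreover have "0 \<le> (x + N - 1) mod (2 * N)" "(x + N - 1) mod (2 * N) < 2 * N" using N3 by simp_all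
  then have "- N < t" "t \<le> N" by (auto simp: t_def)
  ultimately show ?thesis using that by (simp add: cyc_def t_def)
qed

lemma cyc_eq_min: "\<bar>x\<bar> \<le> 2 * N \<Longrightarrow> cyc x = min \<bar>x\<bar> (2 * N - \<bar>x\<bar>)"
proof -
  assume x: "\<bar>x\<bar> \<le> 2 * N"
  consider "\<bar>x\<bar> \<le> N" | "N < x" | "x < - N" by linarith
  then show ?thesis
  proof cases
    case 1
    then show ?thesis using cyc_abs by simp
  next
    case 2
    then have "cyc (x + 2 * N * (- 1)) = 2 * N - x" using x by (subst cyc_abs) auto
    then show ?thesis using 2 x N3 unfolding cyc_shift by simp
  next
    case 3
    then have "cyc (x + 2 * N * 1) = 2 * N + x" using x by (subst cyc_abs) auto
    then show ?thesis using 3 x N3 unfolding cyc_shift by simp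
  qed
qed

lemma cyc_nonneg: "0 \<le> cyc x" and cyc_le: "cyc x \<le> N"
  by (cases rule: cyc_cases[of x], simp)+

lemma even_cyc: "even (cyc x) \<longleftrightarrow> even x"
  by (cases rule: cyc_cases[of x]) auto

lemma cyc_eq_0_iff: "cyc x = 0 \<longleftrightarrow> 2 * N dvd x"
proof (cases rule: cyc_cases[of x])
  case (1 t j)
  have "2 * N dvd x \<longleftrightarrow> 2 * N dvd t" using 1(1) by (simp add: dvd_add_left_iff)
  also have "\<dots> \<longleftrightarrow> t = 0" using 1(2,3) dvd_imp_le_int[of t "2 * N"] by (cases "t = 0") auto
  finally show ?thesis using 1(4) by simp
qed

lemma cyc_succ: "\<bar>cyc (x + 1) - cyc x\<bar> \<le> 1"
proof (cases rule: cyc_cases[of x])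
  case (1 t j)
  have "cyc (x + 1) = cyc (t + 1)" using cyc_shift[of "t + 1" j] 1(1) by (simp add: algebra_simps)
  also have "\<dots> = min \<bar>t + 1\<bar> (2 * N - \<bar>t + 1\<bar>)" using 1(2,3) N3 by (intro cyc_eq_min) auto
  finally show ?thesis using 1(2,3,4) by auto
qed

lemma cyc_pred: "\<bar>cyc (x - 1) - cyc x\<bar> \<le> 1"
  using cyc_succ[of "x - 1"] by simp

lemma cyc_antipode: "cyc (x + N) = N - cyc x"
proof (cases rule: cyc_cases[of x])
  case (1 t j)
  have "cyc (x + N) = cyc (t + N)" using cyc_shift[of "t + N" j] 1(1) by (simp add: algebra_simps)
  also have "\<dots> = min \<bar>t + N\<bar> (2 * N - \<bar>t + N\<bar>)" using 1(2,3) N3 by (intro cyc_eq_min) auto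
  finally show ?thesis using 1(2,3,4) by auto
qed

text \<open>The arc of \<open>2 * k - 1\<close> elements centred at \<open>q\<close> contributes its
  even elements, the complementary arc its odd ones. For even \<open>k + q\<close> both arcs begin
  and end with elements that are left out, so no two consecutive elements are chosen, and the arcs
  contribute \<open>k - 1\<close> and \<open>N - k\<close> elements.\<close>

definition stab :: "int \<Rightarrow> int \<Rightarrow> int \<Rightarrow> bool" where
  "stab k q x \<longleftrightarrow> (even x \<longleftrightarrow> cyc (x - q) < k)"

text \<open>Three points are tested: the extreme point of the first ball on the side away from
  \<open>u\<close>, and the first points outside it on both sides.\<close>

lemma balls_equal:
  assumes k: "1 \<le> k" "k \<le> N" and l: "1 \<le> l" "l \<le> N" and u: "\<bar>u\<bar> \<le> N"
    and eq: "\<And>t. cyc t < k \<longleftrightarrow> cyc (t - u) < l"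
  shows "k = l \<and> u = 0"
proof (cases "0 \<le> u")
  case True
  have 1: "cyc (- (k - 1) - u) < l" using eq[of "- (k - 1)"] cyc_abs[of "- (k - 1)"] k by simp
  have 2: "l \<le> cyc (- k - u)" using eq[of "- k"] cyc_abs[of "- k"] k by simp
  have 3: "l \<le> cyc (k - u)" using eq[of k] cyc_abs[of k] k by simp
  show ?thesis using 1 2 3 cyc_eq_min[of "- (k - 1) - u"] cyc_eq_min[of "- k - u"] cyc_eq_min[of "k - u"]
    True u k l by (auto simp: min_def abs_if split: if_splits)
next
  case False
  have 1: "cyc ((k - 1) - u) < l" using eq[of "k - 1"] cyc_abs[of "k - 1"] k by simp
  have 2: "l \<le> cyc (k - u)" using eq[of k] cyc_abs[of k] k by simp
  have 3: "l \<le> cyc (- k - u)" using eq[of "- k"] cyc_abs[of "- k"] k by simp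
  show ?thesis using 1 2 3 cyc_eq_min[of "(k - 1) - u"] cyc_eq_min[of "- k - u"] cyc_eq_min[of "k - u"]
    False u k l by (auto simp: min_def abs_if split: if_splits)
qed

text \<open>For \<open>2 \<le> k \<le> N - 1\<close> the points \<open>k - 2\<close>,
  \<open>k + 1\<close> and their negatives, the ones of the right parity closest to the boundary of
  the ball, pin down \<open>l\<close> and \<open>u\<close>. For \<open>k = 1\<close> no point of the
  parity of \<open>k\<close> lies inside the ball, and for \<open>k = N\<close> none of the other
  parity outside it; this leaves \<open>u\<close> free on an end level.\<close>

lemma disjoint_balls_forward:
  assumes k: "1 \<le> k" "k \<le> N" and l: "1 \<le> l" "l \<le> N" and u: "\<bar>u\<bar> \<le> N" "odd (k + l + u)"
    and inside: "\<And>t. even (k + t) \<Longrightarrow> cyc t < k \<Longrightarrow> cyc (t - u) < l"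
    and outside: "\<And>t. odd (k + t) \<Longrightarrow> k \<le> cyc t \<Longrightarrow> l \<le> cyc (t - u)"
  shows "l = k \<and> (k = 1 \<or> k = N \<or> u = 1 \<or> u = -1) \<or> (l = k + 1 \<or> l = k - 1) \<and> u = 0"
proof -
  have not2: "\<not> (cyc (u + 1) = 0 \<and> cyc (u - 1) = 0)"
    using dvd_close[of "u + 1" "u - 1"] unfolding cyc_eq_0_iff by auto
  have u0: "cyc u = 0 \<Longrightarrow> u = 0" using cyc_abs[OF u(1)] by simp
  consider "k = 1" | "k = N" | "2 \<le> k" "k \<le> N - 1" using k by linarith
  then show ?thesis
  proof cases
    case 1
    show ?thesis
    proof (cases "l = 1")
      case False
      \<comment> \<open>As \<open>l > 1\<close>, an even point this close to \<open>u\<close> must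
        be \<open>0\<close> modulo the period; for odd \<open>u\<close> there would be two such
        points.\<close>
      have z: "cyc t = 0" if "even t" "cyc (t - u) \<le> 1" for t
        using outside[of t] that 1 False l cyc_nonneg[of t] by fastforce
      have e: "even u"
      proof (rule ccontr)
        assume "odd u"
        then show False using z[of "u + 1"] z[of "u - 1"] cyc_abs[of 1] cyc_abs[of "-1"] N3 not2 by simp
      qed
      then have "u = 0" using z[of u] cyc_abs[of 0] N3 u0 by simp
      moreover have "l \<le> 2" using outside[of 2] cyc_abs[of 2] 1 N3 \<open>u = 0\<close> by simp
      ultimately show ?thesis using False l 1 by auto
    qed (use 1 in simp)
  next
    case 2
    show ?thesis
    proof (cases "l = N")
      case False
      have z: "cyc t = N" if "even (N + t)" "N - 1 \<le> cyc (t - u)" for t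
        using inside[of t] that 2 False l cyc_le[of t] by fastforce
      have z0: "cyc (t - N) = 0" if "even (N + t)" "N - 1 \<le> cyc (t - u)" for t
        using cyc_antipode[of "t - N"] z[OF that] by simp
      have an: "cyc N = N" "cyc (N + 1) = N - 1" "cyc (N - 1) = N - 1"
        using cyc_abs[of N] cyc_abs[of "N - 1"] cyc_antipode[of 1] cyc_abs[of 1] N3 by (auto simp: add.commute)
      have e: "even u"
      proof (rule ccontr)
        assume "odd u"
        then show False using z0[of "u + N + 1"] z0[of "u + N - 1"] an not2 by simp
      qed
      then have "u = 0" using z0[of "u + N"] an u0 by simp
      moreover have "N - 2 < l" using inside[of "N - 2"] cyc_abs[of "N - 2"] 2 N3 \<open>u = 0\<close> by simp
      ultimately show ?thesis using False l 2 by auto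
    qed (use 2 in simp)
  next
    case 3
    have i1: "cyc (k - 2 - u) < l" using inside[of "k - 2"] cyc_abs[of "k - 2"] 3 by simp
    have i2: "cyc (- (k - 2) - u) < l" using inside[of "- (k - 2)"] cyc_abs[of "- (k - 2)"] 3 by simp
    have o1: "l \<le> cyc (k + 1 - u)" using outside[of "k + 1"] cyc_abs[of "k + 1"] 3 by simp
    have o2: "l \<le> cyc (- (k + 1) - u)" using outside[of "- (k + 1)"] cyc_abs[of "- (k + 1)"] 3 by simp
    have p: "l = k \<Longrightarrow> odd u" "u = 0 \<Longrightarrow> l \<noteq> k" using u(2) by auto
    have m1: "cyc (k + 1 - u) = min \<bar>k + 1 - u\<bar> (2 * N - \<bar>k + 1 - u\<bar>)" using 3 u(1) by (intro cyc_eq_min) auto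
    have m2: "cyc (- (k + 1) - u) = min \<bar>- (k + 1) - u\<bar> (2 * N - \<bar>- (k + 1) - u\<bar>)" using 3 u(1) by (intro cyc_eq_min) auto
    have m3: "cyc (k - 2 - u) = min \<bar>k - 2 - u\<bar> (2 * N - \<bar>k - 2 - u\<bar>)" using 3 u(1) by (intro cyc_eq_min) auto
    have m4: "cyc (- (k - 2) - u) = min \<bar>- (k - 2) - u\<bar> (2 * N - \<bar>- (k - 2) - u\<bar>)" using 3 u(1) by (intro cyc_eq_min) auto
    have "(u = 0 \<and> k - 1 \<le> l \<and> l \<le> k + 1) \<or> (u = 1 \<and> l = k) \<or> (u = -1 \<and> l = k)"
    proof (cases "0 \<le> u")
      case True
      have a: "\<bar>- (k + 1) - u\<bar> = k + 1 + u" "\<bar>- (k - 2) - u\<bar> = k - 2 + u" using 3 True by auto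
      have "k - 1 + u \<le> l" using i2 o2 unfolding m2 m4 a by linarith
      then show ?thesis using o1 True 3 unfolding m1 by linarith
    next
      case False
      have a: "\<bar>k + 1 - u\<bar> = k + 1 - u" "\<bar>k - 2 - u\<bar> = k - 2 - u" using 3 False by auto
      have "k - 1 - u \<le> l" using i1 o1 unfolding m1 m3 a by linarith
      then show ?thesis using o2 False 3 unfolding m2 by linarith
    qed
    then show ?thesis using p by auto
  qed
qed

text \<open>Parity gains one step: points of the parity of \<open>k\<close> inside the ball have
  distance at most \<open>k - 2\<close>, points of the other parity outside it at least
  \<open>k + 1\<close>. This absorbs a change of the centre or of the radius by one.\<close>

lemma disjoint_balls_backward:
  assumes k: "1 \<le> k" "k \<le> N" and u: "odd (k + l + u)"
    and inc: "l = k \<and> (k = 1 \<or> k = N \<or> u = 1 \<or> u = -1) \<or> (l = k + 1 \<or> l = k - 1) \<and> u = 0"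
  shows "even (k + t) \<Longrightarrow> cyc t < k \<Longrightarrow> cyc (t - u) < l"
    and "odd (k + t) \<Longrightarrow> k \<le> cyc t \<Longrightarrow> l \<le> cyc (t - u)"
proof -
  have s: "\<bar>cyc (t - 1) - cyc t\<bar> \<le> 1" "\<bar>cyc (t + 1) - cyc t\<bar> \<le> 1" using cyc_pred cyc_succ by auto
  have par: "even (cyc t) \<longleftrightarrow> even t" "even (cyc (t - u)) \<longleftrightarrow> even (t - u)" by (rule even_cyc)+
  consider "l = k" "k = 1" | "l = k" "k = N" | "l = k" "u = 1" | "l = k" "u = -1"
    | "l = k + 1" "u = 0" | "l = k - 1" "u = 0" using inc by blast
  note C = this
  show "cyc (t - u) < l" if t: "even (k + t)" "cyc t < k"
  proof -
    have "cyc t \<noteq> k - 1" using par(1) t(1) by auto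
    then have lt: "cyc t \<le> k - 2" using t(2) by simp
    from C show ?thesis
    proof cases
      case 1
      then show ?thesis using lt cyc_nonneg[of t] by simp
    next
      case 2
      have "cyc (t - u) \<noteq> N" using par(2) t(1) u 2 by auto
      then show ?thesis using cyc_le[of "t - u"] 2 by simp
    qed (use lt s in auto)
  qed
  show "l \<le> cyc (t - u)" if t: "odd (k + t)" "k \<le> cyc t"
  proof -
    have "cyc t \<noteq> k" using par(1) t(1) by auto
    then have gt: "k + 1 \<le> cyc t" using t(2) by simp
    from C show ?thesis
    proof cases
      case 1
      have "cyc (t - u) \<noteq> 0" using par(2) t(1) u 1 by auto
      then show ?thesis using cyc_nonneg[of "t - u"] 1 by simp
    next
      case 2
      then show ?thesis using gt cyc_le[of t] by simp
    qed (use gt s in auto)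
  qed
qed

lemma stab_opposite: "stab k q (q + N + t) \<longleftrightarrow> (even (q + N + t) \<longleftrightarrow> N + 1 - k \<le> cyc t)"
  using cyc_antipode[of t] by (auto simp: stab_def add.commute)

text \<open>Seen from the antipode \<open>q + N\<close>, the first set takes its odd elements inside
  the ball of radius \<open>h\<close> and its even ones outside; the second does the reverse with
  its own ball. Disjointness thus says that the two balls agree up to parity, which
  \<open>disjoint_balls_forward\<close> and \<open>disjoint_balls_backward\<close> evaluate.\<close>

lemma stab_disjoint_iff:
  assumes a: "(k, q) \<in> inner" and b: "(l, r) \<in> inner"
  shows "(\<forall>x. \<not> (stab k q x \<and> stab l r x)) \<longleftrightarrow> incident (N + 1 - k) (q + N) l r"
proof -
  obtain u j where u: "r - (q + N) = u + 2 * N * j" "- N < u" "u \<le> N"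
    by (rule cyc_cases[of "r - (q + N)"])
  define h where "h = N + 1 - k"
  have h: "1 \<le> h" "h \<le> N" and l: "1 \<le> l" "l \<le> N" using a b by (auto simp: h_def inner_def)
  have hlu: "h + l + u = (l + r) - (k + q) + 1 - 2 * (N * j)" using u(1) by (simp add: h_def algebra_simps)
  have par: "odd (q + N + h)" "odd (h + l + u)"
    using a b unfolding hlu by (simp_all add: h_def inner_def)
  have S2: "stab l r (q + N + t) \<longleftrightarrow> (even (q + N + t) \<longleftrightarrow> cyc (t - u) < l)" for t
  proof -
    have "q + N + t - r = t - u + 2 * N * (- j)" using u(1) by (simp add: algebra_simps)
    then show ?thesis unfolding stab_def by (simp only: cyc_shift)
  qed
  have "(\<forall>x. \<not> (stab k q x \<and> stab l r x)) \<longleftrightarrow> (\<forall>t. \<not> (stab k q (q + N + t) \<and> stab l r (q + N + t)))"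
    by (metis add_diff_cancel_left' add_diff_eq diff_add_cancel add.commute)
  also have "\<dots> \<longleftrightarrow> (\<forall>t. (even (h + t) \<longrightarrow> cyc t < h \<longrightarrow> cyc (t - u) < l) \<and> (odd (h + t) \<longrightarrow> h \<le> cyc t \<longrightarrow> l \<le> cyc (t - u)))"
  proof -
    have "even (q + N + t) \<longleftrightarrow> odd (h + t)" for t using par(1) by auto
    then show ?thesis unfolding stab_opposite S2 h_def[symmetric] by (metis not_less)
  qed
  also have "\<dots> \<longleftrightarrow> l = h \<and> (h = 1 \<or> h = N \<or> u = 1 \<or> u = -1) \<or> (l = h + 1 \<or> l = h - 1) \<and> u = 0"
    using disjoint_balls_forward[OF h l _ par(2)] disjoint_balls_backward[OF h par(2)] u(2,3) by auto
  also have "\<dots> \<longleftrightarrow> incident h (q + N) l r"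
  proof -
    have D: "2 * N dvd r - (q + N + c) \<longleftrightarrow> u = c" if "\<bar>c\<bar> \<le> 1" for c
    proof -
      have "r - (q + N + c) = (u - c) + 2 * N * j" using u(1) by simp
      then have "2 * N dvd r - (q + N + c) \<longleftrightarrow> cyc (u - c) = 0" using cyc_eq_0_iff cyc_shift by metis
      also have "\<dots> \<longleftrightarrow> u = c" using cyc_eq_min[of "u - c"] u(2,3) that N3 by auto
      finally show ?thesis .
    qed
    show ?thesis using D[of 0] D[of 1] D[of "-1"] unfolding incident_def by auto
  qed
  finally show ?thesis by (simp add: h_def)
qed

lemma stab_eq_iff:
  assumes a: "(k, q) \<in> inner" and b: "(l, r) \<in> inner"
  shows "(\<forall>x. stab k q x \<longleftrightarrow> stab l r x) \<longleftrightarrow> k = l \<and> 2 * N dvd q - r"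
proof
  assume "k = l \<and> 2 * N dvd q - r"
  then obtain j where "k = l" "q = r + 2 * N * j" by (metis add.commute diff_add_cancel dvd_def)
  then have "x - r = x - q + 2 * N * j" for x by simp
  then show "\<forall>x. stab k q x \<longleftrightarrow> stab l r x" unfolding stab_def \<open>k = l\<close> by (metis cyc_shift)
next
  assume eq: "\<forall>x. stab k q x \<longleftrightarrow> stab l r x"
  obtain u j where u: "r - q = u + 2 * N * j" "- N < u" "u \<le> N" by (rule cyc_cases[of "r - q"])
  have "cyc t < k \<longleftrightarrow> cyc (t - u) < l" for t
  proof -
    have "q + t - r = t - u + 2 * N * (- j)" using u(1) by (simp add: algebra_simps)
    then have "cyc (q + t - r) = cyc (t - u)" by (simp only: cyc_shift)
    then show ?thesis using eq[rule_format, of "q + t"] unfolding stab_def by auto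
  qed
  then have "k = l \<and> u = 0" using balls_equal[of k l u] a b u by (auto simp: inner_def)
  then have "q - r = 2 * N * (- j)" using u(1) by simp
  then show "k = l \<and> 2 * N dvd q - r" using \<open>k = l \<and> u = 0\<close> by simp
qed

text \<open>Of two consecutive members one would be an even element of the ball and the other an odd
  one outside. That puts an even element at distance \<open>k - 1\<close> from \<open>q\<close>,
  impossible for even \<open>k + q\<close>.\<close>

lemma stab_stable: "(k, q) \<in> inner \<Longrightarrow> \<not> (stab k q x \<and> stab k q (x + 1))"
proof -
  assume "(k, q) \<in> inner"
  then have "even (k + q)" by (simp add: inner_def)
  moreover have "\<bar>cyc (x - q + 1) - cyc (x - q)\<bar> \<le> 1" by (rule cyc_succ)
  moreover have "even (cyc (x - q)) \<longleftrightarrow> even (x - q)" by (rule even_cyc)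
  moreover have "even (cyc (x - q + 1)) \<longleftrightarrow> even (x - q + 1)" by (rule even_cyc)
  moreover have "x + 1 - q = x - q + 1" by simp
  ultimately show ?thesis unfolding stab_def by (smt (verit) even_add odd_one)
qed

text \<open>The set alternates on each of its two arcs, so two consecutive non-members occur only
  where the arcs meet: from \<open>q - k\<close> to \<open>q - k + 1\<close> and from
  \<open>q + k - 1\<close> to \<open>q + k\<close>. By \<open>card_stable\<close> the number of
  these gaps determines the cardinality.\<close>

lemma stab_gap_iff:
  assumes "(k, q) \<in> inner"
  shows "\<not> stab k q x \<and> \<not> stab k q (x + 1) \<longleftrightarrow> 2 * N dvd x - (q - k) \<or> 2 * N dvd x - (q + k - 1)"
proof -
  have k: "1 \<le> k" "k \<le> N" "even (k + q)" using assms by (auto simp: inner_def)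
  obtain t j where t: "x - q = t + 2 * N * j" "- N < t" "t \<le> N" "cyc (x - q) = \<bar>t\<bar>" by (rule cyc_cases[of "x - q"])
  have c1: "cyc (x + 1 - q) = min \<bar>t + 1\<bar> (2 * N - \<bar>t + 1\<bar>)"
  proof -
    have "x + 1 - q = t + 1 + 2 * N * j" using t(1) by simp
    then have "cyc (x + 1 - q) = cyc (t + 1)" by (simp only: cyc_shift)
    then show ?thesis using cyc_eq_min[of "t + 1"] t(2,3) N3 by simp
  qed
  have D: "2 * N dvd x - (q + c) \<longleftrightarrow> t = c \<or> t = c + 2 * N" if "- N \<le> c" "c \<le> N - 1" for c
  proof -
    have "x - (q + c) = (t - c) + 2 * N * j" using t(1) by simp
    then have "2 * N dvd x - (q + c) \<longleftrightarrow> cyc (t - c) = 0" using cyc_eq_0_iff cyc_shift by metis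
    also have "\<dots> \<longleftrightarrow> t = c \<or> t = c + 2 * N" using cyc_eq_min[of "t - c"] t(2,3) that N3 by auto
    finally show ?thesis .
  qed
  have ev: "even x \<longleftrightarrow> even (k + t)"
  proof -
    have "x = q + t + 2 * (N * j)" using t(1) by simp
    then show ?thesis using k(3) by auto
  qed
  have "\<not> stab k q x \<and> \<not> stab k q (x + 1) \<longleftrightarrow>
      (even (k + t) \<and> k \<le> \<bar>t\<bar> \<and> min \<bar>t + 1\<bar> (2 * N - \<bar>t + 1\<bar>) < k \<or>
       odd (k + t) \<and> \<bar>t\<bar> < k \<and> k \<le> min \<bar>t + 1\<bar> (2 * N - \<bar>t + 1\<bar>))"
    unfolding stab_def c1 t(4) using ev by auto
  also have "\<dots> \<longleftrightarrow> t = - k \<or> t = - k + 2 * N \<or> t = k - 1 \<or> t = k - 1 + 2 * N"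
  proof -
    have par: "even (k + t) \<Longrightarrow> t \<noteq> k - 1" "odd (k + t) \<Longrightarrow> t \<noteq> - k" "odd (k + t) \<Longrightarrow> t \<noteq> k"
      "odd (k + t) \<Longrightarrow> t \<noteq> - k + 2 * N" by auto
    consider "t < 0" | "0 \<le> t" "t < N" | "t = N" using t(3) by linarith
    then show ?thesis
    proof cases
      case 1
      then have "\<bar>t\<bar> = - t" "min \<bar>t + 1\<bar> (2 * N - \<bar>t + 1\<bar>) = - t - 1" using t(2) by auto
      then show ?thesis using par k 1 t(2) by (cases "even (k + t)") auto
    next
      case 2
      then have "\<bar>t\<bar> = t" "min \<bar>t + 1\<bar> (2 * N - \<bar>t + 1\<bar>) = t + 1" by auto
      then show ?thesis using par k 2 by (cases "even (k + t)") auto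
    next
      case 3
      then have "\<bar>t\<bar> = N" "min \<bar>t + 1\<bar> (2 * N - \<bar>t + 1\<bar>) = N - 1" using N3 by auto
      then show ?thesis using par k 3 by (cases "even (k + t)") auto
    qed
  qed
  finally show ?thesis using D[of "- k"] D[of "k - 1"] k(1,2) unfolding add_diff_eq by auto
qed

text \<open>Membership of the element \<open>x + 1\<close> modulo \<open>2 N\<close>: the paper numbers the cycle from \<open>1\<close>.\<close>

definition mem :: "nat set \<Rightarrow> int \<Rightarrow> bool" where
  "mem A x \<longleftrightarrow> nat (x mod (2 * N)) + 1 \<in> A"

definition vert :: "int \<times> int \<Rightarrow> nat set" where
  "vert a = {y. 1 \<le> y \<and> y \<le> nat (2 * N) \<and> stab (fst a) (snd a) (int y - 1)}"

section \<open>Stable subsets of the cycle in coordinates\<close>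

abbreviation rank :: nat where "rank \<equiv> nat (N - 1)"

lemma rank_eq: "2 * rank + 2 = nat (2 * N)" "2 * rank + 1 = nat (2 * N - 1)"
  using N3 by simp_all

lemma mod_range: "0 \<le> x mod (2 * N)" "x mod (2 * N) < 2 * N"
  using N3 by simp_all

lemma stab_mod: "stab k q (x mod (2 * N)) \<longleftrightarrow> stab k q x"
proof -
  have "x = x mod (2 * N) + 2 * N * (x div (2 * N))" by simp
  then have "x - q = x mod (2 * N) - q + 2 * N * (x div (2 * N))" by linarith
  then have "cyc (x - q) = cyc (x mod (2 * N) - q)" by (metis cyc_shift)
  moreover have "even (x mod (2 * N)) \<longleftrightarrow> even x" by (simp add: dvd_mod_iff)
  ultimately show ?thesis by (simp add: stab_def)
qed

lemma mem_vert: "mem (vert (k, q)) x \<longleftrightarrow> stab k q x"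
proof -
  have "nat (x mod (2 * N)) + 1 \<le> nat (2 * N)" using mod_range[of x] by linarith
  then show ?thesis using stab_mod[of k q x] mod_range[of x] by (simp add: mem_def vert_def)
qed

lemma mem_mod: "mem A (x mod (2 * N)) \<longleftrightarrow> mem A x"
  by (simp add: mem_def)

lemma mem_pred: "1 \<le> y \<Longrightarrow> y \<le> nat (2 * N) \<Longrightarrow> mem A (int y - 1) \<longleftrightarrow> y \<in> A"
proof -
  assume y: "1 \<le> y" "y \<le> nat (2 * N)"
  then have "(int y - 1) mod (2 * N) = int y - 1" by (intro mod_pos_pos_trivial) auto
  moreover have "nat (int y - 1) + 1 = y" using y by linarith
  ultimately show ?thesis by (simp add: mem_def)
qed

lemma mem_disjoint_iff:
  assumes "A \<subseteq> {1..nat (2 * N)}" "B \<subseteq> {1..nat (2 * N)}"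
  shows "A \<inter> B = {} \<longleftrightarrow> (\<forall>x. \<not> (mem A x \<and> mem B x))"
proof
  assume *: "\<forall>x. \<not> (mem A x \<and> mem B x)"
  have False if y: "y \<in> A" "y \<in> B" for y
    using *[rule_format, of "int y - 1"] mem_pred[of y] assms y by auto
  then show "A \<inter> B = {}" by blast
qed (auto simp: mem_def)

lemma mem_eq_iff:
  assumes "A \<subseteq> {1..nat (2 * N)}" "B \<subseteq> {1..nat (2 * N)}"
  shows "A = B \<longleftrightarrow> (\<forall>x. mem A x \<longleftrightarrow> mem B x)"
proof
  assume *: "\<forall>x. mem A x \<longleftrightarrow> mem B x"
  have "y \<in> A \<longleftrightarrow> y \<in> B" if y: "y \<in> {1..nat (2 * N)}" for y
    using *[rule_format, of "int y - 1"] mem_pred[of y] y by auto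
  then show "A = B" using assms by blast
qed simp

lemma mem_stable_iff:
  assumes A: "A \<subseteq> {1..nat (2 * N)}"
  shows "(\<forall>i\<in>{1..nat (2 * N - 1)}. \<not> {i, i + 1} \<subseteq> A) \<and> \<not> {1, nat (2 * N)} \<subseteq> A \<longleftrightarrow>
    (\<forall>x. \<not> (mem A x \<and> mem A (x + 1)))"
proof
  assume *: "(\<forall>i\<in>{1..nat (2 * N - 1)}. \<not> {i, i + 1} \<subseteq> A) \<and> \<not> {1, nat (2 * N)} \<subseteq> A"
  show "\<forall>x. \<not> (mem A x \<and> mem A (x + 1))"
  proof
    fix x
    have step: "(x + 1) mod (2 * N) = (x mod (2 * N) + 1) mod (2 * N)" by (simp add: mod_add_left_eq)
    show "\<not> (mem A x \<and> mem A (x + 1))"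
    proof (cases "x mod (2 * N) = 2 * N - 1")
      case True
      then have "(x + 1) mod (2 * N) = 0" using step by simp
      then have "mem A (x + 1) \<longleftrightarrow> 1 \<in> A" "mem A x \<longleftrightarrow> nat (2 * N) \<in> A"
        using True N3 by (simp_all add: mem_def nat_diff_distrib)
      then show ?thesis using * by blast
    next
      case False
      let ?i = "nat (x mod (2 * N)) + 1"
      have "(x + 1) mod (2 * N) = x mod (2 * N) + 1"
        using step False mod_range[of x] by (simp add: mod_pos_pos_trivial)
      then have "mem A (x + 1) \<longleftrightarrow> ?i + 1 \<in> A" using mod_range(1)[of x] by (simp add: mem_def nat_add_distrib)
      moreover have "?i \<in> {1..nat (2 * N - 1)}" using False mod_range[of x] by auto
      ultimately show ?thesis using * by (auto simp: mem_def)
    qed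
  qed
next
  assume *: "\<forall>x. \<not> (mem A x \<and> mem A (x + 1))"
  have "\<not> {i, i + 1} \<subseteq> A" if i: "i \<in> {1..nat (2 * N - 1)}" for i
  proof -
    have "mem A (int i - 1) \<longleftrightarrow> i \<in> A" by (rule mem_pred) (use i in auto)
    moreover have "mem A (int (i + 1) - 1) \<longleftrightarrow> i + 1 \<in> A" by (rule mem_pred) (use i in auto)
    ultimately show ?thesis using *[rule_format, of "int i - 1"] by simp
  qed
  moreover have "\<not> {1, nat (2 * N)} \<subseteq> A"
  proof -
    have "int (nat (2 * N)) - 1 = 2 * N - 1" using N3 by simp
    then have "mem A (2 * N - 1) \<longleftrightarrow> nat (2 * N) \<in> A" using mem_pred[of "nat (2 * N)" A] N3 by simp
    moreover have "mem A (2 * N - 1 + 1) \<longleftrightarrow> 1 \<in> A" by (simp add: mem_def)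
    moreover note *[rule_format, of "2 * N - 1"]
    ultimately show ?thesis by blast
  qed
  ultimately show "(\<forall>i\<in>{1..nat (2 * N - 1)}. \<not> {i, i + 1} \<subseteq> A) \<and> \<not> {1, nat (2 * N)} \<subseteq> A" by blast
qed

lemma SG_vertices_iff:
  "A \<in> SG_vertices rank \<longleftrightarrow> A \<subseteq> {1..nat (2 * N)} \<and> card A = rank \<and> (\<forall>x. \<not> (mem A x \<and> mem A (x + 1)))"
  unfolding SG_vertices_def rank_eq using mem_stable_iff by blast

lemma card_mem:
  assumes "A \<subseteq> {1..nat (2 * N)}"
  shows "card A = card {x\<in>{0..<2 * N}. mem A x}"
proof -
  have "bij_betw (\<lambda>y. int y - 1) A {x\<in>{0..<2 * N}. mem A x}"
  proof (rule bij_betw_byWitness[where f' = "\<lambda>x. nat x + 1"])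
    show "(\<lambda>y. int y - 1) ` A \<subseteq> {x\<in>{0..<2 * N}. mem A x}"
      using assms mem_pred[of _ A] by (auto; force)
    show "(\<lambda>x. nat x + 1) ` {x\<in>{0..<2 * N}. mem A x} \<subseteq> A" by (auto simp: mem_def)
    show "\<forall>a\<in>A. nat (int a - 1) + 1 = a" using assms by fastforce
  qed auto
  then show ?thesis by (rule bij_betw_same_card)
qed

text \<open>Members, predecessors of members and gaps partition the cycle, and the shift by one is a
  bijection between the first two kinds. So a stable set has \<open>N - 1\<close> elements exactly
  if it has two gaps.\<close>

lemma card_stable:
  assumes per: "\<And>x. a (x mod (2 * N)) \<longleftrightarrow> a x" and st: "\<And>x. \<not> (a x \<and> a (x + 1))"
  shows "2 * int (card {x\<in>{0..<2 * N}. a x}) + int (card {x\<in>{0..<2 * N}. \<not> a x \<and> \<not> a (x + 1)}) = 2 * N"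
proof -
  let ?I = "{0..<2 * N}"
  let ?P = "{x\<in>?I. a x}" and ?Q = "{x\<in>?I. a (x + 1)}" and ?E = "{x\<in>?I. \<not> a x \<and> \<not> a (x + 1)}"
  have inv: "((x + 1) mod (2 * N) - 1) mod (2 * N) = x" "((x - 1) mod (2 * N) + 1) mod (2 * N) = x" if "x \<in> ?I" for x
    using that by (simp_all add: mod_diff_left_eq mod_add_left_eq)
  have "bij_betw (\<lambda>x. (x + 1) mod (2 * N)) ?Q ?P"
  proof (rule bij_betw_byWitness[where f' = "\<lambda>x. (x - 1) mod (2 * N)"])
    show "(\<lambda>x. (x + 1) mod (2 * N)) ` ?Q \<subseteq> ?P" using per mod_range by auto
    have "a ((x - 1) mod (2 * N) + 1) \<longleftrightarrow> a x" if "x \<in> ?I" for x using per inv(2)[OF that] by metis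
    then show "(\<lambda>x. (x - 1) mod (2 * N)) ` ?P \<subseteq> ?Q" using mod_range by auto
  qed (use inv in auto)
  then have "card ?Q = card ?P" by (rule bij_betw_same_card)
  moreover have "card (?P \<union> ?Q \<union> ?E) = card ?P + card ?Q + card ?E"
  proof -
    have fin: "finite {x\<in>?I. R x}" for R by (rule finite_subset[of _ ?I]) auto
    have "card (?P \<union> ?Q \<union> ?E) = card (?P \<union> ?Q) + card ?E"
      by (rule card_Un_disjoint[OF finite_UnI[OF fin fin] fin]) blast
    moreover have "card (?P \<union> ?Q) = card ?P + card ?Q"
      by (rule card_Un_disjoint[OF fin fin]) (use st in blast)
    ultimately show ?thesis by simp
  qed
  moreover have "?P \<union> ?Q \<union> ?E = ?I" by blast
  ultimately show ?thesis using N3 by simp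
qed

lemma vert_in_SG_vertices:
  assumes "(k, q) \<in> inner"
  shows "vert (k, q) \<in> SG_vertices rank"
proof -
  have sub: "vert (k, q) \<subseteq> {1..nat (2 * N)}" by (auto simp: vert_def)
  let ?x = "(q - k) mod (2 * N)" and ?y = "(q + k - 1) mod (2 * N)"
  have cong: "2 * N dvd x - c \<longleftrightarrow> x = c mod (2 * N)" if "x \<in> {0..<2 * N}" for x c
  proof -
    have "x mod (2 * N) = x" using that by simp
    then show ?thesis using mod_eq_dvd_iff[of x "2 * N" c] by simp
  qed
  have "{x\<in>{0..<2 * N}. \<not> stab k q x \<and> \<not> stab k q (x + 1)} = {?x, ?y}"
    using cong mod_range unfolding stab_gap_iff[OF assms] by auto
  moreover have "?x \<noteq> ?y"
  proof
    assume "?x = ?y"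
    then have "2 * N dvd (q - k) - (q + k - 1)" by (simp only: mod_eq_dvd_iff)
    then have "even ((q - k) - (q + k - 1))" by (metis dvd_trans dvd_triv_left)
    then show False by simp
  qed
  ultimately have "card {x\<in>{0..<2 * N}. \<not> stab k q x \<and> \<not> stab k q (x + 1)} = 2" by simp
  then have "2 * int (card {x\<in>{0..<2 * N}. stab k q x}) + 2 = 2 * N"
    using card_stable[of "stab k q"] stab_mod stab_stable[OF assms] by simp
  then have "card (vert (k, q)) = rank" using card_mem[OF sub] by (simp add: mem_vert)
  then show ?thesis using sub stab_stable[OF assms] by (simp add: SG_vertices_iff mem_vert)
qed

text \<open>\<open>e\<close> and \<open>f\<close> are the first elements of the two gaps. Members on
  the arc from \<open>e + 1\<close> to \<open>f\<close> are even, those on the other arc odd, so the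
  first arc has \<open>2 * k - 1\<close> elements and its midpoint \<open>(e + f + 1) div 2\<close>
  is the centre.\<close>

lemma alternating_is_stab:
  assumes e: "even e" and f: "odd (f - e)" "e < f" "f < e + 2 * N"
    and 1: "\<And>t. 1 \<le> t \<Longrightarrow> t \<le> f - e \<Longrightarrow> a (e + t) \<longleftrightarrow> even t"
    and 2: "\<And>t. 1 \<le> t \<Longrightarrow> t \<le> e + 2 * N - f \<Longrightarrow> a (f + t) \<longleftrightarrow> even t"
    and per: "\<And>x. a (x mod (2 * N)) \<longleftrightarrow> a x"
  shows "\<exists>(k, q)\<in>inner. \<forall>x. a x \<longleftrightarrow> stab k q x"
proof -
  define k where "k = (f - e + 1) div 2"
  define q where "q = (e + f + 1) div 2"
  have k: "2 * k = f - e + 1" using f(1) unfolding k_def by presburger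
  have q: "q = e + k" using k unfolding q_def k_def by presburger
  have kq: "(k, q) \<in> inner" using k q e f by (auto simp: inner_def)
  have "a x \<longleftrightarrow> stab k q x" for x
  proof -
    define t where "t = (x - e - 1) mod (2 * N) + 1"
    have t: "1 \<le> t" "t \<le> 2 * N" using mod_range[of "x - e - 1"] by (auto simp: t_def)
    have "(e + t) mod (2 * N) = (e + 1 + (x - e - 1) mod (2 * N)) mod (2 * N)" by (simp add: t_def algebra_simps)
    also have "\<dots> = x mod (2 * N)" by (simp add: mod_add_right_eq)
    finally have x: "(e + t) mod (2 * N) = x mod (2 * N)" .
    have "a x \<longleftrightarrow> a (e + t)" using per x by metis
    moreover have "stab k q x \<longleftrightarrow> stab k q (e + t)" using stab_mod x by metis
    moreover have "a (e + t) \<longleftrightarrow> stab k q (e + t)"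
    proof (cases "t \<le> f - e")
      case True
      have "cyc (e + t - q) < k" using cyc_eq_min[of "e + t - q"] True t k q f by auto
      then show ?thesis using 1[OF t(1) True] e by (simp add: stab_def)
    next
      case False
      have eq: "f + (t - (f - e)) = e + t" by simp
      have "a (e + t) \<longleftrightarrow> even (t - (f - e))"
        by (rule 2[of "t - (f - e)", unfolded eq]) (use False t in auto)
      moreover have "\<not> cyc (e + t - q) < k" using cyc_eq_min[of "e + t - q"] False t k q f by auto
      ultimately show ?thesis using f(1) e by (simp add: stab_def)
    qed
    ultimately show ?thesis by simp
  qed
  then show ?thesis using kq by blast
qed

lemma alternates:
  assumes "\<And>x. i < x \<Longrightarrow> x < j \<Longrightarrow> a (x + 1) \<longleftrightarrow> \<not> a x" and "\<not> a (i + 1)"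
    and "1 \<le> t" "t \<le> j - i"
  shows "a (i + t) \<longleftrightarrow> even (t :: int)"
proof -
  have "int n + 1 \<le> j - i \<Longrightarrow> a (i + (int n + 1)) \<longleftrightarrow> even (int n + 1)" for n
  proof (induction n)
    case (Suc n)
    then have "a (i + (int n + 1) + 1) \<longleftrightarrow> \<not> a (i + (int n + 1))" by (intro assms(1)) auto
    then show ?case using Suc by (simp add: algebra_simps)
  qed (use assms(2) in simp)
  from this[of "nat (t - 1)"] show ?thesis using assms(3,4) by simp
qed

lemma SG_vertices_eq: "SG_vertices rank = vert ` inner"
proof (intro subset_antisym subsetI)
  fix A assume "A \<in> SG_vertices rank"
  then have A: "A \<subseteq> {1..nat (2 * N)}" "card A = rank" and st: "\<And>x. \<not> (mem A x \<and> mem A (x + 1))"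
    by (auto simp: SG_vertices_iff)
  let ?E = "{x\<in>{0..<2 * N}. \<not> mem A x \<and> \<not> mem A (x + 1)}"
  \<comment> \<open>The count \<open>2 * (N - 1) + card ?E = 2 * N\<close> forces exactly two
    gaps.\<close>
  have "int (card ?E) = 2" using card_stable[of "mem A"] mem_mod st card_mem[OF A(1)] A(2) N3 by simp
  then have "card ?E = 2" by simp
  then obtain i' j' where "?E = {i', j'}" "i' \<noteq> j'" by (auto simp: card_2_iff)
  then obtain i j where E: "?E = {i, j}" and ij: "i < j" by (metis insert_commute linorder_neqE_linordered_idom)
  have "i \<in> ?E" "j \<in> ?E" unfolding E by simp_all
  then have ir: "0 \<le> i" "j < 2 * N" and na: "\<not> mem A i" "\<not> mem A (i + 1)" "\<not> mem A j" "\<not> mem A (j + 1)"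
    by simp_all
  have shift: "mem A (x + 2 * N) \<longleftrightarrow> mem A x" for x by (simp add: mem_def)
  have alt: "mem A (x + 1) \<longleftrightarrow> \<not> mem A x" if "i < x" "x < i + 2 * N" "x \<noteq> j" for x
  proof (rule ccontr)
    assume "\<not> ?thesis"
    then have n: "\<not> mem A x" "\<not> mem A (x + 1)" using st by auto
    show False
    proof (cases "x < 2 * N")
      case True
      then have "x \<in> ?E" using n that(1) ir(1) by simp
      then have "x \<in> {i, j}" by (simp only: E)
      then show False using that by simp
    next
      case False
      have "mem A (x - 2 * N) \<longleftrightarrow> mem A x" "mem A (x - 2 * N + 1) \<longleftrightarrow> mem A (x + 1)"
        using shift[of "x - 2 * N"] shift[of "x - 2 * N + 1"] by (simp_all only: diff_add_cancel diff_add_eq)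
      moreover have "0 \<le> x - 2 * N" "x - 2 * N < i" using False that(2) by linarith+
      ultimately have "x - 2 * N \<in> ?E" using n ir ij by simp
      then have "x - 2 * N \<in> {i, j}" by (simp only: E)
      then show False using \<open>x - 2 * N < i\<close> ij by simp
    qed
  qed
  have a1: "mem A (i + t) \<longleftrightarrow> even t" if "1 \<le> t" "t \<le> j - i" for t
    by (rule alternates[of i j "mem A"]) (use alt na that ij ir in auto)
  have a2: "mem A (j + t) \<longleftrightarrow> even t" if "1 \<le> t" "t \<le> i + 2 * N - j" for t
    by (rule alternates[of j "i + 2 * N" "mem A"]) (use alt na that ij ir in auto)
  have odd: "odd (j - i)" using a1[of "j - i"] na(3) ij by simp
  have "\<exists>(k, q)\<in>inner. \<forall>x. mem A x \<longleftrightarrow> stab k q x"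
  proof (cases "even i")
    case True
    then show ?thesis using alternating_is_stab[of i j "mem A"] odd ij ir a1 a2 mem_mod by auto
  next
    case False
    \<comment> \<open>Start from the other gap instead: \<open>j\<close> is even because
      \<open>j - i\<close> is odd, and the second gap is now at \<open>i + 2 * N\<close>.\<close>
    have a1': "mem A (i + 2 * N + t) \<longleftrightarrow> even t" if "1 \<le> t" "t \<le> j + 2 * N - (i + 2 * N)" for t
      using a1[of t] shift[of "i + t"] that by (simp add: algebra_simps)
    show ?thesis
      by (rule alternating_is_stab[of j "i + 2 * N" "mem A"]) (use False odd ij ir a1' a2 mem_mod in auto)
  qed
  then obtain k q where kq: "(k, q) \<in> inner" "\<And>x. mem A x \<longleftrightarrow> stab k q x" by blast
  have "vert (k, q) \<subseteq> {1..nat (2 * N)}" by (auto simp: vert_def)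
  then have "A = vert (k, q)" using mem_eq_iff[OF A(1)] kq(2) mem_vert by blast
  then show "A \<in> vert ` inner" using kq(1) by blast
qed (use vert_in_SG_vertices in auto)

sublocale SG: drum_graph N "SG_vertices rank" SG_adj vert
proof
  have sub: "vert (k, q) \<subseteq> {1..nat (2 * N)}" for k q by (auto simp: vert_def)
  show "finite (SG_vertices rank)"
    by (rule finite_subset[of _ "Pow {1..2 * rank + 2}"]) (auto simp: SG_vertices_def)
  show "SG_vertices rank = vert ` inner" by (rule SG_vertices_eq)
  show "vert a = vert b \<longleftrightarrow> same a b" if "a \<in> inner" "b \<in> inner" for a b
  proof -
    obtain k q l r where ab: "a = (k, q)" "b = (l, r)" by fastforce
    have "vert a = vert b \<longleftrightarrow> k = l \<and> 2 * N dvd q - r"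
      using that mem_eq_iff[OF sub sub] stab_eq_iff unfolding ab mem_vert by blast
    then show ?thesis using that by (auto simp: ab same_def inner_def)
  qed
  show "SG_adj (vert (k, q)) (vert (l, r)) \<longleftrightarrow> incident (N + 1 - k) (q + N) l r"
    if "(k, q) \<in> inner" "(l, r) \<in> inner" for k q l r
    using mem_disjoint_iff[OF sub sub] stab_disjoint_iff[OF that] unfolding SG_adj_def mem_vert by blast
qed

end

text \<open>For \<open>n = 1\<close> the end levels have only two vertices and the general argument breaks down, but the
  graph is complete and its neighborhood complex already is the boundary of a tetrahedron.\<close>

lemma tetrahedron_boundary:
  assumes "card V = 4"
  shows "is_boundary_of_simplicial_3_polytope (embed_face ` {F. F \<subset> V})"
proof -
  have "\<exists>S::(real^3) set. \<not> affine_dependent S \<and> card S = 4"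
  proof -
    have "\<not> affine_dependent (insert 0 (Basis :: (real^3) set))"
      using affine_dependent_iff_dependent[of 0 "Basis :: (real^3) set"] independent_Basis by auto
    moreover have "card (insert 0 (Basis :: (real^3) set)) = 4" by (simp add: card_insert_if)
    ultimately show ?thesis by blast
  qed
  then obtain S :: "(real^3) set" where S: "\<not> affine_dependent S" "card S = 4" by blast
  have finS: "finite S" "finite V" using S(2) assms by (metis card.infinite zero_neq_numeral)+
  let ?P = "convex hull S"
  have simplex: "\<exists>k. k simplex F" if F: "F face_of ?P" for F
  proof -
    obtain c where c: "c \<subseteq> S" "F = convex hull c"
      using iffD1[OF face_of_convex_hull_affine_independent[OF S(1)] F] by blast
    then have "(int (card c) - 1) simplex F"
      unfolding simplex_def using affine_independent_subset[OF S(1)] by (intro exI[of _ c]) auto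
    then show ?thesis by blast
  qed
  have ext: "{x. x extreme_point_of convex hull c} = c" if "c \<subseteq> S" for c
    using extreme_point_of_convex_hull_affine_independent affine_independent_subset[OF S(1) that] by blast
  have bd: "boundary_complex ?P = {c. c \<subset> S}"
  proof (intro subset_antisym subsetI)
    fix c assume "c \<in> boundary_complex ?P"
    then obtain F where F: "c = {x. x extreme_point_of F}" "F face_of ?P" "F \<noteq> ?P"
      unfolding boundary_complex_def by blast
    obtain d where d: "d \<subseteq> S" "F = convex hull d"
      using iffD1[OF face_of_convex_hull_affine_independent[OF S(1)] F(2)] by blast
    then have "c = d" "d \<noteq> S" using F ext[OF d(1)] by auto
    then show "c \<in> {c. c \<subset> S}" using d(1) by blast
  next
    fix c assume c: "c \<in> {c. c \<subset> S}"
    then have sub: "c \<subseteq> S" "c \<noteq> S" by auto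
    have "convex hull c face_of ?P"
      by (intro iffD2[OF face_of_convex_hull_affine_independent[OF S(1)]] exI[of _ c] conjI sub(1) refl)
    moreover have "convex hull c \<noteq> ?P"
    proof
      assume "convex hull c = ?P"
      then have "{x. x extreme_point_of convex hull c} = {x. x extreme_point_of ?P}" by (rule arg_cong)
      then have "c = S" unfolding ext[OF sub(1)] ext[OF subset_refl] .
      then show False using sub(2) by blast
    qed
    moreover have "c = {x. x extreme_point_of convex hull c}" using ext[OF sub(1)] by simp
    ultimately show "c \<in> boundary_complex ?P" unfolding boundary_complex_def by blast
  qed
  have dim: "aff_dim ?P = 3" using aff_dim_affine_independent[OF S(1)] S(2) by (simp add: aff_dim_convex_hull)
  obtain h where h: "bij_betw h V S" using finite_same_card_bij[OF finS(2,1)] assms S(2) by auto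
  let ?\<T> = "{F. F \<subset> V}"
  have cov: "\<Union>?\<T> = V"
  proof -
    have "\<exists>F\<subset>V. x \<in> F" if "x \<in> V" for x
    proof (intro exI[of _ "{x}"] conjI psubsetI)
      show "{x} \<noteq> V" using assms by auto
    qed (use that in auto)
    then show ?thesis by blast
  qed
  have "complex_isomorphic {\<sigma>. \<exists>T\<in>?\<T>. \<sigma> \<subseteq> (\<lambda>v. {v}) ` T} {\<sigma>. \<exists>T\<in>?\<T>. \<sigma> \<subseteq> h ` T}"
    using h by (intro complex_isomorphic_image[OF _ cov]) (auto simp: bij_betw_def inj_on_eq_iff)
  moreover have "{\<sigma>. \<exists>T\<in>?\<T>. \<sigma> \<subseteq> (\<lambda>v. {v}) ` T} = embed_face ` {F. F \<subset> V}"
  proof (intro subset_antisym subsetI)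
    fix \<sigma> assume "\<sigma> \<in> {\<sigma>. \<exists>T\<in>?\<T>. \<sigma> \<subseteq> (\<lambda>v. {v}) ` T}"
    then obtain T A where "T \<subset> V" "A \<subseteq> T" "\<sigma> = (\<lambda>v. {v}) ` A" by (auto simp: subset_image_iff)
    then show "\<sigma> \<in> embed_face ` {F. F \<subset> V}" unfolding embed_face_def by blast
  qed (auto simp: embed_face_def)
  moreover have "{\<sigma>. \<exists>T\<in>?\<T>. \<sigma> \<subseteq> h ` T} = {c. c \<subset> S}"
  proof (intro subset_antisym subsetI)
    fix \<sigma> assume "\<sigma> \<in> {\<sigma>. \<exists>T\<in>?\<T>. \<sigma> \<subseteq> h ` T}"
    then obtain T where T: "T \<subset> V" "\<sigma> \<subseteq> h ` T" by blast
    have "h ` T \<subset> h ` V" by (rule image_strict_mono[OF bij_betw_imp_inj_on[OF h] T(1)])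
    then show "\<sigma> \<in> {c. c \<subset> S}" using T(2) h by (auto simp: bij_betw_def)
  next
    fix c assume c: "c \<in> {c. c \<subset> S}"
    then obtain T where T: "T \<subseteq> V" "c = h ` T" using h by (metis bij_betw_def mem_Collect_eq psubset_imp_subset subset_imageE)
    then have "T \<noteq> V" using c h by (auto simp: bij_betw_def)
    then show "c \<in> {\<sigma>. \<exists>T\<in>?\<T>. \<sigma> \<subseteq> h ` T}" using T by blast
  qed
  ultimately have "complex_isomorphic (embed_face ` {F. F \<subset> V}) (boundary_complex ?P)" using bd by simp
  moreover have "simplicial_polytope ?P"
    unfolding simplicial_polytope_def using simplex finS(1) facet_of_imp_face_of by (auto simp: polytope_def)
  ultimately show ?thesis unfolding is_boundary_of_simplicial_3_polytope_def using dim by blast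
qed

lemma SG_vertices_1: "SG_vertices 1 = {{1}, {2}, {3}, {4}}"
proof -
  have "A \<in> SG_vertices 1 \<longleftrightarrow> (\<exists>x\<in>{1..4}. A = {x})" for A
    unfolding SG_vertices_def by (auto simp: card_1_singleton_iff)
  then have "SG_vertices 1 = (\<lambda>x. {x}) ` {1..4}" by blast
  moreover have "{1..4::nat} = {1, 2, 3, 4}" by auto
  ultimately show ?thesis by simp
qed

text \<open>In a complete graph a common neighbour of \<open>F\<close> is any vertex outside
  \<open>F\<close>.\<close>

lemma neighborhood_complex_SG_1:
  "neighborhood_complex (SG_vertices 1) SG_adj = {F. F \<subset> SG_vertices 1}"
  (is "?K = _")
proof (intro subset_antisym subsetI)
  fix F assume "F \<in> ?K"
  then obtain A where A: "F \<subseteq> SG_vertices 1" "A \<in> SG_vertices 1" "\<forall>B\<in>F. A \<inter> B = {}"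
    by (auto simp: neighborhood_complex_def SG_adj_def)
  then have "A \<notin> F" unfolding SG_vertices_1 by auto
  then show "F \<in> {F. F \<subset> SG_vertices 1}" using A by blast
next
  fix F assume "F \<in> {F. F \<subset> SG_vertices 1}"
  then obtain A where A: "F \<subseteq> SG_vertices 1" "A \<in> SG_vertices 1" "A \<notin> F" by blast
  have "A \<inter> B = {}" if "B \<in> F" for B
  proof -
    have "B \<in> SG_vertices 1" "A \<noteq> B" using A that by auto
    then show ?thesis using A(2) unfolding SG_vertices_1 by auto
  qed
  then show "F \<in> ?K" using A unfolding neighborhood_complex_def SG_adj_def by blast
qed

lemma theorem1p3_complete_graph:
  "\<exists>K L. partial_subdivision (neighborhood_complex (SG_vertices 1) SG_adj) K
     \<and> aut_invariant (SG_vertices 1) SG_adj K \<and> collapses K L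
     \<and> is_boundary_of_simplicial_3_polytope L \<and> aut_invariant (SG_vertices 1) SG_adj L"
proof -
  let ?V = "SG_vertices 1"
  let ?K = "embed_face ` {F. F \<subset> ?V}"
  have card: "card ?V = 4" unfolding SG_vertices_1 by simp
  have "partial_subdivision (neighborhood_complex ?V SG_adj) ?K"
    unfolding neighborhood_complex_SG_1 by (rule partial_subdivision.start)
  moreover have "aut_invariant ?V SG_adj ?K"
  proof (rule aut_invariantI)
    have "finite ?V" unfolding SG_vertices_1 by simp
    then show "finite ?K" by (intro finite_imageI finite_subset[of "{F. F \<subset> ?V}" "Pow ?V"]) auto
    show "\<sigma> \<subseteq> Pow ?V" if "\<sigma> \<in> ?K" for \<sigma> using that by (auto simp: embed_face_def)
    fix \<phi> \<sigma> assume \<phi>: "graph_automorphism ?V SG_adj \<phi>" and "\<sigma> \<in> ?K"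
    then obtain F where F: "F \<subset> ?V" "\<sigma> = embed_face F" by blast
    have "\<phi> ` F \<subset> \<phi> ` ?V"
      by (rule image_strict_mono[OF _ F(1)]) (use \<phi> in \<open>simp add: graph_automorphism_def bij_betw_def\<close>)
    then show "induced_action \<phi> \<sigma> \<in> ?K"
      using \<phi> unfolding F(2) induced_action_embed_face by (auto simp: graph_automorphism_def bij_betw_def)
  qed
  moreover have "collapses ?K ?K" by (simp add: collapses_def)
  ultimately show ?thesis using tetrahedron_boundary[OF card] by blast
qed

theorem theorem1p3:
  fixes n :: nat
  assumes "n \<ge> 1"
  shows "\<exists>K L. partial_subdivision (neighborhood_complex (SG_vertices n) SG_adj) K
           \<and> aut_invariant (SG_vertices n) SG_adj K
           \<and> collapses K L
           \<and> is_boundary_of_simplicial_3_polytope L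
           \<and> aut_invariant (SG_vertices n) SG_adj L"
proof (cases "n = 1")
  case True
  then show ?thesis using theorem1p3_complete_graph by simp
next
  case False
  then interpret levels "int n + 1" using assms by unfold_locales auto
  have n: "nat (int n + 1 - 1) = n" by simp
  show ?thesis
    using SG.partial_subdivision_subdivided SG.aut_invariant_subdivided SG.collapses_subdivided_sphere
      SG.sphere_polytopal SG.aut_invariant_sphere unfolding n by blast
qed

end
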